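(* The following decision problem is in PSPACE. Input: a positive integer $\ell$ and a synchronizing DFA $\mathscr{A}$. Question: does the ideal language $L=\mathrm{Syn}(\mathscr{A})$ satisfy $rc(L)\leq\ell$?
   Context: A deterministic finite automaton (DFA, or simply automaton) here is a triple $\mathscr{A}=\langle Q,\Sigma,\delta\rangle$ with $Q$ a finite nonempty state set, $\Sigma$ a finite alphabet and $\delta:Q\times\Sigma\to Q$ a total transition function, extended in the usual way to $\delta:Q\times\Sigma^*\to Q$. A word $w\in\Sigma^*$ is reset for $\mathscr{A}$ if $\delta(q,w)=\delta(q',w)$ for all $q,q'\in Q$; $\mathscr{A}$ is synchronizing if it has a reset word. $\mathrm{Syn}(\mathscr{A})\subseteq\Sigma^*$ is the set of all reset words of $\mathscr{A}$. It is a regular language and an ideal, i.e. $\mathrm{Syn}(\mathscr{A})=\Sigma^*\mathrm{Syn}(\mathscr{A})\Sigma^*$. The reset complexity $rc(L)$ of a (nonempty) regular ideal language $L\subseteq\Sigma^*$ is the minimal number of states of a synchronizing automaton $\mathscr{B}$ over $\Sigma$ with $\mathrm{Syn}(\mathscr{B})=L$. The ideal language $L$ is presented by the automaton $\mathscr{A}$, given by its transition table. *)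

theory Defs
  imports "HOL-Computational_Algebra.Polynomial"
begin

section \<open>Deterministic finite automata and reset complexity\<close>

record ('q, 'a) dfa =
  states :: "'q set"
  alphabet :: "'a set"
  delta :: "'q \<Rightarrow> 'a \<Rightarrow> 'q"

definition is_dfa :: "('q, 'a) dfa \<Rightarrow> bool" where
  "is_dfa A \<longleftrightarrow>
     finite (states A) \<and> states A \<noteq> {} \<and> finite (alphabet A) \<and>
     (\<forall>q\<in>states A. \<forall>a\<in>alphabet A. delta A q a \<in> states A)"

definition delta_word :: "('q, 'a) dfa \<Rightarrow> 'q \<Rightarrow> 'a list \<Rightarrow> 'q" where
  "delta_word A q w = foldl (delta A) q w"

definition Syn :: "('q, 'a) dfa \<Rightarrow> 'a list set" where
  "Syn A = {w \<in> lists (alphabet A).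
     \<forall>q\<in>states A. \<forall>q'\<in>states A. delta_word A q w = delta_word A q' w}"

definition synchronizing :: "('q, 'a) dfa \<Rightarrow> bool" where
  "synchronizing A \<longleftrightarrow> Syn A \<noteq> {}"

text \<open>
  The automata over \<open>\<Sigma>\<close> range over those whose states are natural numbers; lemma
  \<open>rc_le_card_states\<close> below shows that this is no restriction. The least element exists
  whenever \<open>L\<close> is the set of reset words of a synchronizing automaton over \<open>\<Sigma>\<close>.
\<close>

definition rc :: "'a set \<Rightarrow> 'a list set \<Rightarrow> nat" where
  "rc \<Sigma> L = (LEAST m. \<exists>B :: (nat, 'a) dfa.
     is_dfa B \<and> alphabet B = \<Sigma> \<and> synchronizing B \<and> Syn B = L \<and> card (states B) = m)"

lemma delta_word_in_states:
  assumes "is_dfa A" "q \<in> states A" "w \<in> lists (alphabet A)"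
  shows "delta_word A q w \<in> states A"
  using assms(2,3)
  by (induction w arbitrary: q) (use assms(1) in \<open>auto simp: delta_word_def is_dfa_def\<close>)

lemma rc_le_card_states:
  fixes A :: "('q, 'a) dfa"
  assumes A: "is_dfa A" "synchronizing A"
  shows "rc (alphabet A) (Syn A) \<le> card (states A)"
proof -
  obtain f :: "'q \<Rightarrow> nat" where f: "inj_on f (states A)"
    using A(1) finite_imp_inj_to_nat_seg[of "states A"] by (auto simp: is_dfa_def)
  define g where "g = inv_into (states A) f"
  have gf: "g (f q) = q" if "q \<in> states A" for q
    using that f by (simp add: g_def)
  define B :: "(nat, 'a) dfa" where
    "B = \<lparr>states = f ` states A, alphabet = alphabet A, delta = (\<lambda>q a. f (delta A (g q) a))\<rparr>"
  have B: "states B = f ` states A" "alphabet B = alphabet A"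
    "\<And>q a. delta B q a = f (delta A (g q) a)"
    by (simp_all add: B_def)
  have "is_dfa B"
    using A(1) by (auto simp: is_dfa_def B gf)
  have word: "delta_word B (f q) w = f (delta_word A q w)"
    if "q \<in> states A" "w \<in> lists (alphabet A)" for q w
    using that
    by (induction w arbitrary: q) (use A(1) in \<open>auto simp: delta_word_def B gf is_dfa_def\<close>)
  have "delta_word B (f q) w = delta_word B (f q') w \<longleftrightarrow> delta_word A q w = delta_word A q' w"
    if "q \<in> states A" "q' \<in> states A" "w \<in> lists (alphabet A)" for q q' w
    using that f by (simp add: word delta_word_in_states[OF A(1)] inj_on_eq_iff)
  then have "Syn B = Syn A"
    unfolding Syn_def B(1,2) by (intro Collect_cong conj_cong refl) simp
  moreover have "card (states B) = card (states A)"
    using f by (simp add: B card_image)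
  ultimately show ?thesis
    unfolding rc_def using \<open>is_dfa B\<close> A(2) B(2)
    by (intro Least_le exI[of _ B]) (simp add: synchronizing_def)
qed


section \<open>Polynomial space\<close>

text \<open>
  Deterministic Turing machines with finitely many two-way infinite read-write tapes. The input
  alphabet is the finite type \<open>'a\<close>; besides the blank and the input letters a machine may use
  finitely many auxiliary symbols.
\<close>

datatype 'a symbol = Blank | Inp 'a | Aux nat

datatype move = Left | Stay | Right

record 'a tm =
  num_tapes :: nat
  control :: "nat set"
  tape_alphabet :: "'a symbol set"
  start :: nat
  accept :: nat
  reject :: nat
  trans :: "nat \<Rightarrow> 'a symbol list \<Rightarrow> nat \<times> ('a symbol \<times> move) list"

definition is_tm :: "('a::finite) tm \<Rightarrow> bool" where
  "is_tm M \<longleftrightarrow>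
     num_tapes M \<ge> 1 \<and> finite (control M) \<and>
     start M \<in> control M \<and> accept M \<in> control M \<and> reject M \<in> control M \<and>
     accept M \<noteq> reject M \<and>
     finite (tape_alphabet M) \<and> insert Blank (range Inp) \<subseteq> tape_alphabet M \<and>
     (\<forall>q\<in>control M. \<forall>xs. length xs = num_tapes M \<and> set xs \<subseteq> tape_alphabet M \<longrightarrow>
        (case trans M q xs of (q', acts) \<Rightarrow>
           q' \<in> control M \<and> length acts = num_tapes M \<and> fst ` set acts \<subseteq> tape_alphabet M))"

text \<open>A tape is given by the position of its head and its contents.\<close>

type_synonym 'a tape = "int \<times> (int \<Rightarrow> 'a symbol)"

type_synonym 'a config = "nat \<times> 'a tape list"

definition empty_tape :: "'a tape" where
  "empty_tape = (0, \<lambda>_. Blank)"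

definition input_tape :: "'a list \<Rightarrow> 'a tape" where
  "input_tape w =
     (0, \<lambda>i. if 0 \<le> i \<and> i < int (length w) then Inp (w ! nat i) else Blank)"

definition initial :: "'a tm \<Rightarrow> 'a list \<Rightarrow> 'a config" where
  "initial M w = (start M, input_tape w # replicate (num_tapes M - 1) empty_tape)"

fun displacement :: "move \<Rightarrow> int" where
  "displacement Left = -1"
| "displacement Stay = 0"
| "displacement Right = 1"

fun act :: "'a symbol \<times> move \<Rightarrow> 'a tape \<Rightarrow> 'a tape" where
  "act (x, d) (h, t) = (h + displacement d, t(h := x))"

definition halting :: "'a tm \<Rightarrow> nat \<Rightarrow> bool" where
  "halting M q \<longleftrightarrow> q = accept M \<or> q = reject M"

fun step :: "'a tm \<Rightarrow> 'a config \<Rightarrow> 'a config" where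
  "step M (q, ts) =
     (if halting M q then (q, ts)
      else case trans M q (map (\<lambda>(h, t). t h) ts) of (q', acts) \<Rightarrow> (q', map2 act acts ts))"

definition run :: "'a tm \<Rightarrow> 'a list \<Rightarrow> nat \<Rightarrow> 'a config" where
  "run M w n = (step M ^^ n) (initial M w)"

definition halts :: "'a tm \<Rightarrow> 'a list \<Rightarrow> bool" where
  "halts M w \<longleftrightarrow> (\<exists>n. halting M (fst (run M w n)))"

definition accepts :: "'a tm \<Rightarrow> 'a list \<Rightarrow> bool" where
  "accepts M w \<longleftrightarrow> (\<exists>n. fst (run M w n) = accept M)"

definition visited_cells :: "'a tm \<Rightarrow> 'a list \<Rightarrow> nat \<Rightarrow> int set" where
  "visited_cells M w i = {fst (snd (run M w n) ! i) | n. True}"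

text \<open>
  Only meaningful if \<open>M\<close> halts on \<open>w\<close>: the configuration is constant after halting, so the sets
  of visited cells are then finite, whereas \<open>card\<close> is 0 on infinite sets.
\<close>

definition space_used :: "'a tm \<Rightarrow> 'a list \<Rightarrow> nat" where
  "space_used M w = (\<Sum>i<num_tapes M. card (visited_cells M w i))"

definition PSPACE :: "('a::finite) list set set" where
  "PSPACE = {L. \<exists>(M :: 'a tm) (p :: nat poly). is_tm M \<and>
     (\<forall>w. halts M w \<and> (accepts M w \<longleftrightarrow> w \<in> L) \<and> space_used M w \<le> poly p (length w))}"

lemma halts_imp_finite_visited_cells:
  assumes "halts M w"
  shows "finite (visited_cells M w i)"
proof -
  obtain n where n: "halting M (fst (run M w n))"
    using assms by (auto simp: halts_def)
  have const: "run M w (n + k) = run M w n" for k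
  proof (induction k)
    case (Suc k)
    have "run M w (n + Suc k) = step M (run M w (n + k))"
      by (simp add: run_def)
    also have "\<dots> = run M w n"
      using Suc n by (cases "run M w n") simp
    finally show ?case .
  qed simp
  have "run M w m \<in> run M w ` {..n}" for m
    using const[of "m - n"] by (cases "m \<le> n") auto
  then have "visited_cells M w i \<subseteq> (\<lambda>c. fst (snd c ! i)) ` run M w ` {..n}"
    by (auto simp: visited_cells_def)
  then show ?thesis
    by (rule finite_subset) simp
qed


section \<open>Encoding of instances\<close>

datatype letter = Zero | One | Sep

lemma UNIV_letter: "UNIV = {Zero, One, Sep}"
  using letter.exhaust by auto

instance letter :: finite
  by standard (simp add: UNIV_letter)

text \<open>Binary notation, least significant bit first; the number 0 is denoted by the empty word.\<close>

fun binary :: "nat \<Rightarrow> letter list" where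
  "binary n = (if n = 0 then [] else (if odd n then One else Zero) # binary (n div 2))"

declare binary.simps [simp del]

definition encode_nats :: "nat list \<Rightarrow> letter list" where
  "encode_nats ns = concat (map (\<lambda>n. binary n @ [Sep]) ns)"

text \<open>As an input, an automaton has the states \<open>0, \<dots>, n - 1\<close> and the letters \<open>0, \<dots>, k - 1\<close>.\<close>

definition is_input_dfa :: "(nat, nat) dfa \<Rightarrow> bool" where
  "is_input_dfa A \<longleftrightarrow>
     is_dfa A \<and> (\<exists>n. states A = {0..<n}) \<and> (\<exists>k. alphabet A = {0..<k})"

definition transition_table :: "(nat, nat) dfa \<Rightarrow> nat list" where
  "transition_table A =
     concat (map (\<lambda>q. map (delta A q) [0..<card (alphabet A)]) [0..<card (states A)])"

definition encode_instance :: "nat \<Rightarrow> (nat, nat) dfa \<Rightarrow> letter list" where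
  "encode_instance l A =
     encode_nats (l # card (states A) # card (alphabet A) # transition_table A)"

lemma binary_inject: "binary m = binary n \<Longrightarrow> m = n"
proof (induction m arbitrary: n rule: less_induct)
  case (less m)
  show ?case
  proof (cases "m = 0 \<or> n = 0")
    case True
    then show ?thesis
      using less.prems by (auto simp: binary.simps[of m] binary.simps[of n] split: if_splits)
  next
    case False
    then have "binary (m div 2) = binary (n div 2)" and parity: "odd m = odd n"
      using less.prems by (auto simp: binary.simps[of m] binary.simps[of n] split: if_splits)
    then have "m div 2 = n div 2"
      using less.IH[of "m div 2"] False by simp
    then show ?thesis
      using parity by (metis even_two_times_div_two odd_two_times_div_two_succ)
  qed
qed

lemma Sep_notin_binary: "Sep \<notin> set (binary n)"
proof (induction n rule: less_induct)
  case (less n)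
  then show ?case
    by (subst binary.simps) auto
qed

lemma encode_nats_inject: "encode_nats ms = encode_nats ns \<Longrightarrow> ms = ns"
proof (induction ms arbitrary: ns)
  case Nil
  then show ?case by (cases ns) (auto simp: encode_nats_def)
next
  case (Cons m ms)
  then obtain n ns' where ns: "ns = n # ns'"
    by (cases ns) (auto simp: encode_nats_def)
  have eq: "binary m @ Sep # encode_nats ms = binary n @ Sep # encode_nats ns'"
    using Cons.prems by (simp add: ns encode_nats_def)
  have head: "takeWhile (\<lambda>x. x \<noteq> Sep) (binary k @ Sep # xs) = binary k" for k xs
    using Sep_notin_binary[of k] by (subst takeWhile_append2) auto
  have "binary m = binary n"
    using arg_cong[OF eq, of "takeWhile (\<lambda>x. x \<noteq> Sep)"] by (simp only: head)
  with eq show ?case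
    using Cons.IH[of ns'] binary_inject[of m n] by (simp add: ns)
qed

lemma encode_instance_inject:
  assumes A: "is_input_dfa A" and B: "is_input_dfa B"
    and eq: "encode_instance l A = encode_instance l' B"
  shows "l = l'" "states A = states B" "alphabet A = alphabet B"
    "\<forall>q\<in>states A. \<forall>a\<in>alphabet A. delta A q a = delta B q a"
proof -
  have "l # card (states A) # card (alphabet A) # transition_table A =
      l' # card (states B) # card (alphabet B) # transition_table B"
    using encode_nats_inject eq unfolding encode_instance_def by blast
  then have *: "l = l'" "card (states A) = card (states B)"
      "card (alphabet A) = card (alphabet B)" "transition_table A = transition_table B"
    by simp_all
  show "l = l'" by fact
  show st: "states A = states B" and al: "alphabet A = alphabet B"
    using A B * by (auto simp: is_input_dfa_def)
  obtain n k where nk: "states A = {0..<n}" "alphabet A = {0..<k}"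
    using A by (auto simp: is_input_dfa_def)
  have rows: "concat (map f xs) = concat (map g xs) \<Longrightarrow> (\<And>x. length (f x) = length (g x)) \<Longrightarrow>
      \<forall>x\<in>set xs. f x = g x" for f g :: "nat \<Rightarrow> nat list" and xs
    by (induction xs) auto
  have "\<forall>q\<in>set [0..<n]. map (delta A q) [0..<k] = map (delta B q) [0..<k]"
    by (rule rows) (use *(4) nk st al in \<open>simp_all add: transition_table_def\<close>)
  then show "\<forall>q\<in>states A. \<forall>a\<in>alphabet A. delta A q a = delta B q a"
    by (auto simp: nk)
qed

end

theory Submission imports Defs begin

text \<open>
  Since \<open>rc L\<close> is at most the number \<open>n\<close> of states of the given automaton \<open>A\<close>, it suffices to try all
  automata \<open>B\<close> with at most \<open>min l n\<close> states. A word acts on the states of \<open>A\<close> and \<open>B\<close> simultaneously,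
  and \<open>Syn A = Syn B\<close> holds iff every reachable vector of images is constant on the states of \<open>A\<close>
  exactly if it is constant on those of \<open>B\<close>. The vectors have polynomial length, so that their
  reachability is decided by Savitch's recursion, whose game tree is traversed leaf by leaf.

  Time is irrelevant, so all data are natural numbers of polynomially many bits in the registers of a
  counter program, and a Turing machine keeps them on its tapes in binary. The functions computed in
  this way are closed under arithmetic, bounded quantification and bounded recursion.
\<close>

section \<open>Counter programs on Turing machines\<close>

text \<open>A loop may run exponentially often but carries a single number, so recursion with a
  stack is not directly available. This shapes the treatment of Savitch's recursion: the number of a
  leaf, read to the base \<open>K\<close>, already lists all decisions on its path from the root.
  One number replaces the stack, and passing to the next relevant leaf is one arithmetic update.
  Since reachability is thereby decided deterministically, the guess of \<open>B\<close> and the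
  quantification over reachable vectors are plain bounded quantifiers.

  Two further obstacles concern sizes. The numbers of states and letters are written in binary, and
  it is the complete transition table that keeps them polynomial in the input length. Moreover, a
  size bound must hold for all values of the arguments, even for those that a neighbouring conjunct
  excludes, because every subexpression is evaluated; hence an argument is sometimes capped
  artificially.\<close>

fun bits_val :: "bool list \<Rightarrow> nat" where
  "bits_val [] = 0"
| "bits_val (b # bs) = of_bool b + 2 * bits_val bs"

fun inc_bits :: "bool list \<Rightarrow> bool list" where
  "inc_bits [] = [True]"
| "inc_bits (b # bs) = (if b then False # inc_bits bs else True # bs)"

fun dec_bits :: "bool list \<Rightarrow> bool list" where
  "dec_bits [] = []"
| "dec_bits (b # bs) = (if b then False # bs else True # dec_bits bs)"

lemma bits_val_inc: "bits_val (inc_bits bs) = Suc (bits_val bs)"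
  by (induction bs) auto

lemma bits_val_dec: "bits_val bs > 0 \<Longrightarrow> bits_val (dec_bits bs) = bits_val bs - 1"
  by (induction bs) auto

lemma length_dec_bits [simp]: "length (dec_bits bs) = length bs"
  by (induction bs) auto

lemma bits_val_replicate_False [simp]: "bits_val (replicate n False) = 0"
  by (induction n) auto

text \<open>The word grows only by a carry out of the top digit, which requires all digits to be
  one. As long as values stay below \<open>2 ^ W\<close>, the width \<open>W\<close> is therefore
  never exceeded, even by words with leading zeros.\<close>

lemma length_inc_bits:
  "length (inc_bits bs) = length bs \<or>
     length (inc_bits bs) = Suc (length bs) \<and> Suc (bits_val bs) = 2 ^ length bs"
  by (induction bs) auto

lemma length_inc_bits_le:
  assumes "length bs \<le> W" "Suc (bits_val bs) < 2 ^ W"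
  shows "length (inc_bits bs) \<le> W"
  using length_inc_bits[of bs]
proof
  assume "length (inc_bits bs) = Suc (length bs) \<and> Suc (bits_val bs) = 2 ^ length bs"
  then have "(2::nat) ^ length bs < 2 ^ W" "length (inc_bits bs) = Suc (length bs)"
    using assms by auto
  then show ?thesis
    using power_less_imp_less_exp[of "2::nat" "length bs" W] by simp
qed (use assms in simp)

abbreviation dig :: "bool \<Rightarrow> letter symbol" where
  "dig b \<equiv> Inp (if b then One else Zero)"

text \<open>
  A register is stored from cell 1 on, least significant bit first and possibly with leading zeros;
  cell 0 holds a marker. Between two instructions all heads of register tapes rest on cell 1.
\<close>

definition tape_of :: "bool list \<Rightarrow> int \<Rightarrow> letter symbol" where
  "tape_of bs i = (if i = 0 then Aux 0
     else if 1 \<le> i \<and> i \<le> int (length bs) then dig (bs ! nat (i - 1)) else Blank)"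

lemma tape_of_0 [simp]: "tape_of bs 0 = Aux 0"
  by (simp add: tape_of_def)

lemma tape_of_at [simp]:
  "tape_of (ls @ b # bs) (1 + int (length ls)) = dig b"
  by (simp add: tape_of_def)

lemma tape_of_end [simp]:
  "tape_of ls (1 + int (length ls)) = Blank"
  by (simp add: tape_of_def)

lemma tape_of_upd [simp]:
  "(tape_of (ls @ b # bs))(1 + int (length ls) := dig c) = tape_of (ls @ c # bs)"
  by (rule ext) (auto simp: tape_of_def nth_append nth_Cons' nat_eq_iff)

lemma tape_of_snoc:
  "(tape_of ls)(1 + int (length ls) := dig c) = tape_of (ls @ [c])"
  by (rule ext) (auto simp: tape_of_def nth_append nth_Cons' nat_eq_iff)

lemma tape_of_ne_0: "0 < i \<Longrightarrow> tape_of bs i \<noteq> Aux 0"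
  by (simp add: tape_of_def)


section \<open>Translation of counter instructions into machine transitions\<close>

datatype instr = INC nat | DJZ nat nat | JMP nat

text \<open>A jump uses no register. The 0 is a dummy: the machine rewrites the scanned symbol of
  that tape unchanged.\<close>

fun reg :: "instr \<Rightarrow> nat" where
  "reg (INC r) = r"
| "reg (DJZ r t) = r"
| "reg (JMP t) = 0"

definition addr :: "nat \<Rightarrow> nat \<Rightarrow> nat" where
  "addr pc j = 4 + 3 * pc + j"

text \<open>Targets beyond the rejecting address \<open>N + 1\<close> are clamped to it, so that
  arbitrary jump targets stay within the finite control.\<close>

definition loc :: "nat \<Rightarrow> nat \<Rightarrow> nat" where
  "loc N pc = addr (min pc (N + 1)) 0"

text \<open>Phase 0 propagates the carry or borrow to the right, and phase 1 runs back to the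
  marker. That the value was zero shows only when the borrow leaves the digits, after all zeros have
  become ones; phase 2 undoes this on the way back. An increment also writes a one on a blank, which
  lengthens the number.\<close>

fun micro :: "nat \<Rightarrow> nat \<Rightarrow> instr \<Rightarrow> nat \<Rightarrow> letter symbol \<Rightarrow> nat \<times> letter symbol \<times> move" where
  "micro N pc (INC r) j x =
     (if j = 0 then if x = Inp One then (addr pc 0, Inp Zero, Right) else (addr pc 1, Inp One, Left)
      else if x = Aux 0 then (loc N (pc + 1), x, Right) else (addr pc 1, x, Left))"
| "micro N pc (DJZ r t) j x =
     (if j = 0 then
        if x = Inp Zero then (addr pc 0, Inp One, Right)
        else if x = Inp One then (addr pc 1, Inp Zero, Left)
        else (addr pc 2, x, Left)
      else if j = 1 then
        if x = Aux 0 then (loc N (pc + 1), x, Right) else (addr pc 1, x, Left)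
      else
        if x = Aux 0 then (loc N t, x, Right) else (addr pc 2, Inp Zero, Left))"
| "micro N pc (JMP t) j x = (loc N t, x, Stay)"

definition keep :: "letter symbol list \<Rightarrow> (letter symbol \<times> move) list" where
  "keep xs = map (\<lambda>x. (x, Stay)) xs"

text \<open>
  The control states 0 to 3 mark the register tapes, copy the input to the first of them and rewind
  it; \<open>addr pc j\<close> is phase \<open>j\<close> of the instruction at \<open>pc\<close>. Leaving the program at its end means
  acceptance, jumping one instruction further means rejection.
\<close>

definition asm_trans ::
  "instr list \<Rightarrow> nat \<Rightarrow> nat \<Rightarrow> letter symbol list \<Rightarrow> nat \<times> (letter symbol \<times> move) list" where
  "asm_trans P k q xs =
    (if q = 0 then (1, (xs ! 0, Stay) # replicate k (Aux 0, Right))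
     else if q = 1 then
       (case xs ! 0 of
          Inp a \<Rightarrow> (2, (keep xs)[1 := (dig (a \<noteq> One), Right)])
        | _ \<Rightarrow> (3, (keep xs)[1 := (xs ! 1, Left)]))
     else if q = 2 then
       (case xs ! 0 of
          Inp a \<Rightarrow> (1, (keep xs)[1 := (dig (a \<noteq> Zero), Right), 0 := (xs ! 0, Right)])
        | _ \<Rightarrow> (1, keep xs))
     else if q = 3 then
       (if xs ! 1 = Aux 0 then (loc (length P) 0, (keep xs)[1 := (xs ! 1, Right)])
        else (3, (keep xs)[1 := (xs ! 1, Left)]))
     else let pc = (q - 4) div 3; j = (q - 4) mod 3 in
       if pc < length P then
         case micro (length P) pc (P ! pc) j (xs ! Suc (reg (P ! pc))) of
           (q', a) \<Rightarrow> (q', (keep xs)[Suc (reg (P ! pc)) := a])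
       else (q, keep xs))"

definition asm_tm :: "instr list \<Rightarrow> nat \<Rightarrow> letter tm" where
  "asm_tm P k = \<lparr>num_tapes = Suc k, control = {..addr (length P + 1) 2},
     tape_alphabet = insert Blank (insert (Aux 0) (range Inp)), start = 0,
     accept = addr (length P) 0, reject = addr (length P + 1) 0, trans = asm_trans P k\<rparr>"

lemma loc_le: "loc N pc \<le> addr (N + 1) 2"
  by (simp add: loc_def addr_def min_def)

lemma addr_le: "pc < N \<Longrightarrow> j \<le> 2 \<Longrightarrow> addr pc j \<le> addr (N + 1) 2"
  by (simp add: addr_def)

lemma micro_ctrl:
  assumes "pc < N" "x \<in> S" "range Inp \<subseteq> S"
  shows "fst (micro N pc ins j x) \<le> addr (N + 1) 2 \<and> fst (snd (micro N pc ins j x)) \<in> S"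
proof -
  have "Inp a \<in> S" for a
    using assms(3) by auto
  moreover have "loc N pc' \<le> addr (N + 1) 2" "addr pc 0 \<le> addr (N + 1) 2"
    "addr pc 1 \<le> addr (N + 1) 2" "addr pc 2 \<le> addr (N + 1) 2" for pc'
    using loc_le addr_le[OF assms(1)] by auto
  ultimately show ?thesis
    using assms(2)
    by (cases ins; cases "j = 0"; cases "j = 1"; cases "x = Aux 0"; cases "x = Inp One";
      cases "x = Inp Zero") simp_all
qed

lemma addr_decode:
  assumes "j < 3"
  shows "(addr pc j - 4) div 3 = pc" "(addr pc j - 4) mod 3 = j"
proof -
  have "addr pc j - 4 = j + pc * 3"
    by (simp add: addr_def)
  then show "(addr pc j - 4) div 3 = pc" "(addr pc j - 4) mod 3 = j"
    using assms by simp_all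
qed

lemma length_keep [simp]: "length (keep xs) = length xs"
  by (simp add: keep_def)

lemma map_fst_keep [simp]: "map fst (keep xs) = xs"
  by (simp add: keep_def comp_def)

lemma set_keep: "fst ` set (keep xs) = set xs"
  by (simp flip: set_map)

lemma set_keep_update:
  assumes "set xs \<subseteq> S" "x \<in> S"
  shows "fst ` set ((keep xs)[i := (x, d)]) \<subseteq> S"
  using set_update_subsetI[OF assms, of i] by (simp add: map_update flip: set_map)

lemma set_keep_update2:
  assumes "set xs \<subseteq> S" "x \<in> S" "y \<in> S"
  shows "fst ` set ((keep xs)[i := (x, d), j := (y, e)]) \<subseteq> S"
  using set_update_subsetI[OF set_update_subsetI[OF assms(1,2), of i] assms(3), of j]
  by (simp add: map_update flip: set_map)

lemma is_tm_asm:
  assumes k: "k \<ge> 1" and regs: "\<forall>ins\<in>set P. reg ins < k"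
  shows "is_tm (asm_tm P k)"
proof -
  define S :: "letter symbol set" where "S = insert Blank (insert (Aux 0) (range Inp))"
  have S: "Blank \<in> S" "Aux 0 \<in> S" "Inp a \<in> S" "range Inp \<subseteq> S" for a
    by (auto simp: S_def)
  have main: "case asm_trans P k q xs of (q', acts) \<Rightarrow>
      q' \<le> addr (length P + 1) 2 \<and> length acts = Suc k \<and> fst ` set acts \<subseteq> S"
    if q: "q \<le> addr (length P + 1) 2" and len: "length xs = Suc k" and xs: "set xs \<subseteq> S" for q xs
  proof -
    have in_S: "xs ! i \<in> S" if "i < Suc k" for i
      using nth_mem[of i xs] that len xs by auto
    have s: "1 \<le> addr (length P + 1) 2" "2 \<le> addr (length P + 1) 2" "3 \<le> addr (length P + 1) 2"
      "loc (length P) 0 \<le> addr (length P + 1) 2"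
      by (auto simp: addr_def loc_def)
    note up = set_keep_update[OF xs]
    have x01: "xs ! 0 \<in> S" "xs ! 1 \<in> S"
      using k by (auto intro!: in_S)
    consider "q = 0" | "q = 1" | "q = 2" | "q = 3" | "q \<ge> 4" by linarith
    then show ?thesis
    proof cases
      case 1
      have "fst ` set ((xs ! 0, Stay) # replicate k (Aux 0, Right)) \<subseteq> S"
        using x01(1) S by (auto simp: set_replicate_conv_if)
      then show ?thesis
        using 1 s by (simp add: asm_trans_def)
    next
      case 2
      show ?thesis
        using 2 s len up[OF S(3)] up[OF x01(2)]
        by (simp add: asm_trans_def split: symbol.split)
    next
      case 3
      show ?thesis
        using 3 s len set_keep_update2[OF xs S(3) S(3)] xs
        by (simp add: asm_trans_def set_keep split: symbol.split)
    next
      case 4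
      show ?thesis
        using 4 s len up[OF S(2)] up[OF x01(2)] by (simp add: asm_trans_def)
    next
      case 5
      define pc j where "pc = (q - 4) div 3" and "j = (q - 4) mod 3"
      show ?thesis
      proof (cases "pc < length P")
        case True
        obtain q' y d where m: "micro (length P) pc (P ! pc) j (xs ! Suc (reg (P ! pc))) = (q', y, d)"
          by (metis prod_cases3)
        have "xs ! Suc (reg (P ! pc)) \<in> S"
          by (rule in_S) (use regs True in auto)
        then have mm: "q' \<le> addr (length P + 1) 2" "y \<in> S"
          using micro_ctrl[OF True, of "xs ! Suc (reg (P ! pc))" S "P ! pc" j] m S(4) by simp_all
        then show ?thesis
          using 5 True m len up[OF mm(2)]
          unfolding asm_trans_def pc_def[symmetric] j_def[symmetric]
          by (simp add: Let_def)
      next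
        case False
        then show ?thesis
          using 5 q len xs unfolding asm_trans_def pc_def[symmetric] j_def[symmetric]
          by (simp add: Let_def set_keep)
      qed
    qed
  qed
  show ?thesis
    unfolding is_tm_def
    using main S by (auto simp: asm_tm_def addr_def S_def)
qed


text \<open>The predicate \<open>G\<close> is demanded of every configuration on the way, since
  space depends on the whole run and not only on its end.\<close>

inductive reaches :: "'a tm \<Rightarrow> ('a config \<Rightarrow> bool) \<Rightarrow> 'a config \<Rightarrow> 'a config \<Rightarrow> bool"
  for M :: "'a tm" and G :: "'a config \<Rightarrow> bool" where
  stop: "G c \<Longrightarrow> reaches M G c c"
| go: "G c \<Longrightarrow> reaches M G (step M c) c' \<Longrightarrow> reaches M G c c'"

lemma reaches_step_eq:
  "G c \<Longrightarrow> step M c = c1 \<Longrightarrow> reaches M G c1 c' \<Longrightarrow> reaches M G c c'"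
  using reaches.go by blast

lemma reaches_steps:
  "reaches M G c c' \<Longrightarrow> \<exists>n. (step M ^^ n) c = c' \<and> (\<forall>i\<le>n. G ((step M ^^ i) c))"
proof (induction rule: reaches.induct)
  case (stop c)
  then show ?case by (intro exI[of _ 0]) auto
next
  case (go c c')
  then obtain n where n: "(step M ^^ n) (step M c) = c'"
      "\<forall>i\<le>n. G ((step M ^^ i) (step M c))"
    by blast
  have "G ((step M ^^ i) c)" if "i \<le> Suc n" for i
    using that n(2) go.hyps(1) by (cases i) (auto simp: funpow_swap1)
  then show ?case
    using n(1) by (intro exI[of _ "Suc n"]) (auto simp: funpow_swap1)
qed

text \<open>On a register tape, cell 0 holds the marker, cells 1 to \<open>W\<close> the digits, and
  cell \<open>W + 1\<close> is the blank at which a carry or borrow may arrive.\<close>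

definition confined :: "nat \<Rightarrow> nat \<Rightarrow> letter config \<Rightarrow> bool" where
  "confined k W c \<longleftrightarrow> length (snd c) = Suc k \<and> (\<forall>t\<in>set (snd c). 0 \<le> fst t \<and> fst t \<le> int W + 1)"

lemma confined_update:
  assumes "confined k W (q, ts)" "0 \<le> h" "h \<le> int W + 1"
  shows "confined k W (q', ts[i := (h, t)])"
proof -
  have "0 \<le> fst x \<and> fst x \<le> int W + 1" if "x \<in> set (ts[i := (h, t)])" for x
    using set_update_subset_insert[of ts i "(h, t)"] that assms by (auto simp: confined_def)
  then show ?thesis
    using assms(1) by (simp add: confined_def)
qed

lemma map2_keep:
  assumes "i < length ts"
  shows "map2 act ((keep (map (\<lambda>(h, t). t h) ts))[i := a]) ts = ts[i := act a (ts ! i)]"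
proof (rule nth_equalityI)
  fix n
  assume "n < length (map2 act ((keep (map (\<lambda>(h, t). t h) ts))[i := a]) ts)"
  then show "map2 act ((keep (map (\<lambda>(h, t). t h) ts))[i := a]) ts ! n = ts[i := act a (ts ! i)] ! n"
    by (cases "n = i"; cases "ts ! n") (simp_all add: keep_def)
qed (simp add: keep_def)

lemma step_asm:
  assumes "pc < length P" "j < 3" "r = reg (P ! pc)" "r < k" "length ts = Suc k"
    and "micro (length P) pc (P ! pc) j (t h) = (q', x, d)"
  shows "step (asm_tm P k) (addr pc j, ts[Suc r := (h, t)]) =
    (q', ts[Suc r := (h + displacement d, t(h := x))])"
proof -
  let ?ts = "ts[Suc r := (h, t)]"
  let ?xs = "map (\<lambda>(h, t). t h) ?ts"
  have x: "?xs ! Suc r = t h"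
    using assms by simp
  have "\<not> halting (asm_tm P k) (addr pc j)"
    using assms(1,2) by (auto simp: halting_def asm_tm_def addr_def)
  moreover have "trans (asm_tm P k) (addr pc j) ?xs = (q', (keep ?xs)[Suc r := (x, d)])"
    using assms x addr_decode[OF assms(2), of pc] by (auto simp: asm_tm_def asm_trans_def Let_def addr_def)
  moreover have "map2 act ((keep ?xs)[Suc r := (x, d)]) ?ts =
      ?ts[Suc r := act (x, d) (?ts ! Suc r)]"
    by (rule map2_keep) (use assms in simp)
  ultimately show ?thesis
    using assms by simp
qed

section \<open>Simulation of single instructions\<close>

locale asm_machine =
  fixes P :: "instr list" and k W :: nat
  assumes regs: "\<forall>ins\<in>set P. reg ins < k" and k: "k \<ge> 1"
begin

abbreviation "N \<equiv> length P"
abbreviation "M \<equiv> asm_tm P k"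
abbreviation reach :: "letter config \<Rightarrow> letter config \<Rightarrow> bool" (infix "\<leadsto>" 50) where
  "c \<leadsto> c' \<equiv> reaches M (confined k W) c c'"

text \<open>Continuation style: the remaining run is a premise, so that runs are assembled by
  backward resolution without counting steps.\<close>

lemma micro_step:
  assumes "(q', ts[Suc r := (h + displacement d, t(h := x))]) \<leadsto> c"
    and "pc < N" "j < 3" "r = reg (P ! pc)" "confined k W (q0, ts)" "0 \<le> h" "h \<le> int W + 1"
    and "micro N pc (P ! pc) j (t h) = (q', x, d)"
  shows "(addr pc j, ts[Suc r := (h, t)]) \<leadsto> c"
proof (rule reaches_step_eq)
  show "confined k W (addr pc j, ts[Suc r := (h, t)])"
    by (rule confined_update) fact+
  show "step M (addr pc j, ts[Suc r := (h, t)]) = (q', ts[Suc r := (h + displacement d, t(h := x))])"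
    by (rule step_asm) (use assms(2-) regs in \<open>auto simp: confined_def\<close>)
qed fact

text \<open>Serves phase 1 of \<open>INC\<close> and of \<open>DJZ\<close> alike. The sweep ends
  exactly at cell 0 because no cell to its right carries the marker.\<close>

lemma return_home:
  assumes pc: "pc < N" "j < 3" "r = reg (P ! pc)" "confined k W (q0, ts)"
    and x: "\<And>x. micro N pc (P ! pc) j x = (if x = Aux 0 then (q', x, Right) else (addr pc j, x, Left))"
    and c: "(q', ts[Suc r := (1, tape_of bs)]) \<leadsto> c"
  shows "h \<le> Suc W \<Longrightarrow> (addr pc j, ts[Suc r := (int h, tape_of bs)]) \<leadsto> c"
proof (induction h)
  case 0
  show ?case
    by (rule micro_step[OF _ pc, where q' = q' and x = "Aux 0" and d = Right])
      (use x c in \<open>simp_all add: fun_upd_idem\<close>)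
next
  case (Suc h)
  have ne: "tape_of bs (int (Suc h)) \<noteq> Aux 0"
    by (rule tape_of_ne_0) simp
  show ?case
    by (rule micro_step[OF _ pc, where q' = "addr pc j" and x = "tape_of bs (int (Suc h))" and d = Left])
      (use x ne Suc in simp_all)
qed

text \<open>The prefix \<open>ls\<close> consists of digits that the carry has already passed. It
  must be arbitrary for the induction on the digits \<open>bs\<close> still to be read, with the
  head on the first of them.\<close>

lemma INC_reaches:
  assumes pc: "pc < N" "P ! pc = INC r" "confined k W (q0, ts)"
    and c: "(loc N (Suc pc), ts[Suc r := (1, tape_of (ls @ inc_bits bs))]) \<leadsto> c"
  shows "length ls + length (inc_bits bs) \<le> W \<Longrightarrow>
    (addr pc 0, ts[Suc r := (1 + int (length ls), tape_of (ls @ bs))]) \<leadsto> c"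
  using c
proof (induction bs arbitrary: ls)
  case Nil
  have *: "(addr pc 1, ts[Suc r := (int (length ls), tape_of (ls @ [True]))]) \<leadsto> c"
    by (rule return_home[where q' = "loc N (Suc pc)"]) (use pc Nil in auto)
  show ?case
    by (rule micro_step[where q' = "addr pc 1" and x = "Inp One" and d = Left])
      (use * pc Nil tape_of_snoc[of ls True] in auto)
next
  case (Cons b bs)
  show ?case
  proof (cases b)
    case True
    have *: "(addr pc 0, ts[Suc r := (1 + int (length (ls @ [False])), tape_of ((ls @ [False]) @ bs))]) \<leadsto> c"
      by (rule Cons.IH) (use Cons.prems True in auto)
    show ?thesis
      by (rule micro_step[where q' = "addr pc 0" and x = "Inp Zero" and d = Right])
        (use * pc Cons.prems True tape_of_upd[of ls True bs False] in \<open>auto simp: algebra_simps\<close>)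
  next
    case False
    have *: "(addr pc 1, ts[Suc r := (int (length ls), tape_of (ls @ True # bs))]) \<leadsto> c"
      by (rule return_home[where q' = "loc N (Suc pc)"]) (use pc Cons.prems False in auto)
    show ?thesis
      by (rule micro_step[where q' = "addr pc 1" and x = "Inp One" and d = Left])
        (use * pc Cons.prems False tape_of_upd[of ls False bs True] in auto)
  qed
qed

lemma DJZ_pos_reaches:
  assumes pc: "pc < N" "P ! pc = DJZ r t" "confined k W (q0, ts)"
    and c: "(loc N (Suc pc), ts[Suc r := (1, tape_of (ls @ dec_bits bs))]) \<leadsto> c"
  shows "length ls + length bs \<le> W \<Longrightarrow> bits_val bs > 0 \<Longrightarrow>
    (addr pc 0, ts[Suc r := (1 + int (length ls), tape_of (ls @ bs))]) \<leadsto> c"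
  using c
proof (induction bs arbitrary: ls)
  case (Cons b bs)
  show ?case
  proof (cases b)
    case False
    have *: "(addr pc 0, ts[Suc r := (1 + int (length (ls @ [True])), tape_of ((ls @ [True]) @ bs))]) \<leadsto> c"
      by (rule Cons.IH) (use Cons.prems False in auto)
    show ?thesis
      by (rule micro_step[where q' = "addr pc 0" and x = "Inp One" and d = Right])
        (use * pc Cons.prems False tape_of_upd[of ls False bs True] in \<open>auto simp: algebra_simps\<close>)
  next
    case True
    have *: "(addr pc 1, ts[Suc r := (int (length ls), tape_of (ls @ False # bs))]) \<leadsto> c"
      by (rule return_home[where q' = "loc N (Suc pc)"]) (use pc Cons.prems True in auto)
    show ?thesis
      by (rule micro_step[where q' = "addr pc 1" and x = "Inp Zero" and d = Left])
        (use * pc Cons.prems True tape_of_upd[of ls True bs False] in auto)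
  qed
qed simp

text \<open>After a failed borrow all digits passed are ones. The way back sets each cell to zero
  whatever it holds, which restores the value 0 at the same length.\<close>

lemma DJZ_restore:
  assumes pc: "pc < N" "P ! pc = DJZ r t" "confined k W (q0, ts)"
  shows "length ls \<le> W \<Longrightarrow>
    (loc N t, ts[Suc r := (1, tape_of (replicate (length ls) False @ bs))]) \<leadsto> c \<Longrightarrow>
    (addr pc 2, ts[Suc r := (int (length ls), tape_of (ls @ bs))]) \<leadsto> c"
proof (induction ls arbitrary: bs rule: rev_induct)
  case Nil
  show ?case
    by (rule micro_step[where q' = "loc N t" and x = "Aux 0" and d = Right])
      (use pc Nil in \<open>auto simp: fun_upd_idem\<close>)
next
  case (snoc b ls)
  have *: "(addr pc 2, ts[Suc r := (int (length ls), tape_of (ls @ False # bs))]) \<leadsto> c"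
    by (rule snoc.IH) (use snoc.prems in \<open>auto simp: replicate_append_same[symmetric]\<close>)
  show ?case
    by (rule micro_step[where q' = "addr pc 2" and x = "Inp Zero" and d = Left])
      (use * pc snoc.prems tape_of_upd[of ls b bs False] in \<open>auto simp: algebra_simps\<close>)
qed

lemma DJZ_zero_reaches:
  assumes pc: "pc < N" "P ! pc = DJZ r t" "confined k W (q0, ts)"
    and c: "(loc N t, ts[Suc r := (1, tape_of (replicate (length ls + length bs) False))]) \<leadsto> c"
  shows "length ls + length bs \<le> W \<Longrightarrow> bits_val bs = 0 \<Longrightarrow>
    (addr pc 0, ts[Suc r := (1 + int (length ls), tape_of (ls @ bs))]) \<leadsto> c"
  using c
proof (induction bs arbitrary: ls)
  case Nil
  have *: "(addr pc 2, ts[Suc r := (int (length ls), tape_of (ls @ []))]) \<leadsto> c"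
    by (rule DJZ_restore[OF pc]) (use Nil in auto)
  show ?case
    by (rule micro_step[where q' = "addr pc 2" and x = "Blank" and d = Left])
      (use * pc Nil in \<open>auto simp: fun_upd_idem\<close>)
next
  case (Cons b bs)
  then have b: "\<not> b" by simp
  have *: "(addr pc 0, ts[Suc r := (1 + int (length (ls @ [True])), tape_of ((ls @ [True]) @ bs))]) \<leadsto> c"
    by (rule Cons.IH) (use Cons.prems b in auto)
  show ?case
    by (rule micro_step[where q' = "addr pc 0" and x = "Inp One" and d = Right])
      (use * pc Cons.prems b tape_of_upd[of ls False bs True] in \<open>auto simp: algebra_simps\<close>)
qed

end

text \<open>An increment that would need more than \<open>W\<close> bits has no successor. Hence a
  completed run certifies by itself that its increments respect the width.\<close>

inductive istep :: "instr list \<Rightarrow> nat \<Rightarrow> nat \<times> (nat \<Rightarrow> nat) \<Rightarrow> nat \<times> (nat \<Rightarrow> nat) \<Rightarrow> bool"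
  for P :: "instr list" and W :: nat where
  INC: "pc < length P \<Longrightarrow> P ! pc = INC r \<Longrightarrow> Suc (s r) < 2 ^ W \<Longrightarrow>
    istep P W (pc, s) (Suc pc, s(r := Suc (s r)))"
| DJZ_zero: "pc < length P \<Longrightarrow> P ! pc = DJZ r t \<Longrightarrow> s r = 0 \<Longrightarrow> istep P W (pc, s) (t, s)"
| DJZ_pos: "pc < length P \<Longrightarrow> P ! pc = DJZ r t \<Longrightarrow> s r > 0 \<Longrightarrow>
    istep P W (pc, s) (Suc pc, s(r := s r - 1))"
| JMP: "pc < length P \<Longrightarrow> P ! pc = JMP t \<Longrightarrow> istep P W (pc, s) (t, s)"

text \<open>The letters become the nonzero base 4 digits, which makes the code injective.\<close>

fun code_bits :: "letter list \<Rightarrow> bool list" where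
  "code_bits [] = []"
| "code_bits (a # w) = (a \<noteq> One) # (a \<noteq> Zero) # code_bits w"

lemma code_bits_append [simp]: "code_bits (u @ v) = code_bits u @ code_bits v"
  by (induction u) auto

lemma length_code_bits [simp]: "length (code_bits w) = 2 * length w"
  by (induction w) auto

definition code :: "letter list \<Rightarrow> nat" where
  "code w = bits_val (code_bits w)"

lemma map2_keep_id: "map2 act (keep (map (\<lambda>(h, t). t h) ts)) ts = ts"
  by (rule nth_equalityI) (auto simp: keep_def split: prod.split)

section \<open>Simulation of whole programs\<close>

context asm_machine
begin

definition conf :: "letter tape \<Rightarrow> (nat \<Rightarrow> bool list) \<Rightarrow> nat \<Rightarrow> letter config" where
  "conf it bss q = (q, it # map (\<lambda>r. (1, tape_of (bss r))) [0..<k])"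

definition represents :: "(nat \<Rightarrow> bool list) \<Rightarrow> (nat \<Rightarrow> nat) \<Rightarrow> bool" where
  "represents bss s \<longleftrightarrow> (\<forall>r<k. bits_val (bss r) = s r \<and> length (bss r) \<le> W)"

lemma conf_update:
  assumes "r < k"
  shows "conf it (bss(r := bs)) q = (q, (snd (conf it bss q'))[Suc r := (1, tape_of bs)])"
  unfolding conf_def using assms by (auto intro!: nth_equalityI simp: nth_list_update)

lemma conf_same:
  assumes "r < k"
  shows "conf it bss q = (q, (snd (conf it bss q))[Suc r := (1, tape_of (bss r))])"
  using conf_update[OF assms, of it bss "bss r" q q] by simp

lemma confined_conf: "0 \<le> fst it \<Longrightarrow> fst it \<le> int W + 1 \<Longrightarrow> confined k W (conf it bss q)"
  by (auto simp: confined_def conf_def)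

text \<open>Leading zeros depend on the history of a register, so the digit words after the step are
  existentially quantified rather than computed from the contents. The claim is again a transfer of
  continuations.\<close>

lemma istep_simulation:
  assumes "istep P W c c'" and rep: "represents bss (snd c)"
    and it: "0 \<le> fst it" "fst it \<le> int W + 1"
  shows "fst c < N \<and> (\<exists>bss'. represents bss' (snd c') \<and>
    (\<forall>d. conf it bss' (loc N (fst c')) \<leadsto> d \<longrightarrow> conf it bss (addr (fst c) 0) \<leadsto> d))"
  using assms(1)
proof cases
  case (INC pc r s)
  have r: "r < k"
    using regs INC nth_mem by fastforce
  have rr: "bits_val (bss r) = s r" "length (bss r) \<le> W"
    using rep r INC by (auto simp: represents_def)
  have len: "length (inc_bits (bss r)) \<le> W"
    by (rule length_inc_bits_le) (use rr INC in auto)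
  define bss' where "bss' = bss(r := inc_bits (bss r))"
  have "represents bss' (snd c')"
    using rep len INC by (auto simp: represents_def bss'_def bits_val_inc)
  moreover have "conf it bss (addr pc 0) \<leadsto> d" if "conf it bss' (loc N (Suc pc)) \<leadsto> d" for d
    using INC_reaches[OF INC(3,4), of _ "snd (conf it bss (addr pc 0))" "[]" "bss r" d]
      that len confined_conf[OF it, of bss "addr pc 0"] conf_same[OF r, of it bss "addr pc 0"]
      conf_update[OF r, of it bss "inc_bits (bss r)" "loc N (Suc pc)" "addr pc 0"]
    by (simp add: bss'_def) (metis prod.collapse)
  ultimately show ?thesis
    using INC by auto
next
  case (DJZ_zero pc r t s)
  have r: "r < k"
    using regs DJZ_zero nth_mem by fastforce
  have rr: "bits_val (bss r) = 0" "length (bss r) \<le> W"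
    using rep r DJZ_zero by (auto simp: represents_def)
  define bss' where "bss' = bss(r := replicate (length (bss r)) False)"
  have "represents bss' (snd c')"
    using rep rr DJZ_zero by (auto simp: represents_def bss'_def)
  moreover have "conf it bss (addr pc 0) \<leadsto> d" if "conf it bss' (loc N t) \<leadsto> d" for d
    using DJZ_zero_reaches[OF DJZ_zero(3,4), of _ "snd (conf it bss (addr pc 0))" "[]" "bss r" d]
      that rr confined_conf[OF it, of bss "addr pc 0"] conf_same[OF r, of it bss "addr pc 0"]
      conf_update[OF r, of it bss "replicate (length (bss r)) False" "loc N t" "addr pc 0"]
    by (simp add: bss'_def) (metis prod.collapse)
  ultimately show ?thesis
    using DJZ_zero by auto
next
  case (DJZ_pos pc r t s)
  have r: "r < k"
    using regs DJZ_pos nth_mem by fastforce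
  have rr: "bits_val (bss r) = s r" "length (bss r) \<le> W"
    using rep r DJZ_pos by (auto simp: represents_def)
  define bss' where "bss' = bss(r := dec_bits (bss r))"
  have "represents bss' (snd c')"
    using rep rr DJZ_pos by (auto simp: represents_def bss'_def bits_val_dec)
  moreover have "conf it bss (addr pc 0) \<leadsto> d" if "conf it bss' (loc N (Suc pc)) \<leadsto> d" for d
    using DJZ_pos_reaches[OF DJZ_pos(3,4), of _ "snd (conf it bss (addr pc 0))" "[]" "bss r" d]
      that rr DJZ_pos(5) confined_conf[OF it, of bss "addr pc 0"] conf_same[OF r, of it bss "addr pc 0"]
      conf_update[OF r, of it bss "dec_bits (bss r)" "loc N (Suc pc)" "addr pc 0"]
    by (simp add: bss'_def) (metis prod.collapse)
  ultimately show ?thesis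
    using DJZ_pos by auto
next
  case (JMP pc t s)
  have r: "0 < k" using k by simp
  have "conf it bss (addr pc 0) \<leadsto> d" if "conf it bss (loc N t) \<leadsto> d" for d
  proof -
    have "(addr pc 0, (snd (conf it bss (addr pc 0)))[Suc 0 := (1, tape_of (bss 0))]) \<leadsto> d"
      by (rule micro_step[where q' = "loc N t" and x = "tape_of (bss 0) 1" and d = Stay])
        (use that JMP confined_conf[OF it, of bss "addr pc 0"]
          conf_update[OF r, of it bss "bss 0" "loc N t" "addr pc 0"] in \<open>auto simp: conf_def\<close>)
    then show ?thesis
      using conf_same[OF r, of it bss "addr pc 0"] by simp
  qed
  then show ?thesis
    using JMP rep by auto
qed

lemma isteps_simulation:
  assumes "(istep P W)\<^sup>*\<^sup>* c c'" and "represents bss (snd c)"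
    and it: "0 \<le> fst it" "fst it \<le> int W + 1"
  shows "\<exists>bss'. represents bss' (snd c') \<and>
    conf it bss (loc N (fst c)) \<leadsto> conf it bss' (loc N (fst c'))"
  using assms(1,2)
proof (induction arbitrary: bss rule: converse_rtranclp_induct)
  case base
  then show ?case
    using confined_conf[OF it] by (blast intro: reaches.stop)
next
  case (step c d)
  obtain bss1 where 1: "fst c < N" "represents bss1 (snd d)"
    "\<forall>e. conf it bss1 (loc N (fst d)) \<leadsto> e \<longrightarrow> conf it bss (addr (fst c) 0) \<leadsto> e"
    using istep_simulation[OF step.hyps(1) step.prems it] by blast
  moreover have "loc N (fst c) = addr (fst c) 0"
    using 1(1) by (simp add: loc_def)
  ultimately show ?case
    using step.IH[OF 1(2)] by metis
qed

lemma not_halting [simp]: "q < 4 \<Longrightarrow> \<not> halting M q"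
  by (simp add: halting_def asm_tm_def addr_def)

lemma M_trans [simp]: "trans M = asm_trans P k"
  by (simp add: asm_tm_def)

lemma rewind:
  assumes "length rest = k - 1" "\<forall>t\<in>set rest. fst t = 1" "0 \<le> fst it" "fst it \<le> int W + 1"
  shows "h \<le> Suc W \<Longrightarrow> (loc N 0, it # (1, tape_of bs) # rest) \<leadsto> c \<Longrightarrow>
    (3, it # (int h, tape_of bs) # rest) \<leadsto> c"
proof (induction h)
  case 0
  show ?case
  proof (rule reaches_step_eq)
    show "confined k W (3, it # (int 0, tape_of bs) # rest)"
      using assms k by (simp add: confined_def)
    show "step M (3, it # (int 0, tape_of bs) # rest) = (loc N 0, it # (1, tape_of bs) # rest)"
      using map2_keep[of 1 "it # (0, tape_of bs) # rest" "(Aux 0, Right)"]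
      by (simp add: asm_trans_def fun_upd_idem)
  qed (use 0 in simp)
next
  case (Suc h)
  have ne: "tape_of bs (int (Suc h)) \<noteq> Aux 0"
    by (rule tape_of_ne_0) simp
  show ?case
  proof (rule reaches_step_eq)
    show "confined k W (3, it # (int (Suc h), tape_of bs) # rest)"
      using assms k Suc by (simp add: confined_def)
    show "step M (3, it # (int (Suc h), tape_of bs) # rest) = (3, it # (int h, tape_of bs) # rest)"
      using ne map2_keep[of 1 "it # (int (Suc h), tape_of bs) # rest" "(tape_of bs (int (Suc h)), Left)"]
      by (simp add: asm_trans_def)
  qed (use Suc in simp)
qed

text \<open>The prefix \<open>u\<close> has been copied and \<open>v\<close> is still unread; two
  machine steps write the two bits of a letter. The input head finally rests just behind the
  word.\<close>

lemma scan:
  assumes "length rest = k - 1" "\<forall>t\<in>set rest. fst t = 1" "2 * length w \<le> W"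
    and c: "(loc N 0, (int (length w), snd (input_tape w)) # (1, tape_of (code_bits w)) # rest) \<leadsto> c"
  shows "w = u @ v \<Longrightarrow> (1, (int (length u), snd (input_tape w)) #
    (1 + int (length (code_bits u)), tape_of (code_bits u)) # rest) \<leadsto> c"
proof (induction v arbitrary: u)
  case Nil
  let ?it = "(int (length u), snd (input_tape w))"
  let ?bs = "code_bits u"
  show ?case
  proof (rule reaches_step_eq)
    show "confined k W (1, ?it # (1 + int (length ?bs), tape_of ?bs) # rest)"
      using assms k Nil by (simp add: confined_def)
    have "snd (input_tape w) (int (length u)) = Blank"
      using Nil by (simp add: input_tape_def)
    then show "step M (1, ?it # (1 + int (length ?bs), tape_of ?bs) # rest) =
      (3, ?it # (int (length ?bs), tape_of ?bs) # rest)"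
      using map2_keep[of 1 "?it # (1 + int (length ?bs), tape_of ?bs) # rest" "(Blank, Left)"]
        tape_of_end[of ?bs]
      by (simp add: asm_trans_def fun_upd_idem del: tape_of_end)
    show "(3, ?it # (int (length ?bs), tape_of ?bs) # rest) \<leadsto> c"
      by (rule rewind) (use assms Nil in auto)
  qed
next
  case (Cons a v)
  let ?it = "(int (length u), snd (input_tape w))"
  let ?bs = "code_bits u"
  let ?bs1 = "?bs @ [a \<noteq> One]"
  let ?bs2 = "?bs1 @ [a \<noteq> Zero]"
  have a: "snd (input_tape w) (int (length u)) = Inp a"
    using Cons.prems by (simp add: input_tape_def)
  have len: "2 * length u + 2 \<le> W"
    using assms(3) Cons.prems by simp
  show ?case
  proof (rule reaches_step_eq)
    show "confined k W (1, ?it # (1 + int (length ?bs), tape_of ?bs) # rest)"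
      using assms k len by (simp add: confined_def)
    show "step M (1, ?it # (1 + int (length ?bs), tape_of ?bs) # rest) =
      (2, ?it # (1 + int (length ?bs1), tape_of ?bs1) # rest)"
      using map2_keep[of 1 "?it # (1 + int (length ?bs), tape_of ?bs) # rest" "(dig (a \<noteq> One), Right)"]
        a tape_of_snoc[of ?bs "a \<noteq> One"]
      by (simp add: asm_trans_def add.commute)
    show "(2, ?it # (1 + int (length ?bs1), tape_of ?bs1) # rest) \<leadsto> c"
    proof (rule reaches_step_eq)
      show "confined k W (2, ?it # (1 + int (length ?bs1), tape_of ?bs1) # rest)"
        using assms k len by (simp add: confined_def)
      show "step M (2, ?it # (1 + int (length ?bs1), tape_of ?bs1) # rest) =
        (1, (int (length (u @ [a])), snd (input_tape w)) # (1 + int (length ?bs2), tape_of ?bs2) # rest)"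
        using map2_keep_id[of rest] a tape_of_snoc[of ?bs1 "a \<noteq> Zero"]
        by (simp add: asm_trans_def keep_def fun_upd_idem add.commute)
      show "(1, (int (length (u @ [a])), snd (input_tape w)) #
          (1 + int (length ?bs2), tape_of ?bs2) # rest) \<leadsto> c"
        using Cons.IH[of "u @ [a]"] Cons.prems by simp
    qed
  qed
qed

lemma initial_reaches:
  assumes W: "2 * length w \<le> W"
    and c: "conf (int (length w), snd (input_tape w)) (\<lambda>r. if r = 0 then code_bits w else []) (loc N 0) \<leadsto> c"
  shows "initial M w \<leadsto> c"
proof -
  obtain k' where k': "k = Suc k'"
    using k by (cases k) auto
  let ?rest = "replicate k' (1, tape_of [])"
  have "map (\<lambda>r. (1 :: int, tape_of (if r = 0 then code_bits w else []))) [0..<Suc k'] =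
      (1, tape_of (code_bits w)) # ?rest"
    by (rule nth_equalityI) (auto simp: nth_Cons' simp del: upt_Suc)
  then have start: "conf (int (length w), snd (input_tape w)) (\<lambda>r. if r = 0 then code_bits w else []) (loc N 0) =
      (loc N 0, (int (length w), snd (input_tape w)) # (1, tape_of (code_bits w)) # ?rest)"
    unfolding conf_def by (simp only: k')
  have *: "(1, (int (length ([] :: letter list)), snd (input_tape w)) #
      (1 + int (length (code_bits [])), tape_of (code_bits [])) # ?rest) \<leadsto> c"
    by (rule scan[where v = w]) (use c W k' start in auto)
  have blank: "(\<lambda>_. Blank)(0 := Aux 0) = tape_of []"
    by (auto simp: tape_of_def)
  have map2: "map2 act (replicate n (Aux 0, Right)) (replicate n empty_tape) = replicate n (1, tape_of [])" for n
    by (induction n) (simp_all add: empty_tape_def blank)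
  have init: "initial M w = (0, input_tape w # replicate k empty_tape)"
    by (simp add: initial_def asm_tm_def)
  have it: "input_tape w = (0, snd (input_tape w))"
    by (simp add: input_tape_def)
  have "step M (0, (0, t) # replicate k empty_tape) = (1, (0, t) # replicate k (1, tape_of []))" for t
    using map2[of k] by (simp add: asm_trans_def)
  then have "step M (0, input_tape w # replicate k empty_tape) =
    (1, (0, snd (input_tape w)) # (1, tape_of []) # ?rest)"
    using it k' by (metis replicate_Suc)
  moreover have "confined k W (0, input_tape w # replicate k empty_tape)"
    by (auto simp: confined_def input_tape_def empty_tape_def)
  ultimately show ?thesis
    using * reaches_step_eq[of "confined k W"] by (simp add: init)
qed

lemma asm_run:
  assumes W: "2 * length w \<le> W"
    and run: "(istep P W)\<^sup>*\<^sup>* (0, \<lambda>r. if r = 0 then code w else 0) (pc, s)"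
    and pc: "pc \<in> {N, N + 1}"
  shows "halts M w \<and> (accepts M w \<longleftrightarrow> pc = N) \<and> space_used M w \<le> Suc k * (W + 2)"
proof -
  have "\<exists>bss'. represents bss' s \<and>
    conf (int (length w), snd (input_tape w)) (\<lambda>r. if r = 0 then code_bits w else []) (loc N 0)
      \<leadsto> conf (int (length w), snd (input_tape w)) bss' (loc N pc)"
    using isteps_simulation[OF run, of "\<lambda>r. if r = 0 then code_bits w else []"
        "(int (length w), snd (input_tape w))"] W
    by (simp add: represents_def code_def)
  then obtain bss where
    "initial M w \<leadsto> conf (int (length w), snd (input_tape w)) bss (loc N pc)"
    using initial_reaches[OF W] by metis
  then obtain c where c: "initial M w \<leadsto> c" "fst c = loc N pc"
    by (metis conf_def fst_conv)
  then obtain n where n: "run M w n = c" "\<forall>i\<le>n. confined k W (run M w i)"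
    using reaches_steps unfolding run_def by blast
  have acc: "fst c = (if pc = N then accept M else reject M)"
    using c(2) pc by (auto simp: asm_tm_def loc_def)
  then have halt: "halting M (fst c)"
    by (simp add: halting_def)
  \<comment> \<open>Configurations are constant after halting, so confinement of the configurations
    up to \<open>n\<close> extends to the whole run.\<close>
  have const: "run M w (n + i) = c" for i
  proof (induction i)
    case (Suc i)
    have "run M w (n + Suc i) = step M (run M w (n + i))"
      by (simp add: run_def)
    then show ?case
      using Suc halt by (cases c) simp
  qed (simp add: n)
  have all: "confined k W (run M w i)" for i
    using n const[of "i - n"] by (cases "i \<le> n") auto
  have "accept M \<noteq> reject M"
    by (simp add: asm_tm_def addr_def)
  have "accepts M w \<longleftrightarrow> pc = N"
  proof
    assume "accepts M w"
    then obtain i where i: "fst (run M w i) = accept M"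
      by (auto simp: accepts_def)
    \<comment> \<open>Acceptance may be witnessed before or after step \<open>n\<close>. The run is
      constant from either step on, so comparing both with step \<open>n + i\<close> identifies the
      two configurations.\<close>
    have "run M w (i + j) = run M w i" for j
    proof (induction j)
      case (Suc j)
      have "run M w (i + Suc j) = step M (run M w (i + j))"
        by (simp add: run_def)
      then show ?case
        using Suc i by (cases "run M w i") (simp add: halting_def)
    qed simp
    then have "run M w (n + i) = run M w i"
      by (metis add.commute)
    then show "pc = N"
      using const[of i] i acc \<open>accept M \<noteq> reject M\<close> by (auto split: if_splits)
  next
    assume "pc = N"
    then show "accepts M w"
      using acc n(1) by (auto simp: accepts_def)
  qed
  moreover have "halts M w"
    using halt n(1) by (auto simp: halts_def)
  moreover have "space_used M w \<le> Suc k * (W + 2)"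
  proof -
    have "card (visited_cells M w i) \<le> W + 2" if "i < Suc k" for i
    proof -
      have "fst (snd (run M w m) ! i) \<in> {0..int W + 1}" for m
        using all[of m] that by (auto simp: confined_def)
      then have "visited_cells M w i \<subseteq> {0..int W + 1}"
        by (auto simp: visited_cells_def)
      from card_mono[OF _ this] show ?thesis
        by simp
    qed
    then have "(\<Sum>i<Suc k. card (visited_cells M w i)) \<le> (\<Sum>i<Suc k. W + 2)"
      by (intro sum_mono) auto
    then show ?thesis
      by (simp add: space_used_def asm_tm_def)
  qed
  ultimately show ?thesis
    by blast
qed

end

text \<open>The hypothesis \<open>2 * n \<le> poly p n\<close> makes room for the input itself,
  which occupies register 0 with two bits per letter.\<close>

theorem asm_in_PSPACE:
  assumes regs: "\<forall>ins\<in>set P. reg ins < k" and k: "k \<ge> 1"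
    and p: "\<And>n. 2 * n \<le> poly p n"
    and run: "\<And>w. \<exists>s. (istep P (poly p (length w)))\<^sup>*\<^sup>* (0, \<lambda>r. if r = 0 then code w else 0)
      (if w \<in> L then length P else length P + 1, s)"
  shows "L \<in> PSPACE"
proof -
  have "halts (asm_tm P k) w \<and> (accepts (asm_tm P k) w \<longleftrightarrow> w \<in> L) \<and>
    space_used (asm_tm P k) w \<le> poly ([:Suc k:] * (p + [:2:])) (length w)" for w
  proof -
    interpret asm_machine P k "poly p (length w)"
      by unfold_locales fact+
    obtain s where "(istep P (poly p (length w)))\<^sup>*\<^sup>* (0, \<lambda>r. if r = 0 then code w else 0)
        (if w \<in> L then length P else length P + 1, s)"
      using run by blast
    from asm_run[OF p this] show ?thesis
      by auto
  qed
  then show ?thesis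
    unfolding PSPACE_def using is_tm_asm[OF k regs] by blast
qed


section \<open>Structured counter programs and their compilation\<close>

datatype com = Skip | Inc nat | Dec nat | Seq com com (infixr ";;" 60) | Loop nat com

text \<open>The loop decrements its register before each pass through the body, which may read it.\<close>

inductive exec :: "nat \<Rightarrow> com \<Rightarrow> (nat \<Rightarrow> nat) \<Rightarrow> (nat \<Rightarrow> nat) \<Rightarrow> bool" for W :: nat where
  Skip: "exec W Skip s s"
| Inc: "Suc (s r) < 2 ^ W \<Longrightarrow> exec W (Inc r) s (s(r := Suc (s r)))"
| Dec: "exec W (Dec r) s (s(r := s r - 1))"
| Seq: "exec W c1 s s1 \<Longrightarrow> exec W c2 s1 s2 \<Longrightarrow> exec W (c1 ;; c2) s s2"
| Loop_0: "s r = 0 \<Longrightarrow> exec W (Loop r c) s s"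
| Loop_Suc: "s r > 0 \<Longrightarrow> exec W c (s(r := s r - 1)) s1 \<Longrightarrow> exec W (Loop r c) s1 s2 \<Longrightarrow>
    exec W (Loop r c) s s2"

lemma exec_mono:
  assumes "exec W c s s'" "W \<le> W'"
  shows "exec W' c s s'"
  using assms(1)
proof (induction rule: exec.induct)
  case (Inc s r)
  have "(2::nat) ^ W \<le> 2 ^ W'"
    using assms(2) by simp
  then show ?case
    using Inc by (intro exec.Inc) linarith
qed (blast intro: exec.intros)+

fun csize :: "com \<Rightarrow> nat" where
  "csize Skip = 0"
| "csize (Inc r) = 1"
| "csize (Dec r) = 1"
| "csize (c1 ;; c2) = csize c1 + csize c2"
| "csize (Loop r c) = csize c + 2"

text \<open>The start address \<open>a\<close> is a parameter because jump targets are absolute. In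
  \<open>Dec\<close> both outcomes of the test continue at the next instruction, which truncates
  subtraction at 0.\<close>

fun compile :: "nat \<Rightarrow> com \<Rightarrow> instr list" where
  "compile a Skip = []"
| "compile a (Inc r) = [INC r]"
| "compile a (Dec r) = [DJZ r (a + 1)]"
| "compile a (c1 ;; c2) = compile a c1 @ compile (a + csize c1) c2"
| "compile a (Loop r c) = DJZ r (a + csize c + 2) # compile (a + 1) c @ [JMP a]"

lemma length_compile [simp]: "length (compile a c) = csize c"
  by (induction c arbitrary: a) auto

lemma compile_correct:
  "exec W c s s' \<Longrightarrow> P = pre @ compile (length pre) c @ post \<Longrightarrow>
    (istep P W)\<^sup>*\<^sup>* (length pre, s) (length pre + csize c, s')"
proof (induction arbitrary: pre post rule: exec.induct)
  case (Inc s r)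
  have "istep P W (length pre, s) (Suc (length pre), s(r := Suc (s r)))"
    by (rule istep.INC) (use Inc in \<open>simp_all add: nth_append\<close>)
  then show ?case
    by (simp del: fun_upd_apply add: r_into_rtranclp)
next
  case (Dec r s)
  have P: "length pre < length P" "P ! length pre = DJZ r (length pre + 1)"
    using Dec by (auto simp: nth_append)
  show ?case
  proof (cases "s r = 0")
    case True
    then have "s(r := s r - 1) = s"
      by auto
    then show ?thesis
      using istep.DJZ_zero[of "length pre" P r "length pre + 1" s W] P True by auto
  next
    case False
    then show ?thesis
      using r_into_rtranclp[where r = "istep P W", OF istep.DJZ_pos[OF P, of s W]]
      by (simp del: fun_upd_apply)
  qed
next
  case (Seq c1 s s1 c2 s2)
  have "(istep P W)\<^sup>*\<^sup>* (length pre, s) (length pre + csize c1, s1)"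
    by (rule Seq.IH(1)) (use Seq.prems in simp)
  moreover have "(istep P W)\<^sup>*\<^sup>* (length pre + csize c1, s1) (length pre + csize c1 + csize c2, s2)"
    using Seq.IH(2)[of "pre @ compile (length pre) c1" post] Seq.prems by simp
  ultimately show ?case
    by (simp add: add.assoc)
next
  case (Loop_0 s r c)
  have "istep P W (length pre, s) (length pre + csize c + 2, s)"
    using Loop_0 by (intro istep.DJZ_zero[where r = r]) (auto simp: nth_append)
  then show ?case
    by (simp add: add.assoc)
next
  case (Loop_Suc s r c s1 s2)
  have 1: "istep P W (length pre, s) (Suc (length pre), s(r := s r - 1))"
    by (rule istep.DJZ_pos[where t = "length pre + csize c + 2"])
      (use Loop_Suc.hyps(1) Loop_Suc.prems in \<open>simp_all add: nth_append\<close>)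
  have 2: "(istep P W)\<^sup>*\<^sup>* (Suc (length pre), s(r := s r - 1)) (Suc (length pre) + csize c, s1)"
    using Loop_Suc.IH(1)[of "pre @ [DJZ r (length pre + csize c + 2)]" "JMP (length pre) # post"]
      Loop_Suc.prems by (simp del: fun_upd_apply)
  have 3: "istep P W (Suc (length pre) + csize c, s1) (length pre, s1)"
    by (rule istep.JMP) (use Loop_Suc.prems in \<open>simp_all add: nth_append\<close>)
  have 4: "(istep P W)\<^sup>*\<^sup>* (length pre, s1) (length pre + csize (Loop r c), s2)"
    by (rule Loop_Suc.IH(2)) fact
  show ?case
    by (rule rtranclp_trans[OF rtranclp_trans[OF converse_rtranclp_into_rtranclp[OF 1 2]
          r_into_rtranclp[where r = "istep P W", OF 3]] 4])
qed auto

fun max_reg :: "com \<Rightarrow> nat" where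
  "max_reg Skip = 0"
| "max_reg (Inc r) = r"
| "max_reg (Dec r) = r"
| "max_reg (c1 ;; c2) = max (max_reg c1) (max_reg c2)"
| "max_reg (Loop r c) = max r (max_reg c)"

lemma reg_compile: "ins \<in> set (compile a c) \<Longrightarrow> reg ins \<le> max_reg c"
  by (induction c arbitrary: a) (auto simp: le_max_iff_disj)

theorem exec_in_PSPACE:
  assumes p: "\<And>n. 2 * n \<le> poly p n"
    and ex: "\<And>w. \<exists>s. exec (poly p (length w)) c (\<lambda>r. if r = 0 then code w else 0) s \<and> (s 1 > 0 \<longleftrightarrow> w \<in> L)"
  shows "L \<in> PSPACE"
proof (rule asm_in_PSPACE[where p = p])
  \<comment> \<open>The appended test sits at address \<open>csize c\<close>. If register 1 is
    positive, control falls off the end of the program, which accepts; otherwise it jumps one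
    instruction further, which rejects.\<close>
  let ?P = "compile 0 c @ [DJZ 1 (csize c + 2)]"
  show "\<forall>ins\<in>set ?P. reg ins < max_reg c + 2"
  proof
    fix ins
    assume "ins \<in> set ?P"
    then show "reg ins < max_reg c + 2"
      using reg_compile[of ins 0 c] by auto
  qed
  fix w
  obtain s where s: "exec (poly p (length w)) c (\<lambda>r. if r = 0 then code w else 0) s"
    "s 1 > 0 \<longleftrightarrow> w \<in> L"
    using ex[of w] by auto
  have 1: "(istep ?P (poly p (length w)))\<^sup>*\<^sup>* (0, \<lambda>r. if r = 0 then code w else 0) (csize c, s)"
    using compile_correct[OF s(1), of ?P "[]" "[DJZ 1 (csize c + 2)]"] by simp
  obtain s' where 2: "istep ?P (poly p (length w)) (csize c, s)
      (if w \<in> L then length ?P else length ?P + 1, s')"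
  proof (cases "w \<in> L")
    case True
    have "istep ?P (poly p (length w)) (csize c, s) (Suc (csize c), s(1 := s 1 - 1))"
      by (rule istep.DJZ_pos[where t = "csize c + 2"]) (use s(2) True in \<open>simp_all add: nth_append\<close>)
    then show ?thesis
      using True that[of "s(1 := s 1 - 1)"] by (simp del: fun_upd_apply)
  next
    case False
    have "istep ?P (poly p (length w)) (csize c, s) (csize c + 2, s)"
      by (rule istep.DJZ_zero[where r = 1]) (use s(2) False in \<open>simp_all add: nth_append\<close>)
    then show ?thesis
      using False that[of s] by simp
  qed
  show "\<exists>s'. (istep ?P (poly p (length w)))\<^sup>*\<^sup>* (0, \<lambda>r. if r = 0 then code w else 0)
      (if w \<in> L then length ?P else length ?P + 1, s')"
    by (rule exI[of _ s'], rule rtranclp.rtrancl_into_rtrancl[OF 1 2])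
qed (simp_all add: p)


section \<open>Functions computable in polynomial space\<close>

text \<open>The bit length: \<open>lg 0\<close> is 0 and \<open>lg (2 ^ n)\<close> is
  \<open>n + 1\<close>.\<close>

definition lg :: "nat \<Rightarrow> nat" where
  "lg n = (LEAST k. n < 2 ^ k)"

lemma less_two_power_lg: "n < 2 ^ lg n"
  unfolding lg_def by (rule LeastI[of _ n]) (rule less_exp)

lemma lg_le_iff: "lg n \<le> k \<longleftrightarrow> n < 2 ^ k"
proof
  assume "lg n \<le> k"
  then have "(2::nat) ^ lg n \<le> 2 ^ k"
    by simp
  then show "n < 2 ^ k"
    using less_two_power_lg[of n] by linarith
qed (simp add: lg_def Least_le)

lemma lg_mono: "m \<le> n \<Longrightarrow> lg m \<le> lg n"
  by (metis lg_le_iff less_two_power_lg order_le_less_trans)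

lemma lg_0 [simp]: "lg 0 = 0"
  using lg_le_iff[of 0 0] by simp

lemma lg_eq_0_iff [simp]: "lg n = 0 \<longleftrightarrow> n = 0"
  using lg_le_iff[of n 0] by simp

lemma lg_Suc: "lg (Suc n) \<le> Suc (lg n)"
  using less_two_power_lg[of n] by (simp add: lg_le_iff)

lemma lg_mult: "lg (m * n) \<le> lg m + lg n"
  using mult_strict_mono'[OF less_two_power_lg less_two_power_lg, of m n]
  by (simp add: lg_le_iff power_add)

lemma lg_add: "lg (m + n) \<le> lg m + lg n + 1"
proof -
  have "m + n < 2 ^ (lg m + lg n) + 2 ^ (lg m + lg n)"
    using less_two_power_lg[of m] less_two_power_lg[of n]
      power_increasing[of "lg m" "lg m + lg n" "2::nat"] power_increasing[of "lg n" "lg m + lg n" "2::nat"]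
    by linarith
  then show ?thesis
    by (simp add: lg_le_iff)
qed

lemma lg_power: "lg (m ^ n) \<le> n * lg m + 1"
proof (induction n)
  case 0
  then show ?case by (simp add: lg_le_iff)
next
  case (Suc n)
  then show ?case
    using lg_mult[of m "m ^ n"] by simp
qed

lemma lg_le_self: "lg n \<le> n"
  by (simp add: lg_le_iff)


text \<open>The summand 2 keeps the space at least 2. Constants and sums are then dominated by high
  powers, so that \<open>polybounded\<close> can use pure powers in place of polynomials.\<close>

definition space :: "nat \<Rightarrow> (nat \<Rightarrow> nat) \<Rightarrow> nat" where
  "space t s = 2 + (\<Sum>r<t. lg (s r))"

definition polybounded :: "nat \<Rightarrow> ((nat \<Rightarrow> nat) \<Rightarrow> nat) \<Rightarrow> bool" where
  "polybounded t g \<longleftrightarrow> (\<exists>k. \<forall>s. g s \<le> space t s ^ k)"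

lemma space_ge_2: "2 \<le> space t s"
  by (simp add: space_def)

lemma lg_le_space: "r < t \<Longrightarrow> lg (s r) \<le> space t s"
  using member_le_sum[of r "{..<t}" "\<lambda>r. lg (s r)"] by (simp add: space_def)

lemma polybounded_mono: "polybounded t h \<Longrightarrow> (\<And>s. g s \<le> h s) \<Longrightarrow> polybounded t g"
  unfolding polybounded_def by (meson le_trans)

lemma polybounded_const: "polybounded t (\<lambda>s. c)"
proof -
  have "c \<le> space t s ^ c" for s
    using less_exp[of c] power_mono[OF space_ge_2[of t s], of c] by linarith
  then show ?thesis
    unfolding polybounded_def by blast
qed

lemma polybounded_space: "polybounded t (space t)"
  unfolding polybounded_def by (intro exI[of _ 1]) simp

lemma polybounded_power: "polybounded t g \<Longrightarrow> polybounded t (\<lambda>s. g s ^ c)"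
  unfolding polybounded_def by (metis power_mono power_mult zero_le)

lemma polybounded_mult:
  assumes "polybounded t g" "polybounded t h"
  shows "polybounded t (\<lambda>s. g s * h s)"
proof -
  obtain k l where "\<forall>s. g s \<le> space t s ^ k" "\<forall>s. h s \<le> space t s ^ l"
    using assms by (auto simp: polybounded_def)
  then have "\<forall>s. g s * h s \<le> space t s ^ (k + l)"
    by (simp add: power_add mult_le_mono)
  then show ?thesis
    unfolding polybounded_def by blast
qed

lemma polybounded_add:
  assumes "polybounded t g" "polybounded t h"
  shows "polybounded t (\<lambda>s. g s + h s)"
proof (rule polybounded_mono)
  \<comment> \<open>A sum is dominated by this product, so only successors remain; there one further
    power of the space absorbs a factor 2.\<close>
  show "polybounded t (\<lambda>s. (g s + 1) * (h s + 1))"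
  proof (rule polybounded_mult)
    have *: "polybounded t (\<lambda>s. f s + 1)" if f: "polybounded t f" for f
    proof -
      obtain k where "\<forall>s. f s \<le> space t s ^ k"
        using f by (auto simp: polybounded_def)
      moreover have "x + 1 \<le> space t s ^ Suc k" if "x \<le> space t s ^ k" for x s
      proof -
        have "1 \<le> space t s ^ k"
          using space_ge_2[of t s] by simp
        then have "x + 1 \<le> 2 * space t s ^ k"
          using that by linarith
        also have "\<dots> \<le> space t s ^ Suc k"
          using space_ge_2[of t s] by simp
        finally show ?thesis .
      qed
      ultimately show ?thesis
        unfolding polybounded_def by blast
    qed
    show "polybounded t (\<lambda>s. g s + 1)" "polybounded t (\<lambda>s. h s + 1)"
      using * assms by blast+
  qed
qed simp

lemma polybounded_compose:
  assumes "polybounded t' W" "polybounded t (\<lambda>s. space t' (g s))"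
  shows "polybounded t (\<lambda>s. W (g s))"
proof -
  obtain k where "\<forall>s. W s \<le> space t' s ^ k"
    using assms(1) by (auto simp: polybounded_def)
  then show ?thesis
    by (intro polybounded_mono[OF polybounded_power[OF assms(2), of k]]) simp
qed

lemma space_update: "space (Suc t) (s(t := x)) = space t s + lg x"
  by (simp add: space_def)

lemma space_update2: "space (t + 2) (s(t := x, Suc t := y)) = space t s + lg x + lg y"
  by (simp add: space_def)

lemmas polybounded_intros = polybounded_const polybounded_space polybounded_power polybounded_mult
  polybounded_add


section \<open>Moving, clearing and copying registers\<close>

lemma exec_move:
  assumes "a \<noteq> b"
  shows "s b + s a < 2 ^ W \<Longrightarrow> exec W (Loop a (Inc b)) s (s(a := 0, b := s b + s a))"
proof (induction "s a" arbitrary: s)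
  case 0
  then have "s(a := 0, b := s b + s a) = s"
    by auto
  then show ?case
    using 0 exec.Loop_0[of s a] by metis
next
  case (Suc x)
  let ?s0 = "s(a := s a - 1)"
  let ?s1 = "?s0(b := Suc (?s0 b))"
  have "exec W (Inc b) ?s0 ?s1"
    by (rule exec.Inc) (use assms Suc in simp)
  moreover have "exec W (Loop a (Inc b)) ?s1 (?s1(a := 0, b := ?s1 b + ?s1 a))"
    by (rule Suc.hyps(1)) (use assms Suc in simp_all)
  moreover have "?s1(a := 0, b := ?s1 b + ?s1 a) = s(a := 0, b := s b + s a)"
    using assms Suc(2) by (auto simp: fun_eq_iff)
  ultimately show ?case
    using Suc(2) exec.Loop_Suc[of s a W "Inc b" ?s1] by (metis zero_less_Suc)
qed

lemma exec_clear: "exec W (Loop a Skip) s (s(a := 0))"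
proof (induction "s a" arbitrary: s)
  case 0
  then have "s(a := 0) = s"
    by auto
  then show ?case
    using 0 exec.Loop_0[of s a] by metis
next
  case (Suc x)
  then have "exec W (Loop a Skip) (s(a := s a - 1)) (s(a := 0))"
    using Suc(1)[of "s(a := s a - 1)"] by simp
  then show ?case
    using Suc(2) exec.Loop_Suc[OF _ exec.Skip] by (metis zero_less_Suc)
qed

lemma exec_copy:
  assumes "a \<noteq> b" "a \<noteq> c" "b \<noteq> c"
  shows "s b + s a < 2 ^ W \<Longrightarrow> s c + s a < 2 ^ W \<Longrightarrow>
    exec W (Loop a (Inc b ;; Inc c)) s (s(a := 0, b := s b + s a, c := s c + s a))"
proof (induction "s a" arbitrary: s)
  case 0
  then have "s(a := 0, b := s b + s a, c := s c + s a) = s"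
    by auto
  then show ?case
    using 0 exec.Loop_0[of s a] by metis
next
  case (Suc x)
  let ?s0 = "s(a := s a - 1)"
  let ?s1 = "?s0(b := Suc (?s0 b))"
  let ?s2 = "?s1(c := Suc (?s1 c))"
  have "exec W (Inc b ;; Inc c) ?s0 ?s2"
    by (rule exec.Seq[of _ _ _ ?s1]; rule exec.Inc) (use assms Suc in simp_all)
  moreover have "exec W (Loop a (Inc b ;; Inc c)) ?s2 (?s2(a := 0, b := ?s2 b + ?s2 a, c := ?s2 c + ?s2 a))"
    by (rule Suc.hyps(1)) (use assms Suc in simp_all)
  moreover have "?s2(a := 0, b := ?s2 b + ?s2 a, c := ?s2 c + ?s2 a) =
      s(a := 0, b := s b + s a, c := s c + s a)"
    using assms Suc(2) by (auto simp: fun_eq_iff)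
  ultimately show ?case
    using Suc(2) exec.Loop_Suc[of s a W "Inc b ;; Inc c" ?s2] by (metis zero_less_Suc)
qed

lemma exec_bounded:
  "exec W c s s' \<Longrightarrow> (\<forall>r. s r < 2 ^ W) \<Longrightarrow> (\<forall>r. s' r < 2 ^ W)"
  by (induction rule: exec.induct) (simp_all add: less_imp_diff_less)


text \<open>
  The arguments of \<open>f\<close> are the variables of an environment. A program must exist for every
  placement \<open>\<rho>\<close> of the environment into the registers below \<open>t\<close>, so that renaming variables costs
  nothing; the registers from \<open>t\<close> on are scratch space.
\<close>

definition pspace_fun :: "((nat \<Rightarrow> nat) \<Rightarrow> nat) \<Rightarrow> bool" where
  "pspace_fun f \<longleftrightarrow> (\<forall>\<rho> t. (\<forall>i. \<rho> i < t) \<longrightarrow>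
     (\<exists>c W. polybounded t W \<and>
       (\<forall>s. (\<forall>r\<ge>t. s r = 0) \<longrightarrow> exec (W s) c s (s(t := f (s \<circ> \<rho>))))))"

text \<open>A bound on the accumulator of a loop need not be computed by any program; only the
  number of its digits matters. Hence a notion of its own, implied by
  \<open>pspace_fun\<close>.\<close>

definition size_bounded :: "((nat \<Rightarrow> nat) \<Rightarrow> nat) \<Rightarrow> bool" where
  "size_bounded f \<longleftrightarrow> (\<forall>\<rho> t. (\<forall>i. \<rho> i < t) \<longrightarrow> polybounded t (\<lambda>s. lg (f (s \<circ> \<rho>))))"

lemma pspace_funE:
  assumes "pspace_fun f" "\<forall>i. \<rho> i < t"
  obtains W c where "polybounded t W"
    "\<forall>s. (\<forall>r\<ge>t. s r = 0) \<longrightarrow> exec (W s) c s (s(t := f (s \<circ> \<rho>)))"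
proof -
  have "\<exists>c W. polybounded t W \<and>
      (\<forall>s. (\<forall>r\<ge>t. s r = 0) \<longrightarrow> exec (W s) c s (s(t := f (s \<circ> \<rho>))))"
    by (rule assms(1)[unfolded pspace_fun_def, THEN spec, THEN spec, THEN mp, OF assms(2)])
  then obtain c W where W: "polybounded t W"
    and c: "\<forall>s. (\<forall>r\<ge>t. s r = 0) \<longrightarrow> exec (W s) c s (s(t := f (s \<circ> \<rho>)))"
    by (elim exE conjE)
  show thesis
    by (rule that[OF W c])
qed

text \<open>A program that runs in width \<open>W\<close> on registers fitting into it cannot leave
  a larger number behind. The store is first cut off from \<open>t\<close> on: \<open>f\<close>
  reads only lower registers, but the specification of the program speaks about stores with empty
  scratch space.\<close>

lemma pspace_fun_size_bounded:
  assumes "pspace_fun f"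
  shows "size_bounded f"
  unfolding size_bounded_def
proof (intro allI impI)
  fix \<rho> :: "nat \<Rightarrow> nat" and t
  assume \<rho>: "\<forall>i. \<rho> i < t"
  obtain c W where W: "polybounded t W"
    and c: "\<forall>s. (\<forall>r\<ge>t. s r = 0) \<longrightarrow> exec (W s) c s (s(t := f (s \<circ> \<rho>)))"
    by (rule pspace_funE[OF assms \<rho>])
  define cut where "cut s = (\<lambda>r. if r < t then s r else 0)" for s :: "nat \<Rightarrow> nat"
  have cut: "space t (cut s) = space t s" "cut s \<circ> \<rho> = s \<circ> \<rho>" for s
    using \<rho> by (auto simp: space_def cut_def)
  have le: "lg (f (s \<circ> \<rho>)) \<le> W (cut s) + space t s" for s
  proof -
    have 1: "exec (W (cut s) + space t s) c (cut s) ((cut s)(t := f (s \<circ> \<rho>)))"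
      using exec_mono[OF c[THEN spec, THEN mp, of "cut s"]] cut(2)[of s] by (simp add: cut_def)
    have 2: "cut s r < 2 ^ (W (cut s) + space t s)" for r
    proof (cases "r < t")
      case True
      then have "lg (s r) \<le> W (cut s) + space t s"
        using lg_le_space[of r t s] by simp
      then show ?thesis
        using True by (simp add: lg_le_iff cut_def)
    qed (simp add: cut_def)
    from exec_bounded[OF 1 allI[OF 2], THEN spec, of t] show ?thesis
      by (simp add: lg_le_iff)
  qed
  have "polybounded t (\<lambda>s. W (cut s) + space t s)"
    using polybounded_compose[OF W, of t cut] polybounded_space[of t]
    by (intro polybounded_add) (simp_all add: cut)
  then show "polybounded t (\<lambda>s. lg (f (s \<circ> \<rho>)))"
    by (rule polybounded_mono) (rule le)
qed

lemma pspace_fun_rename: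
  assumes "pspace_fun f"
  shows "pspace_fun (\<lambda>e. f (\<lambda>i. e (\<sigma> i)))"
  unfolding pspace_fun_def
proof (intro allI impI)
  fix \<rho> :: "nat \<Rightarrow> nat" and t
  assume "\<forall>i. \<rho> i < t"
  then have "\<forall>i. (\<rho> \<circ> \<sigma>) i < t"
    by simp
  then obtain c W where W: "polybounded t W"
    and c: "\<forall>s. (\<forall>r\<ge>t. s r = 0) \<longrightarrow> exec (W s) c s (s(t := f (s \<circ> (\<rho> \<circ> \<sigma>))))"
    by (rule pspace_funE[OF assms])
  show "\<exists>c W. polybounded t W \<and>
      (\<forall>s. (\<forall>r\<ge>t. s r = 0) \<longrightarrow> exec (W s) c s (s(t := f (\<lambda>i. (s \<circ> \<rho>) (\<sigma> i)))))"
    using W c by (intro exI[of _ c] exI[of _ W]) (simp add: comp_def)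
qed

text \<open>Reading empties a register. Its content is therefore copied into the target and a spare
  register, and moved back from the latter.\<close>

lemma pspace_fun_var: "pspace_fun (\<lambda>e. e i)"
  unfolding pspace_fun_def
proof (intro allI impI)
  fix \<rho> :: "nat \<Rightarrow> nat" and t
  assume \<rho>: "\<forall>i. \<rho> i < t"
  let ?a = "\<rho> i"
  have a: "?a < t" using \<rho> by simp
  let ?c = "Loop ?a (Inc t ;; Inc (Suc t)) ;; Loop (Suc t) (Inc ?a)"
  have "exec (space t s) ?c s (s(t := (s \<circ> \<rho>) i))" if s: "\<forall>r\<ge>t. s r = 0" for s
  proof (rule exec.Seq)
    have lt: "s ?a < 2 ^ space t s"
      using lg_le_space[OF a, of s] by (simp add: lg_le_iff)
    show "exec (space t s) (Loop ?a (Inc t ;; Inc (Suc t))) s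
        (s(?a := 0, t := s t + s ?a, Suc t := s (Suc t) + s ?a))"
      by (rule exec_copy) (use a s lt in auto)
    let ?s = "s(?a := 0, t := s t + s ?a, Suc t := s (Suc t) + s ?a)"
    have "exec (space t s) (Loop (Suc t) (Inc ?a)) ?s (?s(Suc t := 0, ?a := ?s ?a + ?s (Suc t)))"
      by (rule exec_move) (use a s lt in auto)
    moreover have "?s(Suc t := 0, ?a := ?s ?a + ?s (Suc t)) = s(t := (s \<circ> \<rho>) i)"
      using a s by (auto simp: fun_eq_iff)
    ultimately show "exec (space t s) (Loop (Suc t) (Inc ?a)) ?s (s(t := (s \<circ> \<rho>) i))"
      by metis
  qed
  then show "\<exists>c W. polybounded t W \<and> (\<forall>s. (\<forall>r\<ge>t. s r = 0) \<longrightarrow> exec (W s) c s (s(t := (s \<circ> \<rho>) i)))"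
    using polybounded_space by blast
qed

lemma pspace_fun_0: "pspace_fun (\<lambda>e. 0)"
  unfolding pspace_fun_def
proof (intro allI impI)
  fix \<rho> :: "nat \<Rightarrow> nat" and t
  have "exec 0 Skip s (s(t := 0))" if "\<forall>r\<ge>t. s r = 0" for s
    using that exec.Skip[of 0 s] by (simp add: fun_upd_idem)
  then show "\<exists>c W. polybounded t W \<and> (\<forall>s. (\<forall>r\<ge>t. s r = 0) \<longrightarrow> exec (W s) c s (s(t := 0)))"
    using polybounded_const[of t 0] by blast
qed

lemma pspace_fun_Suc:
  assumes "pspace_fun f"
  shows "pspace_fun (\<lambda>e. Suc (f e))"
  unfolding pspace_fun_def
proof (intro allI impI)
  fix \<rho> :: "nat \<Rightarrow> nat" and t
  assume \<rho>: "\<forall>i. \<rho> i < t"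
  obtain c W where W: "polybounded t W"
    and c: "\<forall>s. (\<forall>r\<ge>t. s r = 0) \<longrightarrow> exec (W s) c s (s(t := f (s \<circ> \<rho>)))"
    by (rule pspace_funE[OF assms \<rho>])
  let ?W = "\<lambda>s. W s + (lg (f (s \<circ> \<rho>)) + 1)"
  have "polybounded t ?W"
    using pspace_fun_size_bounded[OF assms] W \<rho>
    by (intro polybounded_intros) (auto simp: size_bounded_def)
  moreover have "exec (?W s) (c ;; Inc t) s (s(t := Suc (f (s \<circ> \<rho>))))" if s: "\<forall>r\<ge>t. s r = 0" for s
  proof (rule exec.Seq)
    let ?s = "s(t := f (s \<circ> \<rho>))"
    show "exec (?W s) c s ?s"
      by (rule exec_mono[OF c[THEN spec, THEN mp, OF s]]) simp
    have "lg (Suc (f (s \<circ> \<rho>))) \<le> ?W s"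
      using lg_Suc[of "f (s \<circ> \<rho>)"] by simp
    then have "exec (?W s) (Inc t) ?s (?s(t := Suc (?s t)))"
      by (intro exec.Inc) (simp add: lg_le_iff)
    then show "exec (?W s) (Inc t) ?s (s(t := Suc (f (s \<circ> \<rho>))))"
      by simp
  qed
  ultimately show "\<exists>c W. polybounded t W \<and>
      (\<forall>s. (\<forall>r\<ge>t. s r = 0) \<longrightarrow> exec (W s) c s (s(t := Suc (f (s \<circ> \<rho>)))))"
    by blast
qed

lemma pspace_fun_pred:
  assumes "pspace_fun f"
  shows "pspace_fun (\<lambda>e. f e - 1)"
  unfolding pspace_fun_def
proof (intro allI impI)
  fix \<rho> :: "nat \<Rightarrow> nat" and t
  assume \<rho>: "\<forall>i. \<rho> i < t"
  obtain c W where W: "polybounded t W"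
    and c: "\<forall>s. (\<forall>r\<ge>t. s r = 0) \<longrightarrow> exec (W s) c s (s(t := f (s \<circ> \<rho>)))"
    by (rule pspace_funE[OF assms \<rho>])
  have "exec (W s) (c ;; Dec t) s (s(t := f (s \<circ> \<rho>) - 1))" if s: "\<forall>r\<ge>t. s r = 0" for s
  proof (rule exec.Seq)
    let ?s = "s(t := f (s \<circ> \<rho>))"
    show "exec (W s) c s ?s"
      by (rule c[THEN spec, THEN mp, OF s])
    have "exec (W s) (Dec t) ?s (?s(t := ?s t - 1))"
      by (rule exec.Dec)
    then show "exec (W s) (Dec t) ?s (s(t := f (s \<circ> \<rho>) - 1))"
      by simp
  qed
  then show "\<exists>c W. polybounded t W \<and>
      (\<forall>s. (\<forall>r\<ge>t. s r = 0) \<longrightarrow> exec (W s) c s (s(t := f (s \<circ> \<rho>) - 1)))"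
    using W by blast
qed

text \<open>The index runs downwards because it is the register of the loop itself.\<close>

primrec down :: "(nat \<Rightarrow> 'a \<Rightarrow> 'a) \<Rightarrow> nat \<Rightarrow> 'a \<Rightarrow> 'a" where
  "down f 0 x = x"
| "down f (Suc i) x = down f i (f i x)"

text \<open>Bounded recursion: the number of passes may be exponential, but the accumulator must
  stay below a bound \<open>b\<close> of polynomial size. The invariant \<open>I\<close> is there
  because such a bound is rarely inductive by itself. Registers \<open>t\<close> and
  \<open>Suc t\<close> hold index and accumulator, and \<open>\<rho>'\<close> presents them to the
  body as variables 0 and 1.\<close>

lemma pspace_fun_down:
  assumes n: "pspace_fun n" and z: "pspace_fun z"
    and f: "pspace_fun (\<lambda>e. f (e 0) (e (Suc 0)) (\<lambda>j. e (Suc (Suc j))))"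
    and b: "size_bounded b"
    and I0: "\<And>e. I e (n e) (z e)"
    and IS: "\<And>e i x. i < n e \<Longrightarrow> I e (Suc i) x \<Longrightarrow> I e i (f i x e)"
    and Ib: "\<And>e i x. i \<le> n e \<Longrightarrow> I e i x \<Longrightarrow> x \<le> b e"
  shows "pspace_fun (\<lambda>e. down (\<lambda>i x. f i x e) (n e) (z e))"
  unfolding pspace_fun_def
proof (intro allI impI)
  fix \<rho> :: "nat \<Rightarrow> nat" and t
  assume \<rho>: "\<forall>i. \<rho> i < t"
  obtain cn Wn where Wn: "polybounded t Wn"
    and cn: "\<forall>s. (\<forall>r\<ge>t. s r = 0) \<longrightarrow> exec (Wn s) cn s (s(t := n (s \<circ> \<rho>)))"
    by (rule pspace_funE[OF n \<rho>])
  obtain cz Wz where Wz: "polybounded (Suc t) Wz"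
    and cz: "\<forall>s. (\<forall>r\<ge>Suc t. s r = 0) \<longrightarrow> exec (Wz s) cz s (s(Suc t := z (s \<circ> \<rho>)))"
    by (rule pspace_funE[OF z, of \<rho> "Suc t"]) (use \<rho> in \<open>auto intro: less_SucI\<close>)
  define \<rho>' where "\<rho>' = case_nat t (case_nat (Suc t) \<rho>)"
  have \<rho>': "\<forall>i. \<rho>' i < t + 2"
    using less_trans[OF spec[OF \<rho>], of "t + 2"] by (auto simp: \<rho>'_def split: nat.split)
  obtain cf Wf where Wf: "polybounded (t + 2) Wf"
    and cf: "\<forall>s. (\<forall>r\<ge>t + 2. s r = 0) \<longrightarrow> exec (Wf s) cf s
      (s(t + 2 := f ((s \<circ> \<rho>') 0) ((s \<circ> \<rho>') (Suc 0)) (\<lambda>j. (s \<circ> \<rho>') (Suc (Suc j)))))"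
    by (rule pspace_funE[OF f \<rho>'])
  obtain k where k: "\<And>s. Wf s \<le> space (t + 2) s ^ k"
    using Wf by (auto simp: polybounded_def)
  let ?body = "cf ;; Loop (Suc t) Skip ;; Loop (t + 2) (Inc (Suc t))"
  let ?c = "cn ;; cz ;; Loop t ?body ;; Loop (Suc t) (Inc t)"
  \<comment> \<open>The summands cover the two initialisations, one evaluation of \<open>f\<close>
    with the largest possible index and accumulator, and all moves of the accumulator.\<close>
  let ?W = "\<lambda>s. Wn s + Wz (s(t := n (s \<circ> \<rho>)))
    + (space t s + lg (n (s \<circ> \<rho>)) + lg (b (s \<circ> \<rho>))) ^ k + lg (b (s \<circ> \<rho>))"
  have nb: "polybounded t (\<lambda>s. lg (n (s \<circ> \<rho>)))" "polybounded t (\<lambda>s. lg (b (s \<circ> \<rho>)))"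
    using b pspace_fun_size_bounded[OF n] \<rho> by (auto simp: size_bounded_def)
  have "polybounded t (\<lambda>s. Wz (s(t := n (s \<circ> \<rho>))))"
    by (rule polybounded_compose[OF Wz]) (auto intro: polybounded_intros nb simp: space_update)
  then have "polybounded t ?W"
    using Wn nb by (intro polybounded_intros)
  moreover have "exec (?W s) ?c s (s(t := down (\<lambda>i x. f i x (s \<circ> \<rho>)) (n (s \<circ> \<rho>)) (z (s \<circ> \<rho>))))"
    if s: "\<forall>r\<ge>t. s r = 0" for s
  proof -
    define e where "e = s \<circ> \<rho>"
    define V where "V = ?W s"
    have W: "Wn s \<le> V" "Wz (s(t := n e)) \<le> V" "(space t s + lg (n e) + lg (b e)) ^ k \<le> V"
      "lg (b e) \<le> V"
      unfolding V_def e_def by simp_all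
    have bV: "x < 2 ^ V" if "x \<le> b e" for x
      using W(4) that by (meson lg_le_iff lg_mono le_trans)
    have \<rho>t: "\<rho> i \<noteq> t" "\<rho> i \<noteq> Suc t" "t \<noteq> \<rho> i" "Suc t \<noteq> \<rho> i" for i
      using spec[OF \<rho>, of i] by auto
    let ?st = "\<lambda>i x. s(t := i, Suc t := x)"
    have 1: "exec V cn s (s(t := n e))"
      using exec_mono[OF cn[THEN spec, THEN mp, OF s] W(1)[unfolded e_def]] by (simp add: e_def)
    have "(s(t := n e)) \<circ> \<rho> = e"
      using \<rho>t by (auto simp: e_def)
    then have 2: "exec V cz (s(t := n e)) (?st (n e) (z e))"
      using exec_mono[OF cz[THEN spec, THEN mp] W(2)] s by simp
    have env: "f ((?st i x \<circ> \<rho>') 0) ((?st i x \<circ> \<rho>') (Suc 0)) (\<lambda>j. (?st i x \<circ> \<rho>') (Suc (Suc j))) = f i x e"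
      for i x
      using \<rho>t by (simp add: \<rho>'_def e_def comp_def)
    have 3: "I e i x \<Longrightarrow> i \<le> n e \<Longrightarrow>
      exec V (Loop t ?body) (?st i x) (?st 0 (down (\<lambda>i x. f i x e) i x)) \<and> down (\<lambda>i x. f i x e) i x \<le> b e"
      for i x
    proof (induction i arbitrary: x)
      case 0
      have "exec V (Loop t ?body) (?st 0 x) (?st 0 x)"
        by (rule exec.Loop_0) simp
      then show ?case
        using Ib[OF _ 0(1)] by (simp del: fun_upd_apply)
    next
      case (Suc i)
      let ?y = "f i x e"
      have I: "I e i ?y"
        using IS Suc.prems by simp
      have x: "x \<le> b e" and y: "?y \<le> b e"
        using Ib[OF _ Suc.prems(1)] Ib[OF _ I] Suc.prems by auto
      have "Wf (?st i x) \<le> (space t s + lg i + lg x) ^ k"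
        using k[of "?st i x"] by (simp only: space_update2)
      also have "\<dots> \<le> (space t s + lg (n e) + lg (b e)) ^ k"
        using Suc.prems x by (intro power_mono add_mono lg_mono) auto
      finally have WfV: "Wf (?st i x) \<le> V"
        using W(3) by simp
      have "exec V cf (?st i x) ((?st i x)(t + 2 := ?y))"
        using exec_mono[OF cf[THEN spec, THEN mp] WfV] s env[of i x] by simp
      moreover have "exec V (Loop (Suc t) Skip) ((?st i x)(t + 2 := ?y)) ((?st i 0)(t + 2 := ?y))"
        using exec_clear[of V "Suc t" "(?st i x)(t + 2 := ?y)"] by (simp add: fun_upd_twist)
      moreover have "exec V (Loop (t + 2) (Inc (Suc t))) ((?st i 0)(t + 2 := ?y)) (?st i ?y)"
      proof -
        let ?u = "(?st i 0)(t + 2 := ?y)"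
        have "exec V (Loop (t + 2) (Inc (Suc t))) ?u (?u(t + 2 := 0, Suc t := ?u (Suc t) + ?u (t + 2)))"
          by (rule exec_move) (use bV[OF y] in simp_all)
        moreover have "?u(t + 2 := 0, Suc t := ?u (Suc t) + ?u (t + 2)) = ?st i ?y"
          using s by (auto simp: fun_eq_iff)
        ultimately show ?thesis
          by metis
      qed
      ultimately have "exec V ?body (?st i x) (?st i ?y)"
        by (blast intro: exec.Seq)
      then have "exec V ?body ((?st (Suc i) x)(t := ?st (Suc i) x t - 1)) (?st i ?y)"
        by (simp add: fun_upd_twist)
      moreover have "exec V (Loop t ?body) (?st i ?y) (?st 0 (down (\<lambda>i x. f i x e) i ?y))"
        "down (\<lambda>i x. f i x e) i ?y \<le> b e"
        using Suc.IH[OF I] Suc.prems by (simp_all del: fun_upd_apply)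
      moreover have "0 < ?st (Suc i) x t"
        by simp
      ultimately show ?case
        using exec.Loop_Suc[of "?st (Suc i) x" t V ?body] by (simp only: down.simps)
    qed
    let ?r = "down (\<lambda>i x. f i x e) (n e) (z e)"
    have r: "exec V (Loop t ?body) (?st (n e) (z e)) (?st 0 ?r)" "?r \<le> b e"
      using 3[OF I0[of e]] by auto
    have "exec V (Loop (Suc t) (Inc t)) (?st 0 ?r) ((?st 0 ?r)(Suc t := 0, t := ?st 0 ?r t + ?st 0 ?r (Suc t)))"
      by (rule exec_move) (use bV[OF r(2)] in simp_all)
    moreover have "(?st 0 ?r)(Suc t := 0, t := ?st 0 ?r t + ?st 0 ?r (Suc t)) = s(t := ?r)"
      using s by (auto simp: fun_eq_iff)
    ultimately have "exec V (Loop (Suc t) (Inc t)) (?st 0 ?r) (s(t := ?r))"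
      by metis
    then have "exec V ?c s (s(t := ?r))"
      using 1 2 r(1) by (blast intro: exec.Seq)
    then show ?thesis
      by (simp only: V_def e_def)
  qed
  ultimately show "\<exists>c W. polybounded t W \<and>
      (\<forall>s. (\<forall>r\<ge>t. s r = 0) \<longrightarrow> exec (W s) c s
        (s(t := down (\<lambda>i x. f i x (s \<circ> \<rho>)) (n (s \<circ> \<rho>)) (z (s \<circ> \<rho>)))))"
    by blast
qed

theorem pspace_fun_in_PSPACE:
  assumes "pspace_fun f"
  shows "{w. f (\<lambda>_. code w) > 0} \<in> PSPACE"
proof -
  obtain c W where W: "polybounded 1 W"
    and c: "\<forall>s. (\<forall>r\<ge>1. s r = 0) \<longrightarrow> exec (W s) c s (s(1 := f (s \<circ> (\<lambda>_. 0))))"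
    by (rule pspace_funE[OF assms, of "\<lambda>_. 0" 1]) simp
  obtain k where k: "\<And>s. W s \<le> space 1 s ^ k"
    using W by (auto simp: polybounded_def)
  \<comment> \<open>The code of a word of length \<open>n\<close> has at most \<open>2 * n\<close>
    bits. The exponent \<open>Suc k\<close> instead of \<open>k\<close> guarantees
    \<open>2 * n \<le> poly p n\<close> even for \<open>k = 0\<close>.\<close>
  define p :: "nat poly" where "p = [:2, 2:] ^ Suc k"
  have p: "poly p n = (2 + 2 * n) ^ Suc k" for n
    unfolding p_def poly_power by (simp add: mult.commute del: power_Suc)
  show ?thesis
  proof (rule exec_in_PSPACE[where p = p])
    fix n :: nat
    have "2 * n \<le> (2 + 2 * n) ^ 1"
      by simp
    also have "\<dots> \<le> (2 + 2 * n) ^ Suc k"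
      by (rule power_increasing) auto
    finally show "2 * n \<le> poly p n"
      by (simp add: p)
  next
    fix w
    let ?s = "\<lambda>r :: nat. if r = 0 then code w else 0"
    have bits: "bits_val bs < 2 ^ length bs" for bs
      by (induction bs) auto
    have "lg (code w) \<le> 2 * length w"
      unfolding lg_le_iff code_def using bits[of "code_bits w"] by simp
    then have "W ?s \<le> (2 + 2 * length w) ^ k"
      using k[of ?s] power_mono[of "2 + lg (code w)" "2 + 2 * length w" k] by (simp add: space_def)
    also have "\<dots> \<le> poly p (length w)"
      unfolding p by (rule power_increasing) auto
    finally have le: "W ?s \<le> poly p (length w)" .
    have zero: "\<forall>r\<ge>1. ?s r = 0"
      by auto
    have "exec (poly p (length w)) c ?s (?s(1 := f (?s \<circ> (\<lambda>_. 0))))"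
      by (rule exec_mono[OF c[THEN spec, THEN mp, OF zero] le])
    then show "\<exists>s. exec (poly p (length w)) c ?s s \<and> (s 1 > 0 \<longleftrightarrow> w \<in> {w. f (\<lambda>_. code w) > 0})"
      by (intro exI[of _ "?s(1 := f (?s \<circ> (\<lambda>_. 0)))"]) (simp add: comp_def)
  qed
qed

section \<open>Closure under arithmetic\<close>

lemma size_bounded_add:
  assumes "size_bounded f" "size_bounded g"
  shows "size_bounded (\<lambda>e. f e + g e)"
  unfolding size_bounded_def
proof (intro allI impI)
  fix \<rho> :: "nat \<Rightarrow> nat" and t
  assume "\<forall>i. \<rho> i < t"
  then have "polybounded t (\<lambda>s. lg (f (s \<circ> \<rho>)) + lg (g (s \<circ> \<rho>)) + 1)"
    using assms by (intro polybounded_intros) (auto simp: size_bounded_def)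
  then show "polybounded t (\<lambda>s. lg (f (s \<circ> \<rho>) + g (s \<circ> \<rho>)))"
    by (rule polybounded_mono) (rule lg_add)
qed

lemma size_bounded_mult:
  assumes "size_bounded f" "size_bounded g"
  shows "size_bounded (\<lambda>e. f e * g e)"
  unfolding size_bounded_def
proof (intro allI impI)
  fix \<rho> :: "nat \<Rightarrow> nat" and t
  assume "\<forall>i. \<rho> i < t"
  then have "polybounded t (\<lambda>s. lg (f (s \<circ> \<rho>)) + lg (g (s \<circ> \<rho>)))"
    using assms by (intro polybounded_intros) (auto simp: size_bounded_def)
  then show "polybounded t (\<lambda>s. lg (f (s \<circ> \<rho>) * g (s \<circ> \<rho>)))"
    by (rule polybounded_mono) (rule lg_mult)
qed

text \<open>The exponent is a bit length: a power \<open>f e ^ g e\<close> would in general have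
  exponentially many bits.\<close>

lemma size_bounded_power_lg:
  assumes "size_bounded f" "size_bounded g"
  shows "size_bounded (\<lambda>e. f e ^ lg (g e))"
  unfolding size_bounded_def
proof (intro allI impI)
  fix \<rho> :: "nat \<Rightarrow> nat" and t
  assume "\<forall>i. \<rho> i < t"
  then have "polybounded t (\<lambda>s. lg (g (s \<circ> \<rho>)) * lg (f (s \<circ> \<rho>)) + 1)"
    using assms by (intro polybounded_intros) (auto simp: size_bounded_def)
  then show "polybounded t (\<lambda>s. lg (f (s \<circ> \<rho>) ^ lg (g (s \<circ> \<rho>))))"
    by (rule polybounded_mono) (rule lg_power)
qed

lemma pspace_fun_const: "pspace_fun (\<lambda>e. c)"
  by (induction c) (auto intro: pspace_fun_0 pspace_fun_Suc)

lemma size_bounded_const: "size_bounded (\<lambda>e. c)"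
  by (rule pspace_fun_size_bounded[OF pspace_fun_const])

lemmas size_bounded_intros = size_bounded_const size_bounded_add size_bounded_mult size_bounded_power_lg
  pspace_fun_size_bounded

lemma down_const: "down (\<lambda>i x. y) n z = (if n = 0 then z else y)"
  by (induction n arbitrary: z) auto

lemma down_funpow: "down (\<lambda>i. f) n x = (f ^^ n) x"
  by (induction n arbitrary: x) (simp_all add: funpow_swap1)

text \<open>A loop whose body ignores index and accumulator yields its initial value after no pass
  and \<open>h e\<close> after any positive number of passes.\<close>

lemma pspace_fun_if_0:
  assumes f: "pspace_fun f" and g: "pspace_fun g" and h: "pspace_fun h"
  shows "pspace_fun (\<lambda>e. if f e = 0 then g e else h e)"
proof -
  have "pspace_fun (\<lambda>e. down (\<lambda>i x. h e) (f e) (g e))"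
  proof (rule pspace_fun_down[where I = "\<lambda>e i x. x \<le> g e + h e" and b = "\<lambda>e. g e + h e"])
    show "size_bounded (\<lambda>e. g e + h e)"
      using g h by (intro size_bounded_intros)
  qed (use f g pspace_fun_rename[OF h] in auto)
  then show ?thesis
    by (simp only: down_const)
qed

lemma pspace_fun_add:
  assumes f: "pspace_fun f" and g: "pspace_fun g"
  shows "pspace_fun (\<lambda>e. f e + g e)"
proof -
  have "pspace_fun (\<lambda>e. down (\<lambda>i x. Suc x) (g e) (f e))"
  proof (rule pspace_fun_down[where I = "\<lambda>e i x. x + i = f e + g e" and b = "\<lambda>e. f e + g e"])
    show "size_bounded (\<lambda>e. f e + g e)"
      using f g by (intro size_bounded_intros)
  qed (use f g pspace_fun_Suc[OF pspace_fun_var] in auto)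
  moreover have "down (\<lambda>i x. Suc x) n x = x + n" for n x
    by (induction n arbitrary: x) auto
  ultimately show ?thesis
    by simp
qed

lemma pspace_fun_diff:
  assumes f: "pspace_fun f" and g: "pspace_fun g"
  shows "pspace_fun (\<lambda>e. f e - g e)"
proof -
  have "pspace_fun (\<lambda>e. down (\<lambda>i x. x - 1) (g e) (f e))"
  proof (rule pspace_fun_down[where I = "\<lambda>e i x. x \<le> f e" and b = f])
    show "size_bounded f"
      using f by (intro size_bounded_intros)
  qed (use f g pspace_fun_pred[OF pspace_fun_var] in auto)
  moreover have "down (\<lambda>i x. x - 1) n x = x - n" for n and x :: nat
    by (induction n arbitrary: x) auto
  ultimately show ?thesis
    by simp
qed

lemma pspace_fun_mult:
  assumes f: "pspace_fun f" and g: "pspace_fun g"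
  shows "pspace_fun (\<lambda>e. f e * g e)"
proof -
  have "pspace_fun (\<lambda>e. down (\<lambda>i x. x + f e) (g e) 0)"
  proof (rule pspace_fun_down[where I = "\<lambda>e i x. x + i * f e = f e * g e" and b = "\<lambda>e. f e * g e"])
    show "size_bounded (\<lambda>e. f e * g e)"
      using f g by (intro size_bounded_intros)
    show "pspace_fun (\<lambda>e. e (Suc 0) + f (\<lambda>j. e (Suc (Suc j))))"
      by (intro pspace_fun_add pspace_fun_var pspace_fun_rename[OF f])
  qed (use g pspace_fun_const in \<open>auto simp: algebra_simps\<close>)
  moreover have "down (\<lambda>i x. x + y) n x = x + n * y" for n x y :: nat
    by (induction n arbitrary: x) auto
  ultimately show ?thesis
    by (simp add: mult.commute)
qed


section \<open>Predicates, bounded quantifiers and bounded search\<close>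

definition pspace_pred :: "((nat \<Rightarrow> nat) \<Rightarrow> bool) \<Rightarrow> bool" where
  "pspace_pred P \<longleftrightarrow> pspace_fun (\<lambda>e. of_bool (P e))"

lemma pspace_pred_rename: "pspace_pred P \<Longrightarrow> pspace_pred (\<lambda>e. P (\<lambda>i. e (\<sigma> i)))"
  unfolding pspace_pred_def by (rule pspace_fun_rename[where f = "\<lambda>e. of_bool (P e)"])

lemma pspace_fun_If:
  assumes "pspace_pred P" "pspace_fun f" "pspace_fun g"
  shows "pspace_fun (\<lambda>e. if P e then f e else g e)"
proof -
  have eq: "(\<lambda>e. if of_bool (P e) = (0::nat) then g e else f e) = (\<lambda>e. if P e then f e else g e)"
    by auto
  show ?thesis
    using pspace_fun_if_0[OF assms(1)[unfolded pspace_pred_def] assms(3,2)] unfolding eq .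
qed

lemma pspace_pred_eq_0: "pspace_fun f \<Longrightarrow> pspace_pred (\<lambda>e. f e = 0)"
  unfolding pspace_pred_def of_bool_def by (intro pspace_fun_if_0 pspace_fun_const)

lemma pspace_pred_le: "pspace_fun f \<Longrightarrow> pspace_fun g \<Longrightarrow> pspace_pred (\<lambda>e. f e \<le> g e)"
  using pspace_pred_eq_0[OF pspace_fun_diff[of f g]] by simp

lemma pspace_pred_less: "pspace_fun f \<Longrightarrow> pspace_fun g \<Longrightarrow> pspace_pred (\<lambda>e. f e < g e)"
  using pspace_pred_le[OF pspace_fun_Suc[of f], of g] by (simp add: Suc_le_eq)

lemma pspace_pred_not: "pspace_pred P \<Longrightarrow> pspace_pred (\<lambda>e. \<not> P e)"
  using pspace_pred_eq_0[of "\<lambda>e. of_bool (P e)"] by (simp add: pspace_pred_def)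

lemma pspace_pred_if:
  assumes "pspace_pred P" "pspace_pred Q" "pspace_pred R"
  shows "pspace_pred (\<lambda>e. if P e then Q e else R e)"
  using pspace_fun_If[OF assms(1) assms(2,3)[unfolded pspace_pred_def]]
  by (simp add: pspace_pred_def if_distrib)

lemma pspace_pred_const: "pspace_pred (\<lambda>e. c)"
  unfolding pspace_pred_def by (rule pspace_fun_const)

lemma pspace_pred_conj:
  assumes "pspace_pred P" "pspace_pred Q"
  shows "pspace_pred (\<lambda>e. P e \<and> Q e)"
proof -
  have "(\<lambda>e. if P e then Q e else False) = (\<lambda>e. P e \<and> Q e)"
    by auto
  then show ?thesis
    using pspace_pred_if[OF assms pspace_pred_const[of False]] by simp
qed

lemma pspace_pred_disj:
  assumes "pspace_pred P" "pspace_pred Q"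
  shows "pspace_pred (\<lambda>e. P e \<or> Q e)"
  using pspace_pred_not[OF pspace_pred_conj[OF assms[THEN pspace_pred_not]]] by simp

lemma pspace_pred_iff:
  assumes "pspace_pred P" "pspace_pred Q"
  shows "pspace_pred (\<lambda>e. P e \<longleftrightarrow> Q e)"
proof -
  have "(\<lambda>e. if P e then Q e else \<not> Q e) = (\<lambda>e. P e \<longleftrightarrow> Q e)"
    by auto
  then show ?thesis
    using pspace_pred_if[OF assms pspace_pred_not[OF assms(2)]] by simp
qed

lemma pspace_pred_imp:
  assumes "pspace_pred P" "pspace_pred Q"
  shows "pspace_pred (\<lambda>e. P e \<longrightarrow> Q e)"
  unfolding imp_conv_disj by (intro pspace_pred_disj pspace_pred_not assms)

lemma pspace_pred_eq: "pspace_fun f \<Longrightarrow> pspace_fun g \<Longrightarrow> pspace_pred (\<lambda>e. f e = g e)"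
  unfolding order_eq_iff[of "f _"] by (intro pspace_pred_conj pspace_pred_le)

lemma pspace_pred_bex:
  assumes b: "pspace_fun b" and P: "pspace_pred (\<lambda>e. P (e 0) (\<lambda>j. e (Suc j)))"
  shows "pspace_pred (\<lambda>e. \<exists>y<b e. P y e)"
proof -
  have "pspace_fun (\<lambda>e. down (\<lambda>i x. if P i e then 1 else x) (b e) 0)"
  proof (rule pspace_fun_down[where I = "\<lambda>e i x. x \<le> 1" and b = "\<lambda>e. 1"])
    show "pspace_fun (\<lambda>e. if P (e 0) (\<lambda>j. e (Suc (Suc j))) then 1 else e (Suc 0))"
      using pspace_pred_rename[OF P, of "case_nat 0 (\<lambda>j. Suc (Suc j))"]
      by (intro pspace_fun_If pspace_fun_const pspace_fun_var) simp
  qed (auto intro: b pspace_fun_const size_bounded_const)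
  moreover have "down (\<lambda>i x. if Q i then 1 else x) n x = (if \<exists>y<n. Q y then 1 else x)"
    for Q n and x :: nat
    by (induction n arbitrary: x) (auto simp: less_Suc_eq)
  ultimately show ?thesis
    by (simp add: pspace_pred_def of_bool_def)
qed

lemma pspace_pred_ball:
  assumes b: "pspace_fun b" and P: "pspace_pred (\<lambda>e. P (e 0) (\<lambda>j. e (Suc j)))"
  shows "pspace_pred (\<lambda>e. \<forall>y<b e. P y e)"
proof -
  have "pspace_pred (\<lambda>e. \<not> (\<exists>y<b e. \<not> P y e))"
    using b P by (intro pspace_pred_not pspace_pred_bex)
  then show ?thesis
    by simp
qed

text \<open>Counting down, the last hit to overwrite the accumulator is the least one; the value
  \<open>n\<close> reports that there is none.\<close>

definition search :: "(nat \<Rightarrow> bool) \<Rightarrow> nat \<Rightarrow> nat" where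
  "search P n = down (\<lambda>i x. if P i then i else x) n n"

lemma search_eqI:
  assumes "m \<le> n" "\<And>i. i < m \<Longrightarrow> \<not> P i" "m < n \<Longrightarrow> P m"
  shows "search P n = m"
proof -
  have "down (\<lambda>i x. if P i then i else x) k m = m" if "k \<le> m" for k
    using that assms(2) by (induction k) auto
  moreover have "down (\<lambda>i x. if P i then i else x) k x = m" if "m < k" "k \<le> n" for k x
    using that
  proof (induction k arbitrary: x)
    case (Suc k)
    then show ?case
      using calculation[of k] assms(3) by (cases "m = k") auto
  qed simp
  ultimately show ?thesis
    using assms(1) unfolding search_def by (cases "m = n") auto
qed

lemma search_cases:
  obtains "search P n = n" "\<And>i. i < n \<Longrightarrow> \<not> P i"
  | "search P n < n" "P (search P n)" "\<And>i. i < search P n \<Longrightarrow> \<not> P i"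
proof (cases "\<exists>i<n. P i")
  case True
  define m where "m = (LEAST i. P i)"
  have "P m" "m < n" "\<And>i. i < m \<Longrightarrow> \<not> P i"
    using True unfolding m_def by (auto intro: LeastI Least_le le_less_trans dest: not_less_Least)
  moreover from this have "search P n = m"
    by (intro search_eqI) auto
  ultimately show ?thesis
    using that(2) by simp
next
  case False
  then have "search P n = n"
    by (intro search_eqI) auto
  then show ?thesis
    using False that(1) by blast
qed

lemma search_le: "search P n \<le> n"
  by (rule search_cases[of P n]) auto

lemma pspace_fun_search:
  assumes b: "pspace_fun b" and P: "pspace_pred (\<lambda>e. P (e 0) (\<lambda>j. e (Suc j)))"
  shows "pspace_fun (\<lambda>e. search (\<lambda>y. P y e) (b e))"
  unfolding search_def
proof (rule pspace_fun_down[where I = "\<lambda>e i x. x \<le> b e" and b = b])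
  show "pspace_fun (\<lambda>e. if P (e 0) (\<lambda>j. e (Suc (Suc j))) then e 0 else e (Suc 0))"
    using pspace_pred_rename[OF P, of "case_nat 0 (\<lambda>j. Suc (Suc j))"]
    by (intro pspace_fun_If pspace_fun_const pspace_fun_var) simp
qed (use b pspace_fun_size_bounded[OF b] in auto)

text \<open>The quotient is the least \<open>q\<close> with \<open>f e < Suc q * g e\<close>. A zero
  divisor is treated apart, since no \<open>q\<close> qualifies then and the search would return
  \<open>f e\<close>.\<close>

lemma pspace_fun_div:
  assumes f: "pspace_fun f" and g: "pspace_fun g"
  shows "pspace_fun (\<lambda>e. f e div g e)"
proof -
  have "pspace_fun (\<lambda>e. if g e = 0 then 0 else search (\<lambda>q. f e < Suc q * g e) (f e))"
    by (intro pspace_fun_if_0 pspace_fun_const pspace_fun_search pspace_pred_less pspace_fun_mult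
        pspace_fun_Suc pspace_fun_var f g pspace_fun_rename[OF f] pspace_fun_rename[OF g])
  moreover have "search (\<lambda>q. x < Suc q * y) x = x div y" if "y > 0" for x y :: nat
  proof (rule search_eqI)
    show "\<not> x < Suc q * y" if "q < x div y" for q
      using that less_eq_div_iff_mult_less_eq[OF \<open>y > 0\<close>, of "Suc q" x] by (simp del: mult_Suc)
    show "x < Suc (x div y) * y"
      using less_eq_div_iff_mult_less_eq[OF \<open>y > 0\<close>, of "Suc (x div y)" x] by (simp del: mult_Suc)
  qed simp
  then have "(\<lambda>e. if g e = 0 then 0 else search (\<lambda>q. f e < Suc q * g e) (f e)) = (\<lambda>e. f e div g e)"
    by (intro ext) (simp del: mult_Suc)
  ultimately show ?thesis
    by simp
qed

lemma pspace_fun_mod: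
  assumes "pspace_fun f" "pspace_fun g"
  shows "pspace_fun (\<lambda>e. f e mod g e)"
  unfolding minus_div_mult_eq_mod[symmetric]
  by (intro pspace_fun_diff pspace_fun_mult pspace_fun_div assms)

text \<open>Repeated division never writes the power down, so the exponent may be any number, unlike
  in \<open>pspace_fun_power\<close>.\<close>

lemma pspace_fun_div_power:
  assumes f: "pspace_fun f" and g: "pspace_fun g" and h: "pspace_fun h"
  shows "pspace_fun (\<lambda>e. f e div g e ^ h e)"
proof -
  have "pspace_fun (\<lambda>e. down (\<lambda>i x. x div g e) (h e) (f e))"
  proof (rule pspace_fun_down[where I = "\<lambda>e i x. x \<le> f e" and b = f])
    show "pspace_fun (\<lambda>e. e (Suc 0) div g (\<lambda>j. e (Suc (Suc j))))"
      by (intro pspace_fun_div pspace_fun_var pspace_fun_rename[OF g])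
    show "x div g e \<le> f e" if "x \<le> f e" for x e
      using that div_le_dividend[of x "g e"] by linarith
  qed (use f h pspace_fun_size_bounded[OF f] in auto)
  moreover have "down (\<lambda>i x. x div y) n x = x div y ^ n" for n x y :: nat
    by (induction n arbitrary: x) (auto simp: div_mult2_eq)
  ultimately show ?thesis
    by simp
qed

definition digit :: "nat \<Rightarrow> nat \<Rightarrow> nat \<Rightarrow> nat" where
  "digit b x i = x div b ^ i mod b"

lemma pspace_fun_digit:
  "pspace_fun b \<Longrightarrow> pspace_fun f \<Longrightarrow> pspace_fun i \<Longrightarrow> pspace_fun (\<lambda>e. digit (b e) (f e) (i e))"
  unfolding digit_def by (intro pspace_fun_mod pspace_fun_div_power)

lemma pspace_fun_lg:
  assumes f: "pspace_fun f"
  shows "pspace_fun (\<lambda>e. lg (f e))"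
proof -
  have "pspace_fun (\<lambda>e. search (\<lambda>k. f e div 2 ^ k = 0) (f e))"
    by (intro pspace_fun_search pspace_pred_eq pspace_fun_div_power pspace_fun_const pspace_fun_var f
        pspace_fun_rename[OF f])
  moreover have "search (\<lambda>k. x div 2 ^ k = 0) x = lg x" for x
  proof (rule search_eqI)
    show "lg x \<le> x"
      by (rule lg_le_self)
    show "x div 2 ^ i \<noteq> 0" if "i < lg x" for i
      using that lg_le_iff[of x i] by (simp add: div_eq_0_iff)
    show "x div 2 ^ lg x = 0"
      using less_two_power_lg[of x] by simp
  qed
  ultimately show ?thesis
    by simp
qed

lemma pspace_fun_power:
  assumes f: "pspace_fun f" and h: "pspace_fun h" and g: "pspace_fun g" and le: "\<And>e. h e \<le> lg (g e)"
  shows "pspace_fun (\<lambda>e. f e ^ h e)"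
proof -
  have "pspace_fun (\<lambda>e. down (\<lambda>i x. x * f e) (h e) 1)"
  \<comment> \<open>The base \<open>Suc (f e)\<close> makes the powers monotone in the exponent even
    where \<open>f e = 0\<close>.\<close>
  proof (rule pspace_fun_down[where I = "\<lambda>e i x. x \<le> Suc (f e) ^ (h e - i)" and b = "\<lambda>e. Suc (f e) ^ lg (g e)"])
    show "pspace_fun (\<lambda>e. e (Suc 0) * f (\<lambda>j. e (Suc (Suc j))))"
      by (intro pspace_fun_mult pspace_fun_var pspace_fun_rename[OF f])
    show "size_bounded (\<lambda>e. Suc (f e) ^ lg (g e))"
      by (intro size_bounded_power_lg pspace_fun_size_bounded pspace_fun_Suc f g)
    fix e :: "nat \<Rightarrow> nat" and i x
    show "x * f e \<le> Suc (f e) ^ (h e - i)" if "i < h e" "x \<le> Suc (f e) ^ (h e - Suc i)"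
    proof -
      have "x * f e \<le> Suc (f e) ^ (h e - Suc i) * Suc (f e)"
        using that by (intro mult_le_mono) auto
      also have "\<dots> = Suc (f e) ^ (h e - i)"
        using that(1) by (metis Suc_diff_Suc power_Suc2)
      finally show ?thesis .
    qed
    show "x \<le> Suc (f e) ^ lg (g e)" if "x \<le> Suc (f e) ^ (h e - i)"
      using that power_increasing[of "h e - i" "lg (g e)" "Suc (f e)"] le[of e] by linarith
  qed (use h pspace_fun_const in auto)
  moreover have "down (\<lambda>i x. x * y) n x = x * y ^ n" for n x y :: nat
    by (induction n arbitrary: x) auto
  ultimately show ?thesis
    by simp
qed

lemma lg_two_power: "lg (2 ^ n) = Suc n"
proof (rule antisym)
  show "lg (2 ^ n) \<le> Suc n"
    by (simp add: lg_le_iff)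
  show "Suc n \<le> lg (2 ^ n)"
    using lg_le_iff[of "2 ^ n" n] by simp
qed

lemmas pspace_intros = pspace_fun_var pspace_fun_const pspace_fun_Suc pspace_fun_add pspace_fun_diff
  pspace_fun_mult pspace_fun_div pspace_fun_mod pspace_fun_div_power pspace_fun_digit pspace_fun_lg
  pspace_fun_If pspace_fun_search pspace_pred_le pspace_pred_less pspace_pred_eq pspace_pred_not
  pspace_pred_conj pspace_pred_disj pspace_pred_imp pspace_pred_iff pspace_pred_bex pspace_pred_ball


section \<open>Reachability by Savitch's game\<close>

text \<open>A node at level \<open>i\<close> is the common quotient by \<open>K ^ i\<close> of the
  numbers of the leaves below it. A leaf number thus stores its path in its base \<open>K\<close>
  digits.\<close>

fun game :: "nat \<Rightarrow> (nat \<Rightarrow> bool) \<Rightarrow> nat \<Rightarrow> nat \<Rightarrow> bool" where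
  "game K leaf 0 x = leaf x"
| "game K leaf (Suc i) x =
    (if even i then \<forall>y<K. game K leaf i (x * K + y) else \<exists>y<K. game K leaf i (x * K + y))"

text \<open>The value of the leaf, passed up to level \<open>i\<close>, is neutral for the parent
  (true below a universal node, false below an existential one), and a sibling to the right is left
  that may still decide it.\<close>

definition open_level :: "nat \<Rightarrow> (nat \<Rightarrow> bool) \<Rightarrow> nat \<Rightarrow> nat \<Rightarrow> bool" where
  "open_level K leaf t i \<longleftrightarrow> (leaf t \<longleftrightarrow> even i) \<and> digit K t i < K - 1"

text \<open>From \<open>K ^ n\<close> on a number is no leaf but a verdict, \<open>K ^ n\<close> for
  false and \<open>K ^ n + 1\<close> for true, and it is a fixed point. Otherwise the digit at the
  lowest open level is increased and the lower ones are reset, which skips siblings that no longer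
  matter.\<close>

definition next_leaf :: "nat \<Rightarrow> nat \<Rightarrow> (nat \<Rightarrow> bool) \<Rightarrow> nat \<Rightarrow> nat" where
  "next_leaf K n leaf t =
    (if t \<ge> K ^ n then t
     else if search (open_level K leaf t) n = n then K ^ n + of_bool (leaf t)
     else (t div K ^ search (open_level K leaf t) n + 1) * K ^ search (open_level K leaf t) n)"

text \<open>All siblings to the left of the path to \<open>t\<close> failed to decide their parent.\<close>

definition scanned :: "nat \<Rightarrow> nat \<Rightarrow> (nat \<Rightarrow> bool) \<Rightarrow> nat \<Rightarrow> bool" where
  "scanned K n leaf t \<longleftrightarrow> t < K ^ n \<and>
     (\<forall>i<n. \<forall>y<digit K t i. game K leaf i (t div K ^ Suc i * K + y) = even i)"

lemma div_power_digit: "t div K ^ i = t div K ^ Suc i * K + digit K t i"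
proof -
  have "t div K ^ Suc i = t div K ^ i div K"
    by (simp add: div_mult2_eq power_Suc2 del: power_Suc)
  then show ?thesis
    by (simp add: digit_def)
qed

text \<open>Up to the lowest open level every node on the path takes the value of the leaf: a
  decisive child settles its parent at once, and a neutral one is the last of its siblings, the
  others being neutral by \<open>scanned\<close>.\<close>

lemma scanned_value:
  assumes "scanned K n leaf t" "K \<ge> 2"
  shows "m \<le> n \<Longrightarrow> (\<And>i. i < m \<Longrightarrow> \<not> open_level K leaf t i) \<Longrightarrow>
    game K leaf m (t div K ^ m) = leaf t"
proof (induction m)
  case (Suc m)
  let ?x = "t div K ^ Suc m"
  have IH: "game K leaf m (?x * K + digit K t m) = leaf t"
    using Suc by (simp add: div_power_digit[of t K m] del: power_Suc)
  have left: "\<forall>y<digit K t m. game K leaf m (?x * K + y) = even m"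
    using assms(1) Suc.prems(1) by (simp add: scanned_def Suc_le_eq)
  have d: "digit K t m < K"
    using assms(2) by (simp add: digit_def)
  show ?case
  proof (cases "leaf t \<longleftrightarrow> even m")
    case True
    then have "digit K t m = K - 1"
      using Suc.prems(2)[of m] d by (simp add: open_level_def)
    then have "game K leaf m (?x * K + y) = even m" if "y < K" for y
      using left IH True that by (cases "y = digit K t m") auto
    then show ?thesis
      using True assms(2) by (auto intro: exI[of _ 0])
  next
    case False
    then show ?thesis
      using IH d by (auto simp del: power_Suc)
  qed
qed simp

text \<open>Digits above level \<open>i\<close> stay and those below become 0, so the only new
  sibling to the left of the path is the old node at level \<open>i\<close>, whose value is known
  from \<open>scanned_value\<close>.\<close>

lemma scanned_next:
  assumes t: "scanned K n leaf t" and K: "K \<ge> 2"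
    and i: "search (open_level K leaf t) n < n"
  shows "scanned K n leaf (next_leaf K n leaf t)" "t < next_leaf K n leaf t"
proof -
  define i where "i = search (open_level K leaf t) n"
  define t' where "t' = (t div K ^ i + 1) * K ^ i"
  have t': "next_leaf K n leaf t = t'"
    using t i by (simp add: next_leaf_def scanned_def i_def t'_def)
  have i: "i < n" "open_level K leaf t i" "\<And>j. j < i \<Longrightarrow> \<not> open_level K leaf t j"
    using i search_cases[of "open_level K leaf t" n] unfolding i_def by (metis less_irrefl)+
  have Kp: "K ^ j > 0" for j
    using K by simp
  have val: "game K leaf i (t div K ^ i) = even i"
    using scanned_value[OF t K, of i] i by (auto simp: open_level_def)
  have di: "digit K t i < K - 1"
    using i(2) by (simp add: open_level_def)
  have quot: "(a * K + r) div K = a" if "r < K" for a r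
    using that by simp
  have t'i: "t' div K ^ i = t div K ^ i + 1"
    using Kp[of i] by (simp add: t'_def)
  have above: "t' div K ^ Suc j = t div K ^ Suc j" if "j \<ge> i" for j
  proof -
    have "t' div K ^ Suc i = (t div K ^ i + 1) div K"
      using t'i by (metis div_mult2_eq power_Suc2)
    also have "\<dots> = (t div K ^ Suc i * K + (digit K t i + 1)) div K"
      using div_power_digit[of t K i] by (simp del: power_Suc)
    also have "\<dots> = t div K ^ Suc i"
      by (rule quot) (use di in simp)
    finally have "t' div K ^ Suc i = t div K ^ Suc i" .
    then show ?thesis
      using that by (metis Suc_le_mono div_mult2_eq le_Suc_ex power_add)
  qed
  have digits: "digit K t' j = (if j < i then 0 else if j = i then digit K t i + 1 else digit K t j)" for j
  proof -
    consider "j < i" | "j = i" | "j > i" by linarith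
    then show ?thesis
    proof cases
      case 1
      then have "t' = (t div K ^ i + 1) * K ^ (i - Suc j) * K * K ^ j"
        unfolding t'_def by (metis (no_types) Suc_leI le_add_diff_inverse2 mult.assoc power_add power_Suc)
      then show ?thesis
        using 1 Kp[of j] by (simp add: digit_def)
    next
      case 2
      have "t' div K ^ i = t div K ^ Suc i * K + (digit K t i + 1)"
        using t'i div_power_digit[of t K i] by (simp del: power_Suc)
      then show ?thesis
        using 2 di by (simp add: digit_def[of K t'] del: power_Suc)
    next
      case 3
      then have "t' div K ^ j = t div K ^ j"
        using above[of "j - 1"] by (cases j) auto
      then show ?thesis
        using 3 by (simp add: digit_def)
    qed
  qed
  have "t' div K ^ n = t div K ^ n"
    using above[of "n - 1"] i(1) by (cases n) auto
  then have "t' < K ^ n"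
    using t K by (auto simp: scanned_def div_eq_0_iff)
  moreover have "game K leaf j (t' div K ^ Suc j * K + y) = even j"
    if jn: "j < n" and yd: "y < digit K t' j" for j y
  proof -
    consider "j = i" "y = digit K t i" | "j \<ge> i" "y < digit K t j"
      using yd by (auto simp: digits less_Suc_eq split: if_splits)
    then show ?thesis
    proof cases
      case 1
      then show ?thesis
        using val above[of i] div_power_digit[of t K i] by simp
    next
      case 2
      then show ?thesis
        using t jn above[of j] by (simp add: scanned_def del: power_Suc)
    qed
  qed
  ultimately show "scanned K n leaf (next_leaf K n leaf t)"
    by (simp add: scanned_def t')
  have "t < t'"
    unfolding t'_def using Kp[of i] by (metis Suc_eq_plus1 dividend_less_div_times mult.commute mult_Suc)
  then show "t < next_leaf K n leaf t"
    by (simp add: t')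
qed

text \<open>Until the verdict is reached the leaf number grows with every pass, and leaves lie below
  \<open>K ^ n\<close>; hence \<open>K ^ n\<close> passes suffice.\<close>

lemma next_leaf_result:
  assumes K: "K \<ge> 2"
  shows "(next_leaf K n leaf ^^ (K ^ n)) 0 = K ^ n + of_bool (game K leaf n 0)"
proof -
  let ?f = "next_leaf K n leaf"
  have "(?f ^^ k) 0 = K ^ n + of_bool (game K leaf n 0) \<or> scanned K n leaf ((?f ^^ k) 0) \<and> k \<le> (?f ^^ k) 0" for k
  proof (induction k)
    case 0
    have "digit K 0 i = 0" for i
      by (simp add: digit_def)
    then show ?case
      using K by (simp add: scanned_def)
  next
    case (Suc k)
    define t where "t = (?f ^^ k) 0"
    show ?case
    proof (cases "t = K ^ n + of_bool (game K leaf n 0)")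
      case True
      then have "?f t = t"
        by (simp add: next_leaf_def)
      then show ?thesis
        using True by (simp add: t_def)
    next
      case False
      then have t: "scanned K n leaf t" "k \<le> t"
        using Suc by (auto simp: t_def)
      show ?thesis
      proof (cases "search (open_level K leaf t) n < n")
        case True
        then show ?thesis
          using scanned_next[OF t(1) K True] t(2) by (simp add: t_def)
      next
        case False
        then have eq: "search (open_level K leaf t) n = n"
          using search_le[of "open_level K leaf t" n] by simp
        then have "\<And>i. i < n \<Longrightarrow> \<not> open_level K leaf t i"
          using search_cases[of "open_level K leaf t" n] by (metis less_irrefl)
        then have "game K leaf n (t div K ^ n) = leaf t"
          using scanned_value[OF t(1) K, of n] by blast
        moreover have "t < K ^ n"
          using t(1) by (simp add: scanned_def)
        moreover from this have "?f t = K ^ n + of_bool (leaf t)"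
          using eq by (simp add: next_leaf_def)
        ultimately have "?f t = K ^ n + of_bool (game K leaf n 0)"
          by simp
        then show ?thesis
          by (simp add: t_def)
      qed
    qed
  qed
  from this[of "K ^ n"] show ?thesis
    by (auto simp: scanned_def)
qed

lemma next_leaf_le: "t \<le> K ^ n + 1 \<Longrightarrow> K \<ge> 2 \<Longrightarrow> next_leaf K n leaf t \<le> K ^ n + 1"
proof -
  assume t: "t \<le> K ^ n + 1" and K: "K \<ge> 2"
  show ?thesis
  proof (cases "t < K ^ n \<and> search (open_level K leaf t) n < n")
    case True
    let ?i = "search (open_level K leaf t) n"
    have "t div K ^ ?i < K ^ (n - ?i)"
      using True K by (simp add: div_less_iff_less_mult flip: power_add)
    then have "(t div K ^ ?i + 1) * K ^ ?i \<le> K ^ (n - ?i) * K ^ ?i"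
      by (intro mult_le_mono1) simp
    also have "\<dots> = K ^ n"
      using True by (simp flip: power_add)
    finally show ?thesis
      using True by (simp add: next_leaf_def)
  next
    case False
    then show ?thesis
      using t search_le[of "open_level K leaf t" n] by (auto simp: next_leaf_def)
  qed
qed


text \<open>
  Savitch's game: an odd level of the tree proposes a midpoint, the even level below it chooses
  the half of the path to be inspected.
\<close>

fun paths :: "nat \<Rightarrow> (nat \<Rightarrow> nat \<Rightarrow> bool) \<Rightarrow> nat \<Rightarrow> nat \<Rightarrow> nat \<Rightarrow> bool" where
  "paths K R 0 u v \<longleftrightarrow> u = v \<or> R u v"
| "paths K R (Suc j) u v \<longleftrightarrow> (\<exists>m<K. paths K R j u m \<and> paths K R j m v)"

text \<open>Digit \<open>2 * j + 1\<close> is a midpoint and digit \<open>2 * j\<close> selects a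
  half: 0 stands for the first one and every other digit for the second, since all levels share the
  branching factor \<open>K\<close>. Counting \<open>j\<close> down follows the path from the
  root.\<close>

definition left_end :: "nat \<Rightarrow> nat \<Rightarrow> nat \<Rightarrow> nat \<Rightarrow> nat" where
  "left_end K u h x = down (\<lambda>j a. if digit K x (2 * j) = 0 then a else digit K x (2 * j + 1)) h u"

definition right_end :: "nat \<Rightarrow> nat \<Rightarrow> nat \<Rightarrow> nat \<Rightarrow> nat" where
  "right_end K v h x = down (\<lambda>j a. if digit K x (2 * j) = 0 then digit K x (2 * j + 1) else a) h v"

text \<open>The defining equation exposes the step applied first, this one the step applied last. In
  \<open>ends_Suc\<close> the latter is the decision nearest to the leaf.\<close>

lemma down_Suc: "down f (Suc n) x = f 0 (down (\<lambda>i. f (Suc i)) n x)"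
  by (induction n arbitrary: x) auto

lemma digit_0: "m < K \<Longrightarrow> digit K (x * K + m) 0 = m"
  by (simp add: digit_def)

lemma digit_Suc: "m < K \<Longrightarrow> digit K (x * K + m) (Suc i) = digit K x i"
proof -
  assume "m < K"
  then have "(x * K + m) div K ^ Suc i = x div K ^ i"
    by (simp add: div_mult2_eq)
  then show ?thesis
    by (simp add: digit_def)
qed

lemma ends_Suc:
  assumes "m < K" "c < K"
  shows "left_end K u (Suc h) ((x * K + m) * K + c) = (if c = 0 then left_end K u h x else m)"
    "right_end K v (Suc h) ((x * K + m) * K + c) = (if c = 0 then m else right_end K v h x)"
proof -
  define X where "X = (x * K + m) * K + c"
  have shift: "digit K X (Suc (Suc i)) = digit K x i" for i
    unfolding X_def using assms by (simp only: digit_Suc)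
  have low: "digit K X 0 = c" "digit K X (Suc 0) = m"
    unfolding X_def using assms by (simp_all only: digit_0 digit_Suc)
  show "left_end K u (Suc h) ((x * K + m) * K + c) = (if c = 0 then left_end K u h x else m)"
    unfolding left_end_def down_Suc X_def[symmetric] by (simp add: shift low cong: if_cong)
  show "right_end K v (Suc h) ((x * K + m) * K + c) = (if c = 0 then m else right_end K v h x)"
    unfolding right_end_def down_Suc X_def[symmetric] by (simp add: shift low cong: if_cong)
qed

definition path_leaf :: "nat \<Rightarrow> nat \<Rightarrow> (nat \<Rightarrow> nat \<Rightarrow> bool) \<Rightarrow> nat \<Rightarrow> nat \<Rightarrow> nat \<Rightarrow> bool" where
  "path_leaf K D R u v t \<longleftrightarrow>
     left_end K u D t = right_end K v D t \<or> R (left_end K u D t) (right_end K v D t)"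

text \<open>Two levels of the tree make up one halving. By \<open>K \<ge> 2\<close> both the digit 0
  and a nonzero digit occur, so the universal level inspects both halves.\<close>

lemma game_paths:
  assumes K: "K \<ge> 2"
  shows "j \<le> D \<Longrightarrow> game K (path_leaf K D R u v) (2 * j) x \<longleftrightarrow>
    paths K R j (left_end K u (D - j) x) (right_end K v (D - j) x)"
proof (induction j arbitrary: x)
  case 0
  then show ?case
    by (simp add: path_leaf_def)
next
  case (Suc j)
  then have D: "D - j = Suc (D - Suc j)"
    by simp
  let ?l = "left_end K u (D - Suc j) x" and ?r = "right_end K v (D - Suc j) x"
  define B where "B m c = paths K R j (if c = 0 then ?l else m) (if c = 0 then m else ?r)" for m c :: nat
  have step: "game K (path_leaf K D R u v) (2 * j) ((x * K + m) * K + c) \<longleftrightarrow> B m c"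
    if "m < K" "c < K" for m c
    using Suc.IH[of "(x * K + m) * K + c"] Suc.prems
    unfolding D ends_Suc[OF that] B_def by simp
  have "game K (path_leaf K D R u v) (2 * Suc j) x \<longleftrightarrow>
      (\<exists>m<K. \<forall>c<K. game K (path_leaf K D R u v) (2 * j) ((x * K + m) * K + c))"
    by simp
  also have "\<dots> \<longleftrightarrow> (\<exists>m<K. \<forall>c<K. B m c)"
    by (rule ex_cong1, rule conj_cong[OF refl], rule all_cong1, rule imp_cong[OF refl], rule step)
  also have "\<dots> \<longleftrightarrow> (\<exists>m<K. paths K R j ?l m \<and> paths K R j m ?r)"
  proof -
    have "(\<forall>c<K. B m c) \<longleftrightarrow> paths K R j ?l m \<and> paths K R j m ?r" for m
    proof
      assume "\<forall>c<K. B m c"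
      then have "B m 0" "B m 1"
        using K by simp_all
      then show "paths K R j ?l m \<and> paths K R j m ?r"
        by (simp add: B_def)
    qed (simp add: B_def)
    then show ?thesis
      by simp
  qed
  finally show ?case
    by simp
qed

text \<open>Because leaves accept equality besides an edge, depth \<open>j\<close> covers all
  lengths up to \<open>2 ^ j\<close>; a longer walk is split after \<open>min n (2 ^ j)\<close>
  edges.\<close>

lemma paths_relpow:
  assumes S: "\<And>x y. (x, y) \<in> S \<longleftrightarrow> x < K \<and> y < K \<and> R x y" and "u < K" "v < K"
  shows "paths K R j u v \<longleftrightarrow> (\<exists>n\<le>2 ^ j. (u, v) \<in> S ^^ n)"
  using assms(2,3)
proof (induction j arbitrary: u v)
  case 0
  have "(\<exists>n\<le>1. (u, v) \<in> S ^^ n) \<longleftrightarrow> (u, v) \<in> S ^^ 0 \<or> (u, v) \<in> S ^^ 1"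
    by (auto simp: le_Suc_eq)
  then show ?case
    using 0 by (simp add: S)
next
  case (Suc j)
  show ?case
  proof
    assume "paths K R (Suc j) u v"
    then obtain m where "m < K" "paths K R j u m" "paths K R j m v"
      by auto
    then obtain k l where kl: "k \<le> 2 ^ j" "(u, m) \<in> S ^^ k" "l \<le> 2 ^ j" "(m, v) \<in> S ^^ l"
      using Suc.IH[of u m] Suc.IH[of m v] Suc.prems by auto
    have "(u, v) \<in> S ^^ (k + l)"
      unfolding relpow_add using kl(2,4) by (rule relcompI)
    moreover have "k + l \<le> 2 ^ Suc j"
      using kl by simp
    ultimately show "\<exists>n\<le>2 ^ Suc j. (u, v) \<in> S ^^ n"
      by blast
  next
    assume "\<exists>n\<le>2 ^ Suc j. (u, v) \<in> S ^^ n"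
    then obtain n where n: "n \<le> 2 ^ Suc j" "(u, v) \<in> S ^^ n"
      by blast
    define k where "k = min n (2 ^ j)"
    have kn: "k \<le> 2 ^ j" "n - k \<le> 2 ^ j" "n = k + (n - k)"
      using n(1) by (auto simp: k_def)
    have "(u, v) \<in> S ^^ k O S ^^ (n - k)"
      unfolding relpow_add[symmetric] using n(2) kn(3) by simp
    then obtain m where m: "(u, m) \<in> S ^^ k" "(m, v) \<in> S ^^ (n - k)"
      by (rule relcompEpair)
    have "m < K"
      using m(1) Suc.prems by (cases k) (auto simp: S)
    moreover have "paths K R j u m" "paths K R j m v"
      using Suc.IH[of u m] Suc.IH[of m v] Suc.prems \<open>m < K\<close> m kn by blast+
    ultimately show "paths K R (Suc j) u v"
      by auto
  qed
qed

text \<open>A reachable vertex is reached within as many steps as there are edges. These are at most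
  \<open>K * K\<close>, which is below \<open>2 ^ (2 * lg K)\<close>.\<close>

definition reachable :: "nat \<Rightarrow> (nat \<Rightarrow> nat \<Rightarrow> bool) \<Rightarrow> nat \<Rightarrow> nat \<Rightarrow> bool" where
  "reachable K R u v \<longleftrightarrow> paths K R (2 * lg K) u v"

lemma reachable_iff:
  assumes "u < K" "v < K"
  shows "reachable K R u v \<longleftrightarrow> (u, v) \<in> {(x, y). x < K \<and> y < K \<and> R x y}\<^sup>*"
proof -
  define S where "S = {(x, y). x < K \<and> y < K \<and> R x y}"
  have S: "(x, y) \<in> S \<longleftrightarrow> x < K \<and> y < K \<and> R x y" for x y
    by (simp add: S_def)
  have sub: "S \<subseteq> {..<K} \<times> {..<K}"
    by (auto simp: S_def)
  then have fin: "finite S"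
    by (rule finite_subset) simp
  have "card S \<le> K * K"
    using card_mono[OF _ sub] by (simp add: card_cartesian_product)
  also have "\<dots> \<le> 2 ^ lg K * 2 ^ lg K"
    using less_two_power_lg[of K] by (intro mult_le_mono) auto
  also have "\<dots> = 2 ^ (2 * lg K)"
    by (simp add: mult_2 power_add)
  finally have le: "card S \<le> 2 ^ (2 * lg K)" .
  have "reachable K R u v \<longleftrightarrow> (\<exists>n\<le>2 ^ (2 * lg K). (u, v) \<in> S ^^ n)"
    unfolding reachable_def by (rule paths_relpow[OF S assms])
  also have "\<dots> \<longleftrightarrow> (u, v) \<in> S\<^sup>*"
  proof
    assume "(u, v) \<in> S\<^sup>*"
    then obtain n where "n \<le> card S" "(u, v) \<in> S ^^ n"
      using rtrancl_finite_eq_relpow[OF fin] by auto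
    then show "\<exists>n\<le>2 ^ (2 * lg K). (u, v) \<in> S ^^ n"
      using le by (intro exI[of _ n]) simp
  qed (auto intro: relpow_imp_rtrancl)
  finally show ?thesis
    by (simp add: S_def)
qed

text \<open>Recursion depth \<open>2 * lg K\<close> means \<open>4 * lg K\<close> levels of the
  game. Of the two verdicts only true exceeds \<open>K ^ (4 * lg K)\<close>.\<close>

lemma reachable_eq_next_leaf:
  assumes "K \<ge> 2"
  shows "reachable K R u v \<longleftrightarrow>
    down (\<lambda>i. next_leaf K (4 * lg K) (path_leaf K (2 * lg K) R u v)) (K ^ (4 * lg K)) 0 > K ^ (4 * lg K)"
proof -
  have "reachable K R u v \<longleftrightarrow> game K (path_leaf K (2 * lg K) R u v) (4 * lg K) 0"
    using game_paths[OF assms, of "2 * lg K" "2 * lg K" R u v 0]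
    by (simp add: reachable_def left_end_def right_end_def)
  then show ?thesis
    using next_leaf_result[OF assms, of "4 * lg K" "path_leaf K (2 * lg K) R u v"]
    by (simp add: down_funpow)
qed

text \<open>The fourth power of \<open>2 ^ lg (K e)\<close> has \<open>4 * lg (K e) + 1\<close>
  bits; it is the computable number whose length bounds the exponent in
  \<open>pspace_fun_power\<close>.\<close>

lemma pspace_fun_power_lg:
  assumes f: "pspace_fun f" and i: "pspace_fun i" and K: "pspace_fun K" and le: "\<And>e. i e \<le> 4 * lg (K e)"
  shows "pspace_fun (\<lambda>e. f e ^ i e)"
proof (rule pspace_fun_power[OF f i])
  let ?p = "\<lambda>e. 2 ^ lg (K e)"
  have p: "pspace_fun ?p"
    by (rule pspace_fun_power[OF pspace_fun_const pspace_fun_lg[OF K] K]) simp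
  show "pspace_fun (\<lambda>e. (?p e * ?p e) * (?p e * ?p e))"
    by (intro pspace_fun_mult p)
  show "i e \<le> lg ((?p e * ?p e) * (?p e * ?p e))" for e
    using le[of e] by (simp add: lg_two_power flip: power_add)
qed

text \<open>Composition comes from a bounded quantifier: the value of \<open>f e\<close> is found by
  testing all candidates up to it.\<close>

lemma pspace_pred_subst:
  assumes f: "pspace_fun f" and P: "pspace_pred (\<lambda>e. P (e 0) (\<lambda>j. e (Suc j)))"
  shows "pspace_pred (\<lambda>e. P (f e) e)"
proof -
  have "pspace_pred (\<lambda>e. \<exists>y<Suc (f e). y = f e \<and> P y e)"
    by (intro pspace_pred_bex pspace_fun_Suc pspace_pred_conj pspace_pred_eq pspace_fun_var
        pspace_fun_rename[OF f] f P)
  moreover have "(\<exists>y<Suc x. y = x \<and> Q y) \<longleftrightarrow> Q x" for x :: nat and Q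
    by auto
  ultimately show ?thesis
    by simp
qed

lemma pspace_pred_subst2:
  assumes f: "pspace_fun f" and g: "pspace_fun g"
    and P: "pspace_pred (\<lambda>e. P (e 0) (e (Suc 0)) (\<lambda>j. e (Suc (Suc j))))"
  shows "pspace_pred (\<lambda>e. P (f e) (g e) e)"
proof (rule pspace_pred_subst[OF f, where P = "\<lambda>x e. P x (g e) e"])
  show "pspace_pred (\<lambda>e. P (e 0) (g (\<lambda>j. e (Suc j))) (\<lambda>j. e (Suc j)))"
  proof (rule pspace_pred_subst[where f = "\<lambda>e. g (\<lambda>j. e (Suc j))" and P = "\<lambda>y e. P (e 0) y (\<lambda>j. e (Suc j))"])
    show "pspace_pred (\<lambda>e. P (e (Suc 0)) (e 0) (\<lambda>j. e (Suc (Suc j))))"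
      using pspace_pred_rename[OF P, of "case_nat 1 (case_nat 0 (\<lambda>j. Suc (Suc j)))"] by simp
  qed (rule pspace_fun_rename[OF g])
qed

lemma digit_le: "digit b x i \<le> x"
  unfolding digit_def by (meson div_le_dividend le_trans mod_less_eq_dividend)

lemma pspace_pred_path_leaf:
  assumes K: "pspace_fun K" and D: "pspace_fun D" and u: "pspace_fun u" and v: "pspace_fun v"
    and t: "pspace_fun t" and R: "pspace_pred (\<lambda>e. R (e 0) (e (Suc 0)) (\<lambda>j. e (Suc (Suc j))))"
  shows "pspace_pred (\<lambda>e. path_leaf (K e) (D e) (\<lambda>x y. R x y e) (u e) (v e) (t e))"
proof -
  note ren = pspace_fun_rename[OF K] pspace_fun_rename[OF t]
  have digits: "pspace_fun (\<lambda>e. digit (K (\<lambda>j. e (Suc (Suc j)))) (t (\<lambda>j. e (Suc (Suc j)))) (2 * e 0))"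
    "pspace_fun (\<lambda>e. digit (K (\<lambda>j. e (Suc (Suc j)))) (t (\<lambda>j. e (Suc (Suc j)))) (2 * e 0 + 1))"
    by (intro pspace_intros ren)+
  have l: "pspace_fun (\<lambda>e. left_end (K e) (u e) (D e) (t e))"
    unfolding left_end_def
  \<comment> \<open>The end is always \<open>u e\<close> or some digit of \<open>t e\<close>, hence
    at most their sum.\<close>
  proof (rule pspace_fun_down[where I = "\<lambda>e i x. x \<le> u e + t e" and b = "\<lambda>e. u e + t e"])
    show "pspace_fun (\<lambda>e. if digit (K (\<lambda>j. e (Suc (Suc j)))) (t (\<lambda>j. e (Suc (Suc j)))) (2 * e 0) = 0
        then e (Suc 0) else digit (K (\<lambda>j. e (Suc (Suc j)))) (t (\<lambda>j. e (Suc (Suc j)))) (2 * e 0 + 1))"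
      by (intro pspace_fun_if_0 pspace_fun_var digits)
  qed (auto intro: D u size_bounded_add pspace_fun_size_bounded t trans_le_add2 digit_le)
  have r: "pspace_fun (\<lambda>e. right_end (K e) (v e) (D e) (t e))"
    unfolding right_end_def
  proof (rule pspace_fun_down[where I = "\<lambda>e i x. x \<le> v e + t e" and b = "\<lambda>e. v e + t e"])
    show "pspace_fun (\<lambda>e. if digit (K (\<lambda>j. e (Suc (Suc j)))) (t (\<lambda>j. e (Suc (Suc j)))) (2 * e 0) = 0
        then digit (K (\<lambda>j. e (Suc (Suc j)))) (t (\<lambda>j. e (Suc (Suc j)))) (2 * e 0 + 1) else e (Suc 0))"
      by (intro pspace_fun_if_0 pspace_fun_var digits)
  qed (auto intro: D v size_bounded_add pspace_fun_size_bounded t trans_le_add2 digit_le)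
  show ?thesis
    unfolding path_leaf_def by (intro pspace_pred_disj pspace_pred_eq l r pspace_pred_subst2[OF l r R])
qed

lemma pspace_fun_next_leaf:
  assumes K: "pspace_fun K" and n: "pspace_fun n" and t: "pspace_fun t"
    and leaf: "pspace_pred (\<lambda>e. leaf (e 0) (\<lambda>j. e (Suc j)))" and le: "\<And>e. n e \<le> 4 * lg (K e)"
  shows "pspace_fun (\<lambda>e. next_leaf (K e) (n e) (\<lambda>x. leaf x e) (t e))"
proof -
  note ren = pspace_fun_rename[OF K] pspace_fun_rename[OF t]
  have leaf_t: "pspace_pred (\<lambda>e. leaf (t e) e)"
    by (rule pspace_pred_subst[OF t leaf])
  have s: "pspace_fun (\<lambda>e. search (open_level (K e) (\<lambda>x. leaf x e) (t e)) (n e))"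
    unfolding open_level_def even_iff_mod_2_eq_zero
    by (intro pspace_intros n ren pspace_pred_rename[OF leaf_t])
  have M: "pspace_fun (\<lambda>e. K e ^ n e)"
    by (rule pspace_fun_power_lg[OF K n K le])
  have Ks: "pspace_fun (\<lambda>e. K e ^ search (open_level (K e) (\<lambda>x. leaf x e) (t e)) (n e))"
    by (rule pspace_fun_power_lg[OF K s K]) (meson le le_trans search_le)
  show ?thesis
    unfolding next_leaf_def
    by (intro pspace_intros M Ks s t n leaf_t[unfolded pspace_pred_def])
qed

lemma pspace_pred_reachable:
  assumes K: "pspace_fun K" and u: "pspace_fun u" and v: "pspace_fun v"
    and R: "pspace_pred (\<lambda>e. R (e 0) (e (Suc 0)) (\<lambda>j. e (Suc (Suc j))))" and K2: "\<And>e. K e \<ge> 2"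
  shows "pspace_pred (\<lambda>e. reachable (K e) (\<lambda>x y. R x y e) (u e) (v e))"
proof -
  define leaf where "leaf t e = path_leaf (K e) (2 * lg (K e)) (\<lambda>x y. R x y e) (u e) (v e) t" for t e
  have leaf: "pspace_pred (\<lambda>e. leaf (e 0) (\<lambda>j. e (Suc j)))"
    unfolding leaf_def
  proof (rule pspace_pred_path_leaf)
    show "pspace_pred (\<lambda>e. R (e 0) (e (Suc 0)) (\<lambda>j. e (Suc (Suc (Suc j)))))"
      using pspace_pred_rename[OF R, of "case_nat 0 (case_nat 1 (\<lambda>j. Suc (Suc (Suc j))))"] by simp
  qed (intro pspace_intros pspace_fun_rename[OF K] pspace_fun_rename[OF u] pspace_fun_rename[OF v])+
  have n: "pspace_fun (\<lambda>e. 4 * lg (K e))"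
    by (intro pspace_intros K)
  have M: "pspace_fun (\<lambda>e. K e ^ (4 * lg (K e)))"
    by (rule pspace_fun_power_lg[OF K n K]) simp
  have "pspace_fun (\<lambda>e. down (\<lambda>i x. next_leaf (K e) (4 * lg (K e)) (\<lambda>x. leaf x e) x) (K e ^ (4 * lg (K e))) 0)"
  proof (rule pspace_fun_down[where I = "\<lambda>e i x. x \<le> K e ^ (4 * lg (K e)) + 1"
        and b = "\<lambda>e. K e ^ (4 * lg (K e)) + 1"])
    show "pspace_fun (\<lambda>e. next_leaf (K (\<lambda>j. e (Suc (Suc j)))) (4 * lg (K (\<lambda>j. e (Suc (Suc j)))))
        (\<lambda>x. leaf x (\<lambda>j. e (Suc (Suc j)))) (e (Suc 0)))"
    proof (rule pspace_fun_next_leaf)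
      show "pspace_pred (\<lambda>e. leaf (e 0) (\<lambda>j. e (Suc (Suc (Suc j)))))"
        using pspace_pred_rename[OF leaf, of "case_nat 0 (\<lambda>j. Suc (Suc (Suc j)))"] by simp
      show "pspace_fun (\<lambda>e. 4 * lg (K (\<lambda>j. e (Suc (Suc j)))))"
        by (intro pspace_intros pspace_fun_rename[OF K])
    qed (simp_all add: pspace_fun_rename[OF K] pspace_fun_var)
    show "size_bounded (\<lambda>e. K e ^ (4 * lg (K e)) + 1)"
      by (intro size_bounded_add size_bounded_const pspace_fun_size_bounded M)
    show "next_leaf (K e) (4 * lg (K e)) (\<lambda>x. leaf x e) x \<le> K e ^ (4 * lg (K e)) + 1"
      if "x \<le> K e ^ (4 * lg (K e)) + 1" for e x
      by (rule next_leaf_le[OF that K2])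
  qed (simp_all add: M pspace_fun_const)
  then show ?thesis
    unfolding reachable_eq_next_leaf[OF K2] leaf_def by (intro pspace_pred_less M)
qed


section \<open>Pairs of automata as numbers\<close>

lemma code_Nil [simp]: "code [] = 0"
  by (simp add: code_def)

lemma code_Cons: "code (a # w) = (case a of Zero \<Rightarrow> 1 | One \<Rightarrow> 2 | Sep \<Rightarrow> 3) + 4 * code w"
  by (cases a) (simp_all add: code_def)

lemma code_inject: "code u = code v \<Longrightarrow> u = v"
proof (induction u arbitrary: v)
  case Nil
  then show ?case
    by (cases v) (auto simp: code_Cons split: letter.splits)
next
  case (Cons a u)
  then obtain b v' where v: "v = b # v'"
    by (cases v) (auto simp: code_Cons split: letter.splits)
  have "code (a # u) mod 4 = code (b # v') mod 4" "code (a # u) div 4 = code (b # v') div 4"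
    using Cons.prems by (simp_all add: v)
  then have "a = b" "code u = code v'"
    by (auto simp: code_Cons split: letter.splits)
  then show ?case
    using Cons.IH by (simp add: v)
qed

lemma two_power_length_code: "2 ^ length w \<le> code w + 1"
  by (induction w) (auto simp: code_Cons split: letter.splits)

text \<open>No base 4 digit of a code is 0, so a word cannot be longer than the binary notation of
  its code.\<close>

lemma length_le_lg_code: "length w \<le> lg (code w)"
proof -
  have "(2::nat) ^ length w \<le> 2 ^ lg (code w)"
    using two_power_length_code[of w] less_two_power_lg[of "code w"] by linarith
  then show ?thesis
    by simp
qed

text \<open>If \<open>y\<close> codes \<open>w\<close>, this codes
  \<open>binary n @ Sep # w\<close>: the separator is the base 4 digit 3 and a bit \<open>c\<close>
  the digit \<open>1 + c\<close>. Counting down puts the lowest bit in front.\<close>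

definition prepend :: "nat \<Rightarrow> nat \<Rightarrow> nat" where
  "prepend n y = down (\<lambda>i a. 1 + n div 2 ^ i mod 2 + 4 * a) (lg n) (3 + 4 * y)"

lemma lg_rec: "n > 0 \<Longrightarrow> lg n = Suc (lg (n div 2))"
proof (rule antisym)
  show "lg n \<le> Suc (lg (n div 2))"
    using less_two_power_lg[of "n div 2"] by (simp add: lg_le_iff)
  assume "n > 0"
  then obtain k where k: "lg n = Suc k"
    using not0_implies_Suc[of "lg n"] by auto
  then have "n < 2 * 2 ^ k"
    using less_two_power_lg[of n] by simp
  then have "lg (n div 2) \<le> k"
    by (simp add: lg_le_iff)
  then show "Suc (lg (n div 2)) \<le> lg n"
    by (simp add: k)
qed

lemma code_binary: "code (binary n @ Sep # w) = prepend n (code w)"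
proof (induction n rule: less_induct)
  case (less n)
  show ?case
  proof (cases "n = 0")
    case True
    then show ?thesis
      by (simp add: binary.simps[of 0] prepend_def code_Cons)
  next
    case False
    then have "code (binary n @ Sep # w) = 1 + n mod 2 + 4 * prepend (n div 2) (code w)"
      using less.IH[of "n div 2"]
      by (subst binary.simps) (auto simp: code_Cons odd_iff_mod_2_eq_one)
    also have "\<dots> = prepend n (code w)"
      using False by (simp add: prepend_def lg_rec down_Suc div_mult2_eq del: down.simps)
    finally show ?thesis .
  qed
qed

lemma code_encode_nats: "code (encode_nats ns) = foldr prepend ns 0"
  by (induction ns) (simp_all add: encode_nats_def code_binary)

lemma foldr_map_upt: "foldr f (map g [0..<L]) z = down (\<lambda>i. f (g i)) L z"
  by (induction L arbitrary: z) auto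

lemma concat_rows:
  "concat (map (\<lambda>q. map (\<lambda>a. f (q * k + a)) [0..<k]) [0..<n]) = map f [0..<n * k]"
proof (induction n)
  case (Suc n)
  have "map f [n * k..<n * k + k] = map (\<lambda>a. f (n * k + a)) [0..<k]"
    by (rule nth_equalityI) auto
  moreover have "[0..<Suc n * k] = [0..<n * k] @ [n * k..<n * k + k]"
    using upt_add_eq_append[of 0 "n * k" k] by (simp add: add.commute)
  ultimately show ?case
    using Suc by (simp del: mult_Suc)
qed simp

definition table_code :: "nat \<Rightarrow> nat \<Rightarrow> nat \<Rightarrow> nat" where
  "table_code b U L = down (\<lambda>i. prepend (digit b U i)) L 0"

lemma code_encode_instance:
  assumes n: "states A = {0..<n}" and k: "alphabet A = {0..<k}"
    and \<delta>: "\<And>q a. q < n \<Longrightarrow> a < k \<Longrightarrow> delta A q a = digit b U (q * k + a)"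
  shows "code (encode_instance l A) = prepend l (prepend n (prepend k (table_code b U (n * k))))"
proof -
  have "transition_table A = concat (map (\<lambda>q. map (\<lambda>a. digit b U (q * k + a)) [0..<k]) [0..<n])"
    unfolding transition_table_def by (intro arg_cong[where f = concat] map_cong) (auto simp: n k \<delta>)
  then have "transition_table A = map (digit b U) [0..<n * k]"
    by (simp only: concat_rows)
  then show ?thesis
    by (simp add: encode_instance_def code_encode_nats n k foldr_map_upt table_code_def)
qed

lemma length_encode_nats: "length ns \<le> length (encode_nats ns)"
  by (induction ns) (auto simp: encode_nats_def)

lemma length_transition_table: "length (transition_table A) = card (states A) * card (alphabet A)"
  by (simp add: transition_table_def length_concat comp_def sum_list_triv)

text \<open>Every number contributes its separator, even 0 with its empty notation, so the input is
  at least as long as the table has entries.\<close>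

lemma length_encode_instance:
  "card (states A) * card (alphabet A) + 3 \<le> length (encode_instance l A)"
  using length_encode_nats[of "l # card (states A) # card (alphabet A) # transition_table A"]
  by (simp add: encode_instance_def length_transition_table)

text \<open>The number \<open>l\<close> may be exponential in the input length; this puts it in the
  range of a quantifier bounded by the code.\<close>

lemma less_code_encode_instance: "l < code (encode_instance l A)"
proof -
  have "length (binary l) = lg l"
  proof (induction l rule: less_induct)
    case (less l)
    show ?case
    proof (cases "l = 0")
      case True
      then show ?thesis
        by (simp add: binary.simps[of 0])
    next
      case False
      then show ?thesis
        using less.IH[of "l div 2"] by (simp add: binary.simps[of l] lg_rec)
    qed
  qed
  then have "Suc (lg l) \<le> length (encode_instance l A)"
    by (simp add: encode_instance_def encode_nats_def)
  then have "(2::nat) ^ Suc (lg l) \<le> 2 ^ length (encode_instance l A)"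
    by (rule power_increasing) simp
  then show ?thesis
    using two_power_length_code[of "encode_instance l A"] less_two_power_lg[of l] by simp
qed


section \<open>The joint action of words on two automata\<close>

lemma digits_exist:
  "(\<And>i. i < L \<Longrightarrow> f i < b) \<Longrightarrow> \<exists>y<b ^ L. \<forall>i<L. digit b y i = f i"
proof (induction L arbitrary: f)
  case (Suc L)
  obtain y where y: "y < b ^ L" "\<forall>i<L. digit b y i = f (Suc i)"
    using Suc.IH[of "\<lambda>i. f (Suc i)"] Suc.prems by auto
  have f0: "f 0 < b"
    using Suc.prems by simp
  have "y * b + f 0 < (y + 1) * b"
    using f0 by simp
  also have "\<dots> \<le> b ^ L * b"
    using y(1) by (intro mult_le_mono1) simp
  finally have "y * b + f 0 < b ^ Suc L"
    by (simp add: mult.commute)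
  moreover have "digit b (y * b + f 0) i = f i" if "i < Suc L" for i
    using that y(2) f0 by (cases i) (simp_all add: digit_0 digit_Suc)
  ultimately show ?case
    by blast
qed auto

text \<open>Only the first \<open>N\<close> digits are constrained, so a vector has several codes;
  this is harmless because later conditions read only those digits.\<close>

definition image_vector :: "nat \<Rightarrow> nat \<Rightarrow> nat \<Rightarrow> nat \<Rightarrow> nat \<Rightarrow> nat \<Rightarrow> bool" where
  "image_vector b U k N v v' \<longleftrightarrow> (\<exists>a<k. \<forall>i<N. digit b v' i = digit b U (digit b v i * k + a))"

definition constant_on :: "nat \<Rightarrow> nat \<Rightarrow> nat \<Rightarrow> nat \<Rightarrow> bool" where
  "constant_on b v lo hi \<longleftrightarrow> (\<forall>i<hi. \<forall>j<hi. lo \<le> i \<longrightarrow> lo \<le> j \<longrightarrow> digit b v i = digit b v j)"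

text \<open>
  The joint transition table of the two automata consists of the digits of \<open>U\<close> to the base \<open>b\<close>.
  The state sets are disjoint, so that the action of a word on both automata is a single vector of
  states, which is again stored as a number to the base \<open>b\<close>.
\<close>

locale automata_pair =
  fixes A B :: "(nat, nat) dfa" and n m k b U V :: nat
  assumes A: "states A = {0..<n}" "alphabet A = {0..<k}"
    and B: "states B = {n..<n + m}" "alphabet B = {0..<k}"
    and delta_A: "\<And>q a. q < n \<Longrightarrow> a < k \<Longrightarrow> delta A q a = digit b U (q * k + a)"
    and delta_B: "\<And>q a. n \<le> q \<Longrightarrow> q < n + m \<Longrightarrow> a < k \<Longrightarrow> delta B q a = digit b U (q * k + a)"
    and dfas: "is_dfa A" "is_dfa B"
    and base: "n + m \<le> b" "b ^ (n + m) \<le> V"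
begin

definition \<delta> :: "nat \<Rightarrow> nat list \<Rightarrow> nat" where
  "\<delta> q w = foldl (\<lambda>q a. digit b U (q * k + a)) q w"

lemma delta_word_A: "q < n \<Longrightarrow> w \<in> lists {0..<k} \<Longrightarrow> delta_word A q w = \<delta> q w \<and> \<delta> q w < n"
proof (induction w rule: rev_induct)
  case (snoc a w)
  then have w: "delta_word A q w = \<delta> q w" "\<delta> q w < n" "a < k"
    by auto
  moreover have "delta A (\<delta> q w) a < n"
    using dfas(1) w by (auto simp: is_dfa_def A)
  ultimately show ?case
    using delta_A[of "\<delta> q w" a] by (simp add: delta_word_def \<delta>_def)
qed (simp add: delta_word_def \<delta>_def)

lemma delta_word_B:
  "n \<le> q \<Longrightarrow> q < n + m \<Longrightarrow> w \<in> lists {0..<k} \<Longrightarrow>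
    delta_word B q w = \<delta> q w \<and> n \<le> \<delta> q w \<and> \<delta> q w < n + m"
proof (induction w rule: rev_induct)
  case (snoc a w)
  then have w: "delta_word B q w = \<delta> q w" "n \<le> \<delta> q w" "\<delta> q w < n + m" "a < k"
    by auto
  moreover have "n \<le> delta B (\<delta> q w) a \<and> delta B (\<delta> q w) a < n + m"
    using dfas(2) w by (auto simp: is_dfa_def B)
  ultimately show ?case
    using delta_B[of "\<delta> q w" a] by (simp add: delta_word_def \<delta>_def)
qed (simp add: delta_word_def \<delta>_def)

lemma \<delta>_less: "q < n + m \<Longrightarrow> w \<in> lists {0..<k} \<Longrightarrow> \<delta> q w < n + m"
  using delta_word_A[of q w] delta_word_B[of q w] by (cases "q < n") auto

definition represents_word :: "nat \<Rightarrow> nat list \<Rightarrow> bool" where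
  "represents_word v w \<longleftrightarrow> w \<in> lists {0..<k} \<and> (\<forall>i<n + m. digit b v i = \<delta> i w)"

lemma Syn_A:
  assumes "represents_word v w"
  shows "constant_on b v 0 n \<longleftrightarrow> w \<in> Syn A"
proof -
  have w: "w \<in> lists {0..<k}" and d: "\<And>i. i < n + m \<Longrightarrow> digit b v i = \<delta> i w"
    using assms by (simp_all add: represents_word_def)
  have dw: "delta_word A q w = \<delta> q w" if "q \<in> {0..<n}" for q
    using delta_word_A[OF _ w, of q] that by simp
  have "w \<in> Syn A \<longleftrightarrow> (\<forall>q\<in>{0..<n}. \<forall>q'\<in>{0..<n}. \<delta> q w = \<delta> q' w)"
    using w unfolding Syn_def A mem_Collect_eq by (simp add: dw)
  moreover have "constant_on b v 0 n \<longleftrightarrow> (\<forall>i<n. \<forall>j<n. \<delta> i w = \<delta> j w)"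
    by (simp add: constant_on_def d)
  ultimately show ?thesis
    by (simp add: atLeast0LessThan Ball_def)
qed

lemma Syn_B:
  assumes "represents_word v w"
  shows "constant_on b v n (n + m) \<longleftrightarrow> w \<in> Syn B"
proof -
  have w: "w \<in> lists {0..<k}" and d: "\<And>i. i < n + m \<Longrightarrow> digit b v i = \<delta> i w"
    using assms by (simp_all add: represents_word_def)
  have dw: "delta_word B q w = \<delta> q w" if "q \<in> {n..<n + m}" for q
    using delta_word_B[OF _ _ w, of q] that by simp
  have "w \<in> Syn B \<longleftrightarrow> (\<forall>q\<in>{n..<n + m}. \<forall>q'\<in>{n..<n + m}. \<delta> q w = \<delta> q' w)"
    using w unfolding Syn_def B mem_Collect_eq by (simp add: dw)
  moreover have "constant_on b v n (n + m) \<longleftrightarrow>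
      (\<forall>i<n + m. \<forall>j<n + m. n \<le> i \<longrightarrow> n \<le> j \<longrightarrow> \<delta> i w = \<delta> j w)"
    by (simp add: constant_on_def d)
  ultimately show ?thesis
    by (simp add: Ball_def) metis
qed

abbreviation reach :: "nat \<Rightarrow> nat \<Rightarrow> bool" where
  "reach \<equiv> reachable V (image_vector b U k (n + m))"

context
  fixes v0
  assumes v0: "v0 < V" "\<And>i. i < n + m \<Longrightarrow> digit b v0 i = i"
begin

text \<open>The identity vector \<open>v0\<close> represents the empty word, and an edge due to the
  letter \<open>a\<close> appends \<open>a\<close> to the represented word.\<close>

lemma reach_represents:
  assumes "v < V" "reach v0 v"
  shows "\<exists>w. represents_word v w"
proof -
  have "(v0, v) \<in> {(x, y). x < V \<and> y < V \<and> image_vector b U k (n + m) x y}\<^sup>*"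
    using reachable_iff[OF v0(1) assms(1)] assms(2) by blast
  then show ?thesis
  proof (induction rule: rtrancl_induct)
    case base
    have "represents_word v0 []"
      using v0(2) by (simp add: represents_word_def \<delta>_def)
    then show ?case ..
  next
    case (step x y)
    then obtain w a where w: "represents_word x w" "a < k"
      "\<forall>i<n + m. digit b y i = digit b U (digit b x i * k + a)"
      by (auto simp: image_vector_def)
    then have "represents_word y (w @ [a])"
      by (simp add: represents_word_def \<delta>_def)
    then show ?case ..
  qed
qed

text \<open>Every image vector has a code below \<open>b ^ (n + m)\<close>, hence below
  \<open>V\<close>, so the range of the search contains the vectors of all words.\<close>

lemma represents_reach:
  assumes "w \<in> lists {0..<k}"
  shows "\<exists>v<V. reach v0 v \<and> represents_word v w"
proof -
  let ?S = "{(x, y). x < V \<and> y < V \<and> image_vector b U k (n + m) x y}"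
  have "\<exists>v<V. (v0, v) \<in> ?S\<^sup>* \<and> represents_word v w"
    using assms
  proof (induction w rule: rev_induct)
    case Nil
    have "represents_word v0 []"
      using v0(2) by (simp add: represents_word_def \<delta>_def)
    then show ?case
      using v0(1) by blast
  next
    case (snoc a w)
    then have wa: "w \<in> lists {0..<k}" "a < k" "w @ [a] \<in> lists {0..<k}"
      by auto
    obtain v where v: "v < V" "(v0, v) \<in> ?S\<^sup>*" "represents_word v w"
      using snoc.IH[OF wa(1)] by blast
    obtain v' where v': "v' < b ^ (n + m)" "\<forall>i<n + m. digit b v' i = \<delta> i (w @ [a])"
      using digits_exist[of "n + m" "\<lambda>i. \<delta> i (w @ [a])" b]
        less_le_trans[OF \<delta>_less[OF _ wa(3)] base(1)] by blast
    have "v' < V"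
      using v'(1) base(2) by simp
    moreover have "image_vector b U k (n + m) v v'"
      using v' v(3) wa(2) unfolding image_vector_def
      by (intro exI[of _ a]) (simp add: represents_word_def \<delta>_def)
    ultimately have "(v, v') \<in> ?S"
      using v(1) by simp
    with v(2) have "(v0, v') \<in> ?S\<^sup>*"
      by (rule rtrancl_into_rtrancl)
    then show ?case
      using v' wa(3) \<open>v' < V\<close> by (intro exI[of _ v']) (simp add: represents_word_def)
  qed
  then show ?thesis
    using reachable_iff[OF v0(1)] by blast
qed

lemma synchronizing_iff: "synchronizing A \<longleftrightarrow> (\<exists>v<V. reach v0 v \<and> constant_on b v 0 n)"
proof
  assume "synchronizing A"
  then obtain w where "w \<in> Syn A" "w \<in> lists {0..<k}"
    by (auto simp: synchronizing_def Syn_def A)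
  then show "\<exists>v<V. reach v0 v \<and> constant_on b v 0 n"
    using represents_reach[of w] Syn_A by blast
next
  assume "\<exists>v<V. reach v0 v \<and> constant_on b v 0 n"
  then show "synchronizing A"
    using reach_represents Syn_A by (auto simp: synchronizing_def)
qed

lemma Syn_eq_iff:
  "Syn A = Syn B \<longleftrightarrow> (\<forall>v<V. reach v0 v \<longrightarrow> (constant_on b v 0 n \<longleftrightarrow> constant_on b v n (n + m)))"
proof
  assume "Syn A = Syn B"
  then show "\<forall>v<V. reach v0 v \<longrightarrow> (constant_on b v 0 n \<longleftrightarrow> constant_on b v n (n + m))"
    using reach_represents Syn_A Syn_B by blast
next
  assume *: "\<forall>v<V. reach v0 v \<longrightarrow> (constant_on b v 0 n \<longleftrightarrow> constant_on b v n (n + m))"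
  have "w \<in> Syn A \<longleftrightarrow> w \<in> Syn B" if "w \<in> lists {0..<k}" for w
    using represents_reach[OF that] * Syn_A Syn_B by blast
  moreover have "Syn A \<subseteq> lists {0..<k}" "Syn B \<subseteq> lists {0..<k}"
    by (auto simp: Syn_def A B)
  ultimately show "Syn A = Syn B"
    by blast
qed

end

end

text \<open>Moves the states of a minimal automaton behind those of the input automaton, so that the
  two state sets are disjoint.\<close>

lemma rename_states:
  fixes B :: "(nat, nat) dfa"
  assumes B: "is_dfa B"
  shows "\<exists>B' :: (nat, nat) dfa. is_dfa B' \<and> states B' = {n..<n + card (states B)} \<and>
    alphabet B' = alphabet B \<and> Syn B' = Syn B"
proof -
  have fin: "finite (states B)"
    using B by (simp add: is_dfa_def)
  obtain f where f: "bij_betw f (states B) {n..<n + card (states B)}"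
    using finite_same_card_bij[OF fin, of "{n..<n + card (states B)}"] by auto
  have inj: "inj_on f (states B)" and img: "f ` states B = {n..<n + card (states B)}"
    using f by (auto simp: bij_betw_def)
  define g where "g = inv_into (states B) f"
  have gf: "g (f q) = q" if "q \<in> states B" for q
    using that inj by (simp add: g_def)
  define B' :: "(nat, nat) dfa" where
    "B' = \<lparr>states = f ` states B, alphabet = alphabet B, delta = (\<lambda>q a. f (delta B (g q) a))\<rparr>"
  have B': "states B' = f ` states B" "alphabet B' = alphabet B"
    "\<And>q a. delta B' q a = f (delta B (g q) a)"
    by (simp_all add: B'_def)
  have "is_dfa B'"
    using B by (auto simp: is_dfa_def B' gf)
  have word: "delta_word B' (f q) w = f (delta_word B q w)"
    if "q \<in> states B" "w \<in> lists (alphabet B)" for q w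
    using that
    by (induction w arbitrary: q) (use B in \<open>auto simp: delta_word_def B' gf is_dfa_def\<close>)
  have "delta_word B' (f q) w = delta_word B' (f q') w \<longleftrightarrow> delta_word B q w = delta_word B q' w"
    if "q \<in> states B" "q' \<in> states B" "w \<in> lists (alphabet B)" for q q' w
    using that inj by (simp add: word delta_word_in_states[OF B] inj_on_eq_iff)
  then have "Syn B' = Syn B"
    unfolding Syn_def B'(1,2) by (intro Collect_cong conj_cong refl) simp
  then show ?thesis
    using \<open>is_dfa B'\<close> B' img by (intro exI[of _ B']) simp
qed

text \<open>One number serves as base for states and as bound for lengths. With \<open>n\<close> and
  \<open>n * k\<close> at most \<open>lg x\<close> and \<open>m \<le> n\<close>, both
  \<open>n + m\<close> and \<open>(n + m) * k\<close> are at most \<open>2 * lg x\<close>, hence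
  smaller than \<open>base x\<close>.\<close>

definition base :: "nat \<Rightarrow> nat" where
  "base x = 2 * lg (Suc x) + 1"

text \<open>Exceeds the joint table with its \<open>(n + m) * k\<close> digits as well as every
  vector with \<open>n + m\<close> digits. The summand 2 supplies the branching factor of at least 2
  that the game needs.\<close>

definition bound :: "nat \<Rightarrow> nat" where
  "bound x = base x ^ base x + 2"

text \<open>The instance is not parsed but guessed and compared with \<open>x\<close> after encoding
  it again. Given \<open>n * k \<le> lg x\<close> the \<open>min\<close> is just
  \<open>n * k\<close>; the cap keeps the code of the table small for those values as well that
  violate this conjunct. The closure condition on \<open>U\<close> also keeps each automaton within
  its own states.\<close>

definition small_presentation :: "nat \<Rightarrow> bool" where
  "small_presentation x \<longleftrightarrow> (\<exists>l<x. \<exists>n<base x. \<exists>k<base x. \<exists>m<base x. \<exists>U<bound x.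
     0 < l \<and> 0 < n \<and> 0 < m \<and> m \<le> l \<and> n + m \<le> base x \<and> n * k \<le> lg x \<and>
     prepend l (prepend n (prepend k (table_code (base x) U (min (n * k) (lg x))))) = x \<and>
     (\<forall>q<n + m. \<forall>a<k. digit (base x) U (q * k + a) < n + m \<and>
        (q < n \<longleftrightarrow> digit (base x) U (q * k + a) < n)) \<and>
     (\<exists>v0<bound x. (\<forall>i<n + m. digit (base x) v0 i = i) \<and>
        (\<exists>v<bound x. reachable (bound x) (image_vector (base x) U k (n + m)) v0 v \<and>
           constant_on (base x) v 0 n) \<and>
        (\<forall>v<bound x. reachable (bound x) (image_vector (base x) U k (n + m)) v0 v \<longrightarrow>
           (constant_on (base x) v 0 n \<longleftrightarrow> constant_on (base x) v n (n + m)))))"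

lemma base_power_less_bound: "i \<le> base x \<Longrightarrow> base x ^ i < bound x"
proof -
  assume "i \<le> base x"
  moreover have "1 \<le> base x"
    by (simp add: base_def)
  ultimately have "base x ^ i \<le> base x ^ base x"
    by (rule power_increasing)
  then show ?thesis
    by (simp add: bound_def)
qed

lemma small_presentation_sound:
  assumes "small_presentation (code w)"
  shows "\<exists>l A. w = encode_instance l A \<and> l > 0 \<and> is_input_dfa A \<and> synchronizing A \<and>
    rc (alphabet A) (Syn A) \<le> l"
proof -
  define x where "x = code w"
  define b where "b = base x"
  obtain l n k m U v0 where *: "0 < l" "0 < n" "0 < m" "m \<le> l" "n + m \<le> b" "n * k \<le> lg x"
    "prepend l (prepend n (prepend k (table_code b U (min (n * k) (lg x))))) = x"
    and closed: "\<forall>q<n + m. \<forall>a<k. digit b U (q * k + a) < n + m \<and> (q < n \<longleftrightarrow> digit b U (q * k + a) < n)"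
    and v0: "v0 < bound x" "\<forall>i<n + m. digit b v0 i = i"
    and sync: "\<exists>v<bound x. reachable (bound x) (image_vector b U k (n + m)) v0 v \<and> constant_on b v 0 n"
    and eq: "\<forall>v<bound x. reachable (bound x) (image_vector b U k (n + m)) v0 v \<longrightarrow>
      (constant_on b v 0 n \<longleftrightarrow> constant_on b v n (n + m))"
    using assms unfolding small_presentation_def x_def[symmetric] b_def[symmetric] by blast
  define A :: "(nat, nat) dfa" where
    "A = \<lparr>states = {0..<n}, alphabet = {0..<k}, delta = (\<lambda>q a. digit b U (q * k + a))\<rparr>"
  define B :: "(nat, nat) dfa" where
    "B = \<lparr>states = {n..<n + m}, alphabet = {0..<k}, delta = (\<lambda>q a. digit b U (q * k + a))\<rparr>"
  have closed': "digit b U (q * k + a) < n + m" "digit b U (q * k + a) < n \<longleftrightarrow> q < n"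
    if "q < n + m" "a < k" for q a
    using closed that by auto
  have dfas: "is_dfa A" "is_dfa B"
    using * closed' unfolding is_dfa_def A_def B_def by (simp_all add: not_less[symmetric])
  interpret automata_pair A B n m k b U "bound x"
    by unfold_locales (use dfas * base_power_less_bound[of "n + m" x] in
      \<open>simp_all add: A_def B_def b_def less_imp_le\<close>)
  have v0': "\<And>i. i < n + m \<Longrightarrow> digit b v0 i = i"
    using v0(2) by blast
  have A: "synchronizing A"
    using synchronizing_iff[OF v0(1) v0'] sync by blast
  have Syn: "Syn A = Syn B"
    using Syn_eq_iff[OF v0(1) v0'] eq by blast
  have "rc (alphabet A) (Syn A) \<le> m"
    unfolding rc_def
    by (rule Least_le, rule exI[of _ B]) (use dfas A Syn in \<open>simp add: A_def B_def synchronizing_def\<close>)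
  moreover have "is_input_dfa A"
    using dfas by (auto simp: is_input_dfa_def A_def)
  moreover have "code w = code (encode_instance l A)"
    using *(6,7) code_encode_instance[of A n k b U l] by (simp add: A_def x_def min_absorb1)
  ultimately show ?thesis
    using A *(1,4) code_inject by (intro exI[of _ l] exI[of _ A]) auto
qed

lemma small_presentation_complete:
  assumes l: "l > 0" and input: "is_input_dfa A" and sync: "synchronizing A"
    and rc: "rc (alphabet A) (Syn A) \<le> l"
  shows "small_presentation (code (encode_instance l A))"
proof -
  define x where "x = code (encode_instance l A)"
  define b where "b = base x"
  obtain n k where A: "states A = {0..<n}" "alphabet A = {0..<k}" "is_dfa A"
    using input unfolding is_input_dfa_def by (elim exE conjE)
  have n: "n > 0"
    using A(1,3) by (simp add: is_dfa_def)
  \<comment> \<open>Exactly the minimum is chosen: it is at most \<open>l\<close> by assumption and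
    at most \<open>n\<close> by \<open>rc_le_card_states\<close>, which brings it below
    \<open>base x\<close> however large \<open>l\<close> is.\<close>
  define m where "m = rc (alphabet A) (Syn A)"
  have ex: "\<exists>m. \<exists>B :: (nat, nat) dfa. is_dfa B \<and> alphabet B = alphabet A \<and> synchronizing B \<and>
      Syn B = Syn A \<and> card (states B) = m"
    using A(3) sync by (intro exI[of _ "card (states A)"] exI[of _ A]) simp
  have "\<exists>B :: (nat, nat) dfa. is_dfa B \<and> alphabet B = alphabet A \<and> synchronizing B \<and>
      Syn B = Syn A \<and> card (states B) = m"
    using LeastI_ex[OF ex] unfolding m_def rc_def .
  then obtain B0 :: "(nat, nat) dfa" where B0: "is_dfa B0" "alphabet B0 = alphabet A"
    "Syn B0 = Syn A" "card (states B0) = m"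
    by (elim exE conjE)
  obtain B :: "(nat, nat) dfa" where "is_dfa B" "states B = {n..<n + card (states B0)}"
    "alphabet B = alphabet B0" "Syn B = Syn B0"
    using rename_states[OF B0(1), of n] by (elim exE conjE)
  then have B: "is_dfa B" "states B = {n..<n + m}" "alphabet B = {0..<k}" "Syn B = Syn A"
    using B0 A(2) by simp_all
  note Syn_eq = B(4)
  have m: "m > 0"
    using B(1,2) by (simp add: is_dfa_def)
  have mn: "m \<le> n"
    using rc_le_card_states[OF A(3) sync] by (simp add: m_def A)
  have len: "n * k + 3 \<le> lg x"
    using length_encode_instance[of A l] length_le_lg_code[of "encode_instance l A"]
    by (simp add: A x_def)
  \<comment> \<open>The table bounds only the product \<open>n * k\<close>. Over the empty alphabet
    it is empty, but then the only word is the empty one and synchronization forces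
    \<open>n = 1\<close>.\<close>
  have nk: "n \<le> lg x \<and> k \<le> lg x"
  proof (cases "k = 0")
    case True
    obtain w where w: "w \<in> Syn A"
      using sync by (auto simp: synchronizing_def)
    then have *: "w \<in> lists {0..<k} \<and>
        (\<forall>q\<in>{0..<n}. \<forall>q'\<in>{0..<n}. delta_word A q w = delta_word A q' w)"
      unfolding Syn_def A(1,2) mem_Collect_eq .
    have "w = []"
      using *[THEN conjunct1] True by simp
    moreover have "delta_word A 0 w = delta_word A (n - 1) w"
      by (rule *[THEN conjunct2, THEN bspec, THEN bspec]) (use n in simp_all)
    ultimately have "0 = n - 1"
      by (simp add: delta_word_def)
    then show ?thesis
      using True len by simp
  next
    case False
    then have "n \<le> n * k" "k \<le> n * k"
      using n by simp_all
    then show ?thesis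
      using len by linarith
  qed
  have "lg x \<le> lg (Suc x)"
    by (rule lg_mono) simp
  moreover have "(n + m) * k \<le> 2 * (n * k)"
    using mult_le_mono1[OF mn, of k] by (simp add: add_mult_distrib)
  ultimately have b: "n < b" "k < b" "m < b" "n + m < b" "(n + m) * k < b"
    using nk len mn unfolding b_def base_def by linarith+
  have A_less: "delta A q a < n" if "q < n" "a < k" for q a
    using A(3) that unfolding is_dfa_def A(1,2) by simp
  have B_range: "n \<le> delta B q a \<and> delta B q a < n + m" if "n \<le> q" "q < n + m" "a < k" for q a
    using B(1) that unfolding is_dfa_def B(2,3) by simp
  define f where "f i = (if i div k < n then delta A (i div k) (i mod k) else delta B (i div k) (i mod k))" for i
  have f: "f (q * k + a) = (if q < n then delta A q a else delta B q a)" if "a < k" for q a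
    using that by (simp add: f_def)
  have "f i < b" if "i < (n + m) * k" for i
  proof -
    have "k > 0"
      using that by (cases k) auto
    then have "i div k < n + m" "i mod k < k"
      using that by (auto simp: div_less_iff_less_mult)
    then show ?thesis
      using A_less[of "i div k" "i mod k"] B_range[of "i div k" "i mod k"] b(4)
      by (simp add: f_def) linarith
  qed
  then obtain U where U: "U < b ^ ((n + m) * k)" "\<forall>i<(n + m) * k. digit b U i = f i"
    using digits_exist[of "(n + m) * k" f b] by blast
  have digit_U: "digit b U (q * k + a) = (if q < n then delta A q a else delta B q a)"
    if "q < n + m" "a < k" for q a
  proof -
    have "q * k + a < (q + 1) * k"
      using that(2) by simp
    also have "\<dots> \<le> (n + m) * k"
      using that(1) by (intro mult_le_mono1) simp
    finally show ?thesis
      using U(2) f[OF that(2)] by simp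
  qed
  have delta_A_digit: "delta A q a = digit b U (q * k + a)" if "q < n" "a < k" for q a
    using digit_U[of q a] that by simp
  have V: "U < bound x" "b ^ (n + m) < bound x"
    using U(1) b base_power_less_bound[of "(n + m) * k" x] base_power_less_bound[of "n + m" x]
    by (auto simp: b_def)
  interpret automata_pair A B n m k b U "bound x"
    by unfold_locales (use A B digit_U b V in simp_all)
  have "\<exists>v0<b ^ (n + m). \<forall>i<n + m. digit b v0 i = i"
    by (rule digits_exist) (use b(4) in simp)
  then obtain v0 where v0: "v0 < b ^ (n + m)" "\<forall>i<n + m. digit b v0 i = i"
    by (elim exE conjE)
  have v0': "v0 < bound x" "\<And>i. i < n + m \<Longrightarrow> digit b v0 i = i"
    using v0 V(2) by auto
  have encoding: "prepend l (prepend n (prepend k (table_code b U (min (n * k) (lg x))))) = x"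
    using code_encode_instance[OF A(1,2) delta_A_digit, of l] len by (simp add: x_def)
  have "digit b U (q * k + a) < n + m \<and> (q < n \<longleftrightarrow> digit b U (q * k + a) < n)"
    if qa: "q < n + m" "a < k" for q a
  proof (cases "q < n")
    case True
    then show ?thesis
      unfolding digit_U[OF qa] using A_less[OF True qa(2)] by simp
  next
    case False
    then show ?thesis
      unfolding digit_U[OF qa] using B_range[OF _ qa] by simp
  qed
  then have closed: "\<forall>q<n + m. \<forall>a<k. digit b U (q * k + a) < n + m \<and>
      (q < n \<longleftrightarrow> digit b U (q * k + a) < n)"
    by simp
  have reset: "\<exists>v<bound x. reach v0 v \<and> constant_on b v 0 n"
    using synchronizing_iff[OF v0'] sync by simp
  have same: "\<forall>v<bound x. reach v0 v \<longrightarrow> (constant_on b v 0 n \<longleftrightarrow> constant_on b v n (n + m))"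
    using Syn_eq_iff[OF v0'] Syn_eq by simp
  have l_less: "l < x"
    unfolding x_def by (rule less_code_encode_instance)
  have le: "m \<le> l" "n * k \<le> lg x" "n + m \<le> b"
    using rc len b by (simp_all add: m_def)
  have vectors: "\<exists>v0<bound x. (\<forall>i<n + m. digit b v0 i = i) \<and> (\<exists>v<bound x. reach v0 v \<and> constant_on b v 0 n) \<and>
      (\<forall>v<bound x. reach v0 v \<longrightarrow> (constant_on b v 0 n \<longleftrightarrow> constant_on b v n (n + m)))"
    by (rule exI[of _ v0]) (intro conjI v0'(1) v0(2) reset same)
  show ?thesis
    unfolding small_presentation_def x_def[symmetric] b_def[symmetric]
    by (rule exI[of _ l], rule conjI[OF l_less], rule exI[of _ n], rule conjI[OF b(1)],
      rule exI[of _ k], rule conjI[OF b(2)], rule exI[of _ m], rule conjI[OF b(3)],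
      rule exI[of _ U], rule conjI[OF V(1)], intro conjI l n m le encoding closed vectors)
qed

section \<open>Space bounds for the decision predicate\<close>

lemma pspace_fun_min: "pspace_fun f \<Longrightarrow> pspace_fun g \<Longrightarrow> pspace_fun (\<lambda>e. min (f e) (g e))"
  unfolding min_def by (intro pspace_intros)

text \<open>Putting one base 4 digit in front multiplies the successor of a code by at most 4;
  counting successors absorbs the digit itself.\<close>

lemma prepend_bound_aux:
  "a + 1 \<le> c * 4 ^ j \<Longrightarrow> 1 + r mod 2 + 4 * a + 1 \<le> c * 4 ^ Suc j" for a c r j :: nat
  using mod_less_divisor[of 2 r] by simp

lemma prepend_bound: "prepend n y + 1 \<le> (y + 1) * (4 * 4 ^ lg n)"
proof -
  have "i \<le> lg n \<Longrightarrow> a + 1 \<le> (4 + 4 * y) * 4 ^ (lg n - i) \<Longrightarrow>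
      down (\<lambda>i a. 1 + n div 2 ^ i mod 2 + 4 * a) i a + 1 \<le> (4 + 4 * y) * 4 ^ lg n" for i a
  proof (induction i arbitrary: a)
    case (Suc i)
    then show ?case
      using prepend_bound_aux[of a "4 + 4 * y" "lg n - Suc i" "n div 2 ^ i"] Suc_diff_Suc[of i "lg n"]
      by (simp del: power_Suc)
  qed simp
  from this[of "lg n" "3 + 4 * y"] show ?thesis
    by (simp add: prepend_def algebra_simps)
qed

lemma pspace_fun_prepend:
  assumes f: "pspace_fun f" and g: "pspace_fun g"
  shows "pspace_fun (\<lambda>e. prepend (f e) (g e))"
  unfolding prepend_def
proof (rule pspace_fun_down[where I = "\<lambda>e i a. a + 1 \<le> (4 + 4 * g e) * 4 ^ (lg (f e) - i)"
      and b = "\<lambda>e. (4 + 4 * g e) * 4 ^ lg (f e)"])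
  show "pspace_fun (\<lambda>e. 1 + f (\<lambda>j. e (Suc (Suc j))) div 2 ^ e 0 mod 2 + 4 * e (Suc 0))"
    by (intro pspace_intros pspace_fun_rename[OF f])
  show "size_bounded (\<lambda>e. (4 + 4 * g e) * 4 ^ lg (f e))"
    by (intro size_bounded_mult size_bounded_add size_bounded_power_lg size_bounded_const
        pspace_fun_size_bounded f g)
  fix e :: "nat \<Rightarrow> nat" and i a
  show "1 + f e div 2 ^ i mod 2 + 4 * a + 1 \<le> (4 + 4 * g e) * 4 ^ (lg (f e) - i)"
    if "i < lg (f e)" "a + 1 \<le> (4 + 4 * g e) * 4 ^ (lg (f e) - Suc i)"
    using prepend_bound_aux[OF that(2), of "f e div 2 ^ i"] Suc_diff_Suc[OF that(1)] by simp
  show "a \<le> (4 + 4 * g e) * 4 ^ lg (f e)" if "a + 1 \<le> (4 + 4 * g e) * 4 ^ (lg (f e) - i)"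
  proof -
    have "(4 + 4 * g e) * 4 ^ (lg (f e) - i) \<le> (4 + 4 * g e) * 4 ^ lg (f e)"
      by (intro mult_le_mono2 power_increasing) auto
    then show ?thesis
      using that by linarith
  qed
  show "pspace_fun (\<lambda>e. lg (f e))" "pspace_fun (\<lambda>e. 3 + 4 * g e)"
    by (intro pspace_intros f g)+
qed simp

text \<open>Each of at most \<open>lg (g e)\<close> entries is a digit of \<open>U e\<close> and so
  at most \<open>U e\<close>; prepending it multiplies the successor of the code by at most
  \<open>4 * 4 ^ lg (U e)\<close>.\<close>

lemma pspace_fun_table_code:
  assumes b: "pspace_fun b" and U: "pspace_fun U" and L: "pspace_fun L" and g: "pspace_fun g"
  shows "pspace_fun (\<lambda>e. table_code (b e) (U e) (min (L e) (lg (g e))))"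
  unfolding table_code_def
proof (rule pspace_fun_down[where I = "\<lambda>e i a. a + 1 \<le> (4 * 4 ^ lg (U e)) ^ (min (L e) (lg (g e)) - i)"
      and b = "\<lambda>e. (4 * 4 ^ lg (U e)) ^ lg (g e)"])
  show "pspace_fun (\<lambda>e. prepend (digit (b (\<lambda>j. e (Suc (Suc j)))) (U (\<lambda>j. e (Suc (Suc j)))) (e 0)) (e (Suc 0)))"
    by (intro pspace_fun_prepend pspace_intros pspace_fun_rename[OF b] pspace_fun_rename[OF U])
  show "size_bounded (\<lambda>e. (4 * 4 ^ lg (U e)) ^ lg (g e))"
    by (intro size_bounded_mult size_bounded_power_lg size_bounded_const pspace_fun_size_bounded U g)
  fix e :: "nat \<Rightarrow> nat" and i a
  let ?c = "4 * 4 ^ lg (U e) :: nat" and ?n = "min (L e) (lg (g e))"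
  show "prepend (digit (b e) (U e) i) a + 1 \<le> ?c ^ (?n - i)"
    if "i < ?n" "a + 1 \<le> ?c ^ (?n - Suc i)"
  proof -
    have "(4::nat) ^ lg (digit (b e) (U e) i) \<le> 4 ^ lg (U e)"
      by (intro power_increasing lg_mono digit_le) simp
    then have "prepend (digit (b e) (U e) i) a + 1 \<le> (a + 1) * ?c"
      using prepend_bound[of "digit (b e) (U e) i" a] by (meson le_trans mult_le_mono2)
    also have "\<dots> \<le> ?c ^ (?n - Suc i) * ?c"
      using that(2) by (rule mult_le_mono1)
    also have "\<dots> = ?c ^ (?n - i)"
      using Suc_diff_Suc[OF that(1)] by (metis power_Suc2)
    finally show ?thesis .
  qed
  show "a \<le> ?c ^ lg (g e)" if "a + 1 \<le> ?c ^ (?n - i)"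
  proof -
    have "?c ^ (?n - i) \<le> ?c ^ lg (g e)"
      by (rule power_increasing) auto
    then show ?thesis
      using that by linarith
  qed
  show "pspace_fun (\<lambda>e. min (L e) (lg (g e)))"
    by (intro pspace_fun_min pspace_fun_lg L g)
qed (simp_all add: pspace_fun_const)

lemma pspace_fun_base: "pspace_fun f \<Longrightarrow> pspace_fun (\<lambda>e. base (f e))"
  unfolding base_def by (intro pspace_intros)

lemma pspace_fun_bound:
  assumes "pspace_fun f"
  shows "pspace_fun (\<lambda>e. bound (f e))"
proof -
  have "pspace_fun (\<lambda>e. base (f e) ^ base (f e))"
  proof (rule pspace_fun_power_lg)
    fix e
    \<comment> \<open>Here the successor in \<open>base\<close> pays off:
      \<open>2 * j + 1 \<le> 4 * j\<close> holds for all positive \<open>j\<close>, but not for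
      0.\<close>
    have "lg (Suc (f e)) \<noteq> 0"
      by simp
    then show "base (f e) \<le> 4 * lg (Suc (f e))"
      unfolding base_def by linarith
  qed (intro pspace_fun_base pspace_fun_Suc assms)+
  then show ?thesis
    unfolding bound_def by (intro pspace_fun_add pspace_fun_const)
qed

lemma pspace_pred_small_presentation: "pspace_pred (\<lambda>e. small_presentation (e 0))"
  unfolding small_presentation_def image_vector_def constant_on_def
  by (intro pspace_pred_bex pspace_pred_ball pspace_pred_conj pspace_pred_imp pspace_pred_iff
      pspace_pred_eq pspace_pred_le pspace_pred_less pspace_fun_prepend pspace_fun_table_code
      pspace_pred_reachable pspace_fun_base pspace_fun_bound pspace_fun_digit pspace_fun_add
      pspace_fun_mult pspace_fun_lg pspace_fun_var pspace_fun_const) (simp_all add: bound_def)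

theorem proposition1:
  "{encode_instance l A | l A.
      l > 0 \<and> is_input_dfa A \<and> synchronizing A \<and> rc (alphabet A) (Syn A) \<le> l} \<in> PSPACE"
proof -
  have "{encode_instance l A | l A.
      l > 0 \<and> is_input_dfa A \<and> synchronizing A \<and> rc (alphabet A) (Syn A) \<le> l} =
    {w. of_bool (small_presentation (code w)) > (0 :: nat)}"
    using small_presentation_sound small_presentation_complete by auto
  also have "\<dots> \<in> PSPACE"
    by (rule pspace_fun_in_PSPACE[OF pspace_pred_small_presentation[unfolded pspace_pred_def]])
  finally show ?thesis .
qed

end
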